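(* Let $k\geq 1$ be an integer. Let $f$ and $g$ be transcendental meromorphic functions on $\mathbb{C}$ such that $N(r,f)+N(r,1/f)=S(r,f)$ and $N(r,g)+N(r,1/g)=S(r,g)$. Let $a(z)$ be a meromorphic function, not identically zero, which is a small function of both $f$ and $g$, i.e. $T(r,a)=S(r,f)$ and $T(r,a)=S(r,g)$. Then at least one of the two functions $f^{2}(z)g^{(k)}(z)-a(z)$ and $g^{2}(z)f^{(k)}(z)-a(z)$ has infinitely many zeros.
   Context: Standard Nevanlinna theory notation is used: for a meromorphic function $f$ on $\mathbb{C}$, $N(r,f)$ is the integrated counting function of poles (with multiplicity), $m(r,f)$ the proximity function, and $T(r,f)=m(r,f)+N(r,f)$ the characteristic function. $S(r,f)$ denotes any quantity of growth $o(T(r,f))$ as $r\to\infty$, outside a possible exceptional set of finite linear measure. A meromorphic function $a$ is a small function of $f$ if $T(r,a)=S(r,f)$. $h^{(k)}$ denotes the $k$th derivative of $h$. *)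

theory Defs
  imports
    "HOL-Complex_Analysis.Complex_Analysis"
    "HOL-Library.Landau_Symbols"
begin

text \<open>
  A meromorphic function on the complex plane is a function \<open>f :: complex \<Rightarrow> complex\<close> with
  \<open>f meromorphic_on UNIV\<close>. Its values on a discrete closed set (in particular at its poles) are
  arbitrary. All notions below are insensitive to these values: poles, orders and zeros
  are read off from punctured neighbourhoods, and identities between meromorphic functions are
  stated outside a sparse set (\<open>\<forall>\<^sub>\<approx>\<close>).
\<close>

definition rational_function :: "(complex \<Rightarrow> complex) \<Rightarrow> bool" where
  "rational_function f \<longleftrightarrow>
     (\<exists>p q. q \<noteq> 0 \<and> (\<forall>\<^sub>\<approx>z\<in>UNIV. f z = poly p z / poly q z))"

definition transcendental_meromorphic :: "(complex \<Rightarrow> complex) \<Rightarrow> bool" where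
  "transcendental_meromorphic f \<longleftrightarrow> f meromorphic_on UNIV \<and> \<not> rational_function f"

text \<open>The number \<open>n(r, f)\<close> of poles in the closed disc of radius \<open>r\<close>, with multiplicity.\<close>

definition pole_count :: "real \<Rightarrow> (complex \<Rightarrow> complex) \<Rightarrow> nat" where
  "pole_count r f = (\<Sum>z | norm z \<le> r \<and> is_pole f z. nat (- zorder f z))"

text \<open>
  \<open>N(r, f)\<close>, for \<open>r > 0\<close>. The integrand vanishes for all sufficiently small \<open>t\<close>.
\<close>

definition nevanlinna_N :: "real \<Rightarrow> (complex \<Rightarrow> complex) \<Rightarrow> real" where
  "nevanlinna_N r f =
     integral {0..r} (\<lambda>t. (real (pole_count t f) - real (pole_count 0 f)) / t)
     + real (pole_count 0 f) * ln r"

definition log_plus :: "real \<Rightarrow> real" where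
  "log_plus x = ln (max 1 x)"

definition nevanlinna_m :: "real \<Rightarrow> (complex \<Rightarrow> complex) \<Rightarrow> real" where
  "nevanlinna_m r f =
     1 / (2 * pi) * integral {0..2 * pi} (\<lambda>\<theta>. log_plus (norm (f (of_real r * cis \<theta>))))"

definition nevanlinna_T :: "real \<Rightarrow> (complex \<Rightarrow> complex) \<Rightarrow> real" where
  "nevanlinna_T r f = nevanlinna_m r f + nevanlinna_N r f"

text \<open>
  The class \<open>S(r, f)\<close>: \<open>o(T(r, f))\<close> as \<open>r\<close> tends to infinity outside an exceptional set \<open>E\<close>;
  \<open>lmeasurable\<close> sets are the Lebesgue measurable sets of finite measure.
\<close>

definition nevanlinna_S :: "(complex \<Rightarrow> complex) \<Rightarrow> (real \<Rightarrow> real) set" where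
  "nevanlinna_S f =
     {\<phi>. \<exists>E\<in>lmeasurable. \<phi> \<in> o[inf at_top (principal (- E))](\<lambda>r. nevanlinna_T r f)}"

definition small_function :: "(complex \<Rightarrow> complex) \<Rightarrow> (complex \<Rightarrow> complex) \<Rightarrow> bool" where
  "small_function a f \<longleftrightarrow>
     a meromorphic_on UNIV \<and> (\<lambda>r. nevanlinna_T r a) \<in> nevanlinna_S f"

text \<open>
  Zeros are defined by the limit value rather than by \<open>h z = 0\<close>, since an expression built
  from meromorphic functions may have an arbitrary value at a pole of one of its constituents.
\<close>

definition zeros_of :: "(complex \<Rightarrow> complex) \<Rightarrow> complex set" where
  "zeros_of h = {z. h \<midarrow>z\<rightarrow> 0}"

end

theory Submission
  imports Defs
begin

text \<open>
  Put \<open>\<tau> = T(r, f) + T(r, g)\<close>. The functions \<open>h\<close> with \<open>T(r, h) = o(\<tau>)\<close> form a field. By the lemma on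
  the logarithmic derivative, this field contains \<open>h' / h\<close> for every \<open>h\<close> with few zeros and poles and
  \<open>T(r, h) = O(\<tau>)\<close>; hence it contains \<open>g\<^sup>(\<^sup>k\<^sup>) / g\<close>. If \<open>f\<^sup>2 g\<^sup>(\<^sup>k\<^sup>) - a\<close> has finitely many zeros, then
  \<open>H = f\<^sup>2 g\<^sup>(\<^sup>k\<^sup>) / a\<close> and \<open>H - 1\<close> both have few zeros and poles, and \<open>H\<close> is recovered from the logarithmic
  derivatives of \<open>H\<close> and \<open>H - 1\<close>; so \<open>H\<close>, and with it \<open>f\<^sup>2 g\<close>, lies in the field. If the same holds for
  \<open>g\<^sup>2 f\<close>, the field contains \<open>f\<^sup>3 = (f\<^sup>2 g)\<^sup>2 / (g\<^sup>2 f)\<close> and \<open>g\<^sup>3\<close>, so \<open>\<tau> = o(\<tau>)\<close>, which is absurd.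

  All estimates are made at radii \<open>r\<close> for which the functions involved are analytic and nonzero on the
  circle of radius \<open>r\<close>. Only countably many radii are lost, and the integrands are continuous.
\<close>

section \<open>Circle means and the Poisson kernel\<close>

text \<open>\<open>f\<close> and \<open>g\<close> need not grow at comparable rates, so o(T(r, f))
  and o(T(r, g)) are different classes; the sum \<tau> dominates both characteristics and lets every
  error be measured against one function. Transcendence enters as ln r = o(T(r, f)), hence
  o(\<tau>): finitely many zeros contribute O(ln r) to N and so count as few. Cubes are enough at
  the end because m(r, f^3) = 3 m(r, f), while N(r, f) is small by hypothesis.

  The analysis rests on one device: on a disc whose boundary is free of zeros and poles, a
  meromorphic function is a finite Blaschke product times the exponential of a holomorphic function.
  The product has modulus 1 on the boundary, so the Poisson and Cauchy formulas are only ever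
  applied to holomorphic functions, and zeros and poles enter through explicit rational factors.

  Each hypothesis brings its own exceptional set of radii and the estimates add more; the filter
  \<open>nev_filter\<close> absorbs them all. It is proper and \<tau> is unbounded along it, which
  is what makes the final relation absurd.\<close>

definition circle_mean :: "real \<Rightarrow> (complex \<Rightarrow> 'a :: euclidean_space) \<Rightarrow> 'a" where
  "circle_mean r u = (1 / (2 * pi)) *\<^sub>R integral {0..2 * pi} (\<lambda>\<theta>. u (of_real r * cis \<theta>))"

lemma continuous_on_circle:
  assumes "continuous_on (sphere 0 r) u" "r \<ge> 0"
  shows "continuous_on S (\<lambda>\<theta>. u (of_real r * cis \<theta>))"
  by (rule continuous_on_compose2[OF assms(1)])
     (use assms(2) in \<open>auto intro!: continuous_intros simp: norm_mult\<close>)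

lemma circle_integrable:
  fixes u :: "complex \<Rightarrow> 'a :: banach"
  assumes "continuous_on (sphere 0 r) u" "r \<ge> 0"
  shows "(\<lambda>\<theta>. u (of_real r * cis \<theta>)) integrable_on {a..b}"
  by (rule integrable_continuous_real, rule continuous_on_circle[OF assms])

lemma circle_mean_cong:
  assumes "\<And>w. norm w = r \<Longrightarrow> u w = v w" "r \<ge> 0"
  shows "circle_mean r u = circle_mean r v"
  unfolding circle_mean_def
  by (intro arg_cong[where f = "\<lambda>x. _ *\<^sub>R x"] integral_cong) (use assms in \<open>auto simp: norm_mult\<close>)

lemma circle_mean_add:
  assumes "continuous_on (sphere 0 r) u" "continuous_on (sphere 0 r) v" "r \<ge> 0"
  shows "circle_mean r (\<lambda>w. u w + v w) = circle_mean r u + circle_mean r v"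
  unfolding circle_mean_def
  by (subst Henstock_Kurzweil_Integration.integral_add) (use assms in \<open>auto intro!: circle_integrable simp: scaleR_add_right\<close>)

lemma circle_mean_sum:
  assumes "\<And>i. i \<in> I \<Longrightarrow> continuous_on (sphere 0 r) (u i)" "r \<ge> 0" "finite I"
  shows "circle_mean r (\<lambda>w. \<Sum>i\<in>I. u i w) = (\<Sum>i\<in>I. circle_mean r (u i))"
  unfolding circle_mean_def
  by (subst Henstock_Kurzweil_Integration.integral_sum) (use assms in \<open>auto intro!: circle_integrable simp: scaleR_sum_right\<close>)

lemma circle_mean_bounded_linear:
  assumes "bounded_linear h" "continuous_on (sphere 0 r) u" "r \<ge> 0"
  shows "circle_mean r (\<lambda>w. h (u w)) = h (circle_mean r u)"
proof -
  interpret bounded_linear h by fact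
  have "integral {0..2*pi} (h \<circ> (\<lambda>\<theta>. u (of_real r * cis \<theta>))) = h (integral {0..2*pi} (\<lambda>\<theta>. u (of_real r * cis \<theta>)))"
    by (rule integral_linear) (use assms in \<open>auto intro!: circle_integrable\<close>)
  thus ?thesis unfolding circle_mean_def by (simp add: o_def scaleR)
qed

lemma circle_mean_cmult:
  fixes u :: "complex \<Rightarrow> real"
  assumes "continuous_on (sphere 0 r) u" "r \<ge> 0"
  shows "circle_mean r (\<lambda>w. c * u w) = c * circle_mean r u"
  by (rule circle_mean_bounded_linear[OF bounded_linear_mult_right assms])

lemma circle_mean_const [simp]: "circle_mean r (\<lambda>_. c) = c"
  by (simp add: circle_mean_def)

lemma circle_mean_mono:
  fixes u v :: "complex \<Rightarrow> real"
  assumes "continuous_on (sphere 0 r) u" "continuous_on (sphere 0 r) v" "r \<ge> 0"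
    and "\<And>w. norm w = r \<Longrightarrow> u w \<le> v w"
  shows "circle_mean r u \<le> circle_mean r v"
  unfolding circle_mean_def real_scaleR_def
  by (intro mult_left_mono integral_le circle_integrable) (use assms in \<open>auto simp: norm_mult\<close>)

lemma norm_circle_mean_le:
  assumes "continuous_on (sphere 0 r) u" "continuous_on (sphere 0 r) v" "r \<ge> 0"
    and "\<And>w. norm w = r \<Longrightarrow> norm (u w) \<le> v w"
  shows "norm (circle_mean r u) \<le> circle_mean r v"
proof -
  have "norm (integral {0..2*pi} (\<lambda>\<theta>. u (of_real r * cis \<theta>))) \<le> integral {0..2*pi} (\<lambda>\<theta>. v (of_real r * cis \<theta>))"
    by (rule integral_norm_bound_integral) (use assms in \<open>auto intro!: circle_integrable simp: norm_mult\<close>)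
  thus ?thesis unfolding circle_mean_def by (simp add: divide_right_mono)
qed

lemma circle_mean_swap:
  fixes k :: "complex \<Rightarrow> complex \<Rightarrow> real"
  assumes "continuous_on (sphere 0 r \<times> sphere 0 s) (\<lambda>(z, w). k z w)" "r \<ge> 0" "s \<ge> 0"
  shows "circle_mean r (\<lambda>z. circle_mean s (\<lambda>w. k z w)) = circle_mean s (\<lambda>w. circle_mean r (\<lambda>z. k z w))"
proof -
  have c: "continuous_on (cbox (0, 0) (2*pi, 2*pi)) (\<lambda>(x, y). k (of_real r * cis x) (of_real s * cis y))"
    unfolding case_prod_beta
    by (rule continuous_on_compose2[OF assms(1), where f = "\<lambda>p. (of_real r * cis (fst p), of_real s * cis (snd p))", simplified])
       (use assms(2,3) in \<open>auto intro!: continuous_intros simp: norm_mult\<close>)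
  have "integral {0..2*pi} (\<lambda>x. integral {0..2*pi} (\<lambda>y. k (of_real r * cis x) (of_real s * cis y)))
      = integral {0..2*pi} (\<lambda>y. integral {0..2*pi} (\<lambda>x. k (of_real r * cis x) (of_real s * cis y)))"
    using integral_swap_continuous[OF c] by simp
  thus ?thesis unfolding circle_mean_def by simp
qed

text \<open>On the circle dw = \<i> w d\<theta>, so a contour integral divided by 2 pi \<i> is the
  mean of the integrand times \<open>w\<close>.\<close>

lemma circle_mean_contour_integral:
  assumes "(F has_contour_integral (2 * of_real pi * \<i> * L)) (circlepath 0 R)"
  shows "circle_mean R (\<lambda>w. F w * w) = L"
proof -
  have "((\<lambda>x. F (of_real R * cis x) * of_real R * \<i> * cis x) has_integral (2 * of_real pi * \<i> * L)) {0..2*pi}"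
    using assms unfolding circlepath_def
    by (subst (asm) has_contour_integral_part_circlepath_iff) (auto simp: cis_conv_exp mult_ac)
  hence "((\<lambda>x. (1 / \<i>) * (F (of_real R * cis x) * of_real R * \<i> * cis x)) has_integral
      ((1 / \<i>) * (2 * of_real pi * \<i> * L))) {0..2*pi}"
    by (rule has_integral_mult_right)
  also have "(\<lambda>x. (1 / \<i>) * (F (of_real R * cis x) * of_real R * \<i> * cis x))
     = (\<lambda>x. F (of_real R * cis x) * (of_real R * cis x))"
    by (auto simp: fun_eq_iff mult_ac)
  finally have "integral {0..2*pi} (\<lambda>x. F (of_real R * cis x) * (of_real R * cis x)) = (1 / \<i>) * (2 * of_real pi * \<i> * L)"
    by (rule integral_unique)
  thus ?thesis unfolding circle_mean_def by (simp add: scaleR_conv_of_real)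
qed

lemma continuous_on_sphere_holomorphic:
  fixes \<phi> :: "complex \<Rightarrow> complex"
  assumes "\<phi> holomorphic_on ball 0 R'" "R < R'"
  shows "continuous_on (sphere 0 R) \<phi>"
  using holomorphic_on_imp_continuous_on[OF assms(1)] by (rule continuous_on_subset) (use assms(2) in auto)

lemma circle_mean_Cauchy:
  assumes "G holomorphic_on ball 0 R'" "0 < R" "R < R'" "norm z < R"
  shows "circle_mean R (\<lambda>w. G w * (w / (w - z))) = G z"
proof -
  have "((\<lambda>u. G u / (u - z)) has_contour_integral (2 * of_real pi * \<i> * G z)) (circlepath 0 R)"
    by (rule Cauchy_integral_circlepath_simple)
       (use assms in \<open>auto intro!: holomorphic_on_subset[OF assms(1)]\<close>)
  thus ?thesis using circle_mean_contour_integral[of "\<lambda>u. G u / (u - z)" "G z" R] by simp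
qed

lemma circle_mean_holomorphic:
  assumes "G holomorphic_on ball 0 R'" "0 < R" "R < R'"
  shows "circle_mean R G = G 0"
proof -
  have "circle_mean R G = circle_mean R (\<lambda>w. G w * (w / (w - 0)))"
    by (rule circle_mean_cong) (use assms in auto)
  thus ?thesis using circle_mean_Cauchy[OF assms, of 0] assms by simp
qed

text \<open>The factor 1 / (2 pi) of the usual Poisson kernel sits in
  \<open>circle_mean\<close>.\<close>

definition poisson :: "real \<Rightarrow> complex \<Rightarrow> complex \<Rightarrow> real" where
  "poisson R z w = (R\<^sup>2 - (norm z)\<^sup>2) / (norm (w - z))\<^sup>2"

lemma poisson_eq_Re:
  assumes "norm w = R" "norm z < R"
  shows "poisson R z w = Re ((w + z) / (w - z))"
proof -
  have "Re ((w + z) / (w - z)) = Re ((w + z) * cnj (w - z)) / (norm (w - z))\<^sup>2"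
    by (simp add: complex_div_cnj[of "w+z"] Re_divide_of_real del: complex_cnj_diff)
  also have "Re ((w + z) * cnj (w - z)) = (norm w)\<^sup>2 - (norm z)\<^sup>2"
    by (simp only: cmod_power2) (simp add: algebra_simps power2_eq_square)
  finally show ?thesis unfolding poisson_def using assms by simp
qed

lemma poisson_nonneg: "norm z \<le> R \<Longrightarrow> 0 \<le> poisson R z w"
  unfolding poisson_def by (intro divide_nonneg_nonneg) (auto intro: power_mono)

lemma poisson_le:
  assumes "norm w = R" "norm z < R"
  shows "poisson R z w \<le> (R + norm z) / (R - norm z)"
proof -
  have "R - norm z \<le> norm (w - z)" using assms norm_triangle_ineq2[of w z] by simp
  hence "(R - norm z)\<^sup>2 \<le> (norm (w - z))\<^sup>2" using assms by (intro power_mono) auto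
  hence "poisson R z w \<le> (R\<^sup>2 - (norm z)\<^sup>2) / (R - norm z)\<^sup>2"
    unfolding poisson_def using assms
    by (intro divide_left_mono mult_pos_pos zero_less_power) (auto intro: power_mono)
  also have "\<dots> = (R + norm z) / (R - norm z)"
    using assms by (simp add: power2_eq_square square_diff_square_factored)
  finally show ?thesis .
qed

text \<open>The second summand is the conjugate of z / (w - z). On the circle R^2 = w cnj w, which
  allows it to be rewritten without cnj w, hence as a holomorphic function of
  \<open>w\<close>.\<close>

lemma poisson_eq_sum:
  assumes "norm w = R" "norm z < R"
  shows "of_real (poisson R z w) = w / (w - z) + cnj z * w / (of_real (R\<^sup>2) - cnj z * w)"
proof -
  have R: "of_real (R\<^sup>2) = w * cnj w" using assms by (simp add: complex_norm_square[symmetric] of_real_power)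
  have w: "w \<noteq> 0" "w - z \<noteq> 0" "cnj w - cnj z \<noteq> 0" using assms by (auto simp flip: complex_cnj_diff)
  have "cnj z * w / (of_real (R\<^sup>2) - cnj z * w) = cnj z * w / ((cnj w - cnj z) * w)"
    unfolding R by (simp add: algebra_simps)
  also have "\<dots> = cnj z / (cnj w - cnj z)" using w by simp
  finally have 1: "w / (w - z) + cnj z * w / (of_real (R\<^sup>2) - cnj z * w) = w / (w - z) + cnj z / (cnj w - cnj z)"
    by simp
  have "of_real (poisson R z w) = (w * cnj w - z * cnj z) / ((w - z) * cnj (w - z))"
    unfolding poisson_def using assms
    by (simp add: complex_norm_square[symmetric] of_real_power del: complex_cnj_diff)
  also have "\<dots> = w / (w - z) + cnj z / (cnj w - cnj z)"
    using w by (simp add: field_simps)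
  finally show ?thesis using 1 by simp
qed

lemma cnj_mult_bound:
  assumes "norm z < R" "norm w < R\<^sup>2 / norm z \<or> z = 0" "0 < R"
  shows "of_real (R\<^sup>2) - cnj z * w \<noteq> 0"
proof
  assume "of_real (R\<^sup>2) - cnj z * w = 0"
  hence eq: "cnj z * w = of_real (R\<^sup>2)" by simp
  hence "norm (cnj z * w) = R\<^sup>2" by (simp add: norm_power)
  hence "norm z * norm w = R\<^sup>2" by (simp add: norm_mult)
  moreover have "z \<noteq> 0" using eq assms(3) by auto
  ultimately show False using assms by (auto simp: field_simps)
qed

text \<open>The denominator vanishes only at the reflection of \<open>z\<close> in the circle of
  radius \<open>R\<close>. That point lies strictly outside the closed disc, so a slightly larger
  disc still avoids it.\<close>

lemma reflected_radius:
  assumes "norm z < R" "0 < R" "R < R'"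
  obtains R2 where "R < R2" "R2 \<le> R'" "\<And>w. norm w < R2 \<Longrightarrow> of_real (R\<^sup>2) - cnj z * w \<noteq> 0"
proof (cases "z = 0")
  case True thus ?thesis using assms that[of R'] by auto
next
  case False
  show ?thesis
  proof (rule that[of "min R' (R\<^sup>2 / norm z)"])
    show "R < min R' (R\<^sup>2 / norm z)"
      using assms False by (auto simp: field_simps power2_eq_square)
    show "of_real (R\<^sup>2) - cnj z * w \<noteq> 0" if "norm w < min R' (R\<^sup>2 / norm z)" for w
      using that cnj_mult_bound[OF assms(1) _ assms(2)] by auto
  qed auto
qed

text \<open>On \<open>norm w = R\<close> the Poisson kernel is the Cauchy kernel plus a function of \<open>w\<close> that is holomorphic in
  the disc and vanishes at 0.\<close>

lemma poisson_formula_complex: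
  assumes "\<phi> holomorphic_on ball 0 R'" "0 < R" "R < R'" "norm z < R"
  shows "circle_mean R (\<lambda>w. \<phi> w * of_real (poisson R z w)) = \<phi> z"
proof -
  obtain R2 where R2: "R < R2" "R2 \<le> R'" "\<And>w. norm w < R2 \<Longrightarrow> of_real (R\<^sup>2) - cnj z * w \<noteq> 0"
    using reflected_radius[OF assms(4,2,3)] by blast
  define G where "G w = \<phi> w * (cnj z * w / (of_real (R\<^sup>2) - cnj z * w))" for w
  have hol: "\<phi> holomorphic_on ball 0 R2" by (rule holomorphic_on_subset[OF assms(1)]) (use R2 in auto)
  have G: "G holomorphic_on ball 0 R2"
    unfolding G_def by (intro holomorphic_intros hol) (use R2 in auto)
  note cs = continuous_on_sphere_holomorphic[OF _ R2(1)]
  have "circle_mean R (\<lambda>w. \<phi> w * of_real (poisson R z w)) = circle_mean R (\<lambda>w. \<phi> w * (w / (w - z)) + G w)"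
    by (rule circle_mean_cong) (use assms in \<open>auto simp: poisson_eq_sum G_def algebra_simps\<close>)
  also have "\<dots> = circle_mean R (\<lambda>w. \<phi> w * (w / (w - z))) + circle_mean R G"
    by (rule circle_mean_add) (use assms in \<open>auto intro!: continuous_intros cs[OF hol] cs[OF G]\<close>)
  also have "circle_mean R G = 0"
    using circle_mean_holomorphic[OF G] assms R2 by (simp add: G_def)
  also have "circle_mean R (\<lambda>w. \<phi> w * (w / (w - z))) = \<phi> z"
    by (rule circle_mean_Cauchy) (use assms in auto)
  finally show ?thesis by simp
qed

lemma continuous_on_poisson [continuous_intros]:
  assumes "norm z < R" shows "continuous_on (sphere 0 R) (\<lambda>w. poisson R z w)"
  unfolding poisson_def by (intro continuous_intros) (use assms in auto)

lemma poisson_formula: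
  assumes "\<phi> holomorphic_on ball 0 R'" "0 < R" "R < R'" "norm z < R"
  shows "circle_mean R (\<lambda>w. Re (\<phi> w) * poisson R z w) = Re (\<phi> z)"
proof -
  have "continuous_on (sphere 0 R) \<phi>" by (rule continuous_on_sphere_holomorphic[OF assms(1,3)])
  hence "circle_mean R (\<lambda>w. Re (\<phi> w * of_real (poisson R z w))) = Re (circle_mean R (\<lambda>w. \<phi> w * of_real (poisson R z w)))"
    by (intro circle_mean_bounded_linear bounded_linear_Re continuous_intros) (use assms in auto)
  thus ?thesis using poisson_formula_complex[OF assms] by simp
qed

text \<open>Here the pole \<open>w\<close> is fixed and the mean runs over \<open>z\<close>: the
  kernel is the real part of (w + z) / (w - z), which is holomorphic in \<open>z\<close> and equals
  1 at the origin.\<close>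

lemma circle_mean_poisson:
  assumes "norm w = R" "0 < r" "r < R"
  shows "circle_mean r (\<lambda>z. poisson R z w) = 1"
proof -
  define G where "G z = (w + z) / (w - z)" for z
  have w: "w \<noteq> 0" using assms by auto
  have G: "G holomorphic_on ball 0 R" unfolding G_def
    by (intro holomorphic_intros) (use assms in auto)
  note cG = continuous_on_sphere_holomorphic[OF G assms(3)]
  have "circle_mean r (\<lambda>z. poisson R z w) = circle_mean r (\<lambda>z. Re (G z))"
    by (rule circle_mean_cong) (use assms in \<open>auto simp: poisson_eq_Re G_def\<close>)
  also have "\<dots> = Re (circle_mean r G)"
    by (rule circle_mean_bounded_linear[OF bounded_linear_Re cG]) (use assms in auto)
  also have "circle_mean r G = 1"
    using circle_mean_holomorphic[OF G assms(2,3)] w by (simp add: G_def)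
  finally show ?thesis by simp
qed

text \<open>A derivative has to be bounded from the real part alone, because in the applications
  only Re \<phi> = ln |h| is known on the circle. Cauchy's formula expresses it through \<phi>;
  adding the conjugate of a function of mean 0 turns \<phi> into 2 Re \<phi>.\<close>

lemma deriv_eq_circle_mean:
  assumes "\<phi> holomorphic_on ball 0 R'" "0 < R" "R < R'" "norm z < R"
  shows "deriv \<phi> z = circle_mean R (\<lambda>w. of_real (2 * Re (\<phi> w)) * (w / (w - z)\<^sup>2))"
proof -
  obtain R2 where R2: "R < R2" "R2 \<le> R'" "\<And>w. norm w < R2 \<Longrightarrow> of_real (R\<^sup>2) - cnj z * w \<noteq> 0"
    using reflected_radius[OF assms(4,2,3)] by blast
  \<comment> \<open>Chosen holomorphic with \<open>G 0 = 0\<close>, hence of mean 0, and such that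
    on the circle, where R^2 = w cnj w, its conjugate is cnj (\<phi> w) times the same kernel w / (w
    - z)^2.\<close>
  define G where "G w = \<phi> w * (of_real (R\<^sup>2) * w / (of_real (R\<^sup>2) - cnj z * w)\<^sup>2)" for w
  have hol: "\<phi> holomorphic_on ball 0 R2" by (rule holomorphic_on_subset[OF assms(1)]) (use R2 in auto)
  have G: "G holomorphic_on ball 0 R2"
    unfolding G_def by (intro holomorphic_intros hol) (use R2 in auto)
  note cs = continuous_on_sphere_holomorphic[OF _ R2(1)]
  have "((\<lambda>u. \<phi> u / (u - z) ^ Suc 1) has_contour_integral (2 * pi * \<i>) / fact 1 * (deriv ^^ 1) \<phi> z) (circlepath 0 R)"
    by (rule Cauchy_has_contour_integral_higher_derivative_circlepath)
       (use assms R2 in \<open>auto intro!: holomorphic_on_subset[OF assms(1)] holomorphic_on_imp_continuous_on\<close>)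
  hence d: "circle_mean R (\<lambda>w. \<phi> w * (w / (w - z)\<^sup>2)) = deriv \<phi> z"
    using circle_mean_contour_integral[of "\<lambda>u. \<phi> u / (u - z)\<^sup>2" "deriv \<phi> z" R] by (simp add: power2_eq_square)
  have "circle_mean R (\<lambda>w. of_real (2 * Re (\<phi> w)) * (w / (w - z)\<^sup>2)) = circle_mean R (\<lambda>w. \<phi> w * (w / (w - z)\<^sup>2) + cnj (G w))"
  proof (rule circle_mean_cong)
    fix w :: complex assume w: "norm w = R"
    have R: "of_real (R\<^sup>2) = w * cnj w" using w by (simp add: complex_norm_square[symmetric] of_real_power)
    have w0: "w \<noteq> 0" "w - z \<noteq> 0" using assms w by auto
    have "cnj (G w) = cnj (\<phi> w) * ((w * cnj w) * cnj w / ((w - z) * cnj w)\<^sup>2)"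
      unfolding G_def R by (simp add: algebra_simps)
    also have "(w * cnj w) * cnj w / ((w - z) * cnj w)\<^sup>2 = w / (w - z)\<^sup>2"
      using w0 by (simp add: power_mult_distrib power2_eq_square)
    finally have "\<phi> w * (w / (w - z)\<^sup>2) + cnj (G w) = (\<phi> w + cnj (\<phi> w)) * (w / (w - z)\<^sup>2)"
      by (simp add: algebra_simps add_divide_distrib)
    thus "of_real (2 * Re (\<phi> w)) * (w / (w - z)\<^sup>2) = \<phi> w * (w / (w - z)\<^sup>2) + cnj (G w)"
      by (simp add: complex_add_cnj)
  qed (use assms in auto)
  also have "\<dots> = circle_mean R (\<lambda>w. \<phi> w * (w / (w - z)\<^sup>2)) + circle_mean R (\<lambda>w. cnj (G w))"
    by (rule circle_mean_add) (use assms in \<open>auto intro!: continuous_intros cs[OF hol] cs[OF G]\<close>)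
  also have "circle_mean R (\<lambda>w. cnj (G w)) = cnj (circle_mean R G)"
    by (rule circle_mean_bounded_linear[OF bounded_linear_cnj]) (use assms cs G in auto)
  also have "circle_mean R G = 0"
    using circle_mean_holomorphic[OF G] assms R2 by (simp add: G_def)
  finally show ?thesis using d by simp
qed

lemma norm_deriv_le_circle_mean:
  assumes "\<phi> holomorphic_on ball 0 R'" "0 < R" "R < R'" "norm z < R"
  shows "norm (deriv \<phi> z) \<le> 2 * R / (R - norm z)\<^sup>2 * circle_mean R (\<lambda>w. \<bar>Re (\<phi> w)\<bar>)"
proof -
  note c = continuous_on_sphere_holomorphic[OF assms(1,3)]
  have "norm (circle_mean R (\<lambda>w. of_real (2 * Re (\<phi> w)) * (w / (w - z)\<^sup>2))) \<le> circle_mean R (\<lambda>w. 2 * R / (R - norm z)\<^sup>2 * \<bar>Re (\<phi> w)\<bar>)"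
  proof (rule norm_circle_mean_le)
    fix w :: complex assume w: "norm w = R"
    have "R - norm z \<le> norm (w - z)" using w norm_triangle_ineq2[of w z] by simp
    hence "(R - norm z)\<^sup>2 \<le> (norm (w - z))\<^sup>2" using assms by (intro power_mono) auto
    hence "R / (norm (w - z))\<^sup>2 \<le> R / (R - norm z)\<^sup>2"
      using assms w by (intro divide_left_mono mult_pos_pos zero_less_power) auto
    hence "2 * \<bar>Re (\<phi> w)\<bar> * (R / (norm (w - z))\<^sup>2) \<le> 2 * \<bar>Re (\<phi> w)\<bar> * (R / (R - norm z)\<^sup>2)"
      by (intro mult_left_mono) auto
    thus "norm (of_real (2 * Re (\<phi> w)) * (w / (w - z)\<^sup>2)) \<le> 2 * R / (R - norm z)\<^sup>2 * \<bar>Re (\<phi> w)\<bar>"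
      using w by (simp add: norm_mult norm_divide norm_power mult_ac)
  qed (use assms c in \<open>auto intro!: continuous_intros\<close>)
  also have "\<dots> = 2 * R / (R - norm z)\<^sup>2 * circle_mean R (\<lambda>w. \<bar>Re (\<phi> w)\<bar>)"
    by (rule circle_mean_cmult) (use assms c in \<open>auto intro!: continuous_intros\<close>)
  finally show ?thesis using deriv_eq_circle_mean[OF assms] by simp
qed

section \<open>Factorization by Blaschke products\<close>

definition nonzero_meromorphic :: "(complex \<Rightarrow> complex) \<Rightarrow> bool" where
  "nonzero_meromorphic h \<longleftrightarrow> h meromorphic_on UNIV \<and> \<not> (\<forall>\<^sub>\<approx>z\<in>UNIV. h z = 0)"

definition regular_radius :: "(complex \<Rightarrow> complex) \<Rightarrow> real \<Rightarrow> bool" where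
  "regular_radius h r \<longleftrightarrow> (\<forall>z. norm z = r \<longrightarrow> h analytic_on {z} \<and> h z \<noteq> 0)"

lemma nonzero_meromorphic_cosparse:
  assumes "nonzero_meromorphic h"
  shows "eventually (\<lambda>z. h analytic_on {z} \<and> h z \<noteq> 0) (cosparse UNIV)"
proof -
  have m: "h meromorphic_on UNIV" and nz: "\<not> eventually (\<lambda>z. h z = 0) (cosparse UNIV)"
    using assms by (auto simp: nonzero_meromorphic_def)
  have "eventually (\<lambda>z. h z \<noteq> 0) (cosparse UNIV)"
    using meromorphic_imp_constant_or_avoid[OF m open_UNIV, of 0] nz by (auto simp: connected_UNIV)
  thus ?thesis using meromorphic_on_imp_analytic_cosparse[OF m] by eventually_elim auto
qed

lemma nonzero_meromorphic_at:
  assumes "nonzero_meromorphic h"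
  shows "eventually (\<lambda>w. h analytic_on {w} \<and> h w \<noteq> 0) (at z)"
  by (rule eventually_cosparse_imp_eventually_at[OF nonzero_meromorphic_cosparse[OF assms]]) auto

lemma nonzero_meromorphic_at' :
  assumes "nonzero_meromorphic h"
  shows "h meromorphic_on A" "frequently (\<lambda>w. h w \<noteq> 0) (at z)" "eventually (\<lambda>w. h w \<noteq> 0) (at z)"
proof -
  show "h meromorphic_on A" using assms meromorphic_on_subset unfolding nonzero_meromorphic_def by blast
  show "eventually (\<lambda>w. h w \<noteq> 0) (at z)"
    using nonzero_meromorphic_at[OF assms] by eventually_elim auto
  thus "frequently (\<lambda>w. h w \<noteq> 0) (at z)" by (rule eventually_frequently[rotated]) auto
qed

lemma nonzero_meromorphicI:
  assumes "h meromorphic_on UNIV" "eventually (\<lambda>w. h w \<noteq> 0) (at z)"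
  shows "nonzero_meromorphic h"
proof -
  have False if "eventually (\<lambda>z. h z = 0) (cosparse UNIV)"
  proof -
    have "eventually (\<lambda>w. h w = 0) (at z)"
      by (rule eventually_cosparse_imp_eventually_at[OF that]) auto
    hence "eventually (\<lambda>w. False) (at z)" using assms(2) by eventually_elim auto
    thus False by simp
  qed
  thus ?thesis using assms by (auto simp: nonzero_meromorphic_def)
qed

lemma sparse_singular_points:
  assumes "nonzero_meromorphic h"
  shows "{z. \<not> (h analytic_on {z} \<and> h z \<noteq> 0)} sparse_in UNIV"
  using nonzero_meromorphic_cosparse[OF assms] by (simp add: eventually_cosparse)

lemma zorder_eq_0_at_regular: "h analytic_on {z} \<Longrightarrow> h z \<noteq> 0 \<Longrightarrow> zorder h z = 0"
  using analytic_at zorder_eqI[where n = 0 and f = h] by force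

lemma finite_zeros_poles:
  assumes "nonzero_meromorphic h" "compact K"
  shows "finite {c\<in>K. zorder h c \<noteq> 0}"
proof -
  have "finite (K \<inter> {z. \<not> (h analytic_on {z} \<and> h z \<noteq> 0)})"
    by (rule sparse_in_compact_finite) (use sparse_singular_points[OF assms(1)] assms(2) sparse_in_subset in blast)+
  thus ?thesis by (rule rev_finite_subset) (use zorder_eq_0_at_regular in blast)
qed

lemma regular_at_imp_regular_near:
  assumes "h analytic_on {z}" "h z \<noteq> 0"
  shows "eventually (\<lambda>w. h analytic_on {w} \<and> h w \<noteq> 0) (nhds z)"
proof -
  have "eventually (\<lambda>w. h w \<noteq> 0) (nhds z)"
    using assms by (intro tendsto_imp_eventually_ne[OF _ assms(2)]) (metis analytic_at_imp_isCont isCont_def tendsto_at_iff_tendsto_nhds)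
  moreover have "eventually (\<lambda>w. h analytic_on {w}) (nhds z)"
  proof -
    obtain S where S: "open S" "z \<in> S" "h holomorphic_on S" using assms(1) by (auto simp: analytic_at)
    show ?thesis using eventually_nhds_in_open[OF S(1,2)]
      by eventually_elim (use S in \<open>auto simp: analytic_at\<close>)
  qed
  ultimately show ?thesis by eventually_elim auto
qed

text \<open>Normalised to have modulus 1 on the circle of radius \<open>R\<close>, so that dividing
  it out does not change the boundary values of ln |h|.\<close>

definition blaschke :: "real \<Rightarrow> complex \<Rightarrow> complex \<Rightarrow> complex" where
  "blaschke R c z = of_real R * (z - c) / (of_real (R\<^sup>2) - cnj c * z)"

lemma blaschke_denom:
  assumes "norm c < R" "norm z \<le> R"
  shows "of_real (R\<^sup>2) - cnj c * z \<noteq> 0"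
proof (rule cnj_mult_bound[OF assms(1)])
  show R: "0 < R" using assms norm_ge_zero[of c] by linarith
  have "norm z < R\<^sup>2 / norm c" if "c \<noteq> 0"
  proof -
    have "norm z * norm c \<le> R * norm c" using assms by (intro mult_right_mono) auto
    also have "\<dots> < R * R" using assms R by simp
    finally show ?thesis using that by (simp add: field_simps power2_eq_square)
  qed
  thus "norm z < R\<^sup>2 / norm c \<or> c = 0" by auto
qed

lemma blaschke_analytic:
  assumes "norm c < R" "norm z \<le> R"
  shows "blaschke R c analytic_on {z}"
  unfolding blaschke_def[abs_def] using blaschke_denom[OF assms]
  by (auto intro!: analytic_intros)

lemma blaschke_eq_0_iff:
  assumes "norm c < R" "norm z \<le> R"
  shows "blaschke R c z = 0 \<longleftrightarrow> z = c"
  unfolding blaschke_def using blaschke_denom[OF assms] assms(1) norm_ge_zero[of c]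
  by (auto simp del: norm_ge_zero)

lemma zorder_blaschke:
  assumes "norm c < R" "norm z \<le> R"
  shows "zorder (blaschke R c) z = (if z = c then 1 else 0)"
proof (cases "z = c")
  case False
  thus ?thesis using zorder_eq_0_at_regular[OF blaschke_analytic[OF assms]] blaschke_eq_0_iff[OF assms] by auto
next
  case True
  have R: "R > 0" using assms norm_ge_zero[of c] by linarith
  define g where "g w = of_real R / (of_real (R\<^sup>2) - cnj c * w)" for w
  have "g analytic_on {c}"
    unfolding g_def using blaschke_denom[of c R c] assms(1) by (auto intro!: analytic_intros)
  then obtain S where S: "open S" "c \<in> S" "g holomorphic_on S" by (auto simp: analytic_at)
  have "zorder (blaschke R c) c = 1"
    by (rule zorder_eqI[OF S]) (use R blaschke_denom[of c R c] assms(1) in \<open>auto simp: g_def blaschke_def\<close>)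
  thus ?thesis using True by simp
qed

lemma norm_blaschke_sphere:
  assumes "norm c < R" "norm z = R"
  shows "norm (blaschke R c z) = 1"
proof -
  have z: "z \<noteq> 0" "z \<noteq> c" and R: "R > 0" using assms norm_ge_zero[of c] by (auto simp del: norm_ge_zero)
  have "of_real (R\<^sup>2) = z * cnj z" using assms by (simp add: complex_norm_square[symmetric] of_real_power)
  hence "of_real (R\<^sup>2) - cnj c * z = z * cnj (z - c)" by (simp add: algebra_simps)
  hence "norm (blaschke R c z) = R * norm (z - c) / (norm z * norm (z - c))"
    unfolding blaschke_def using R by (simp add: norm_mult norm_divide del: complex_cnj_diff)
  thus ?thesis using z assms R by simp
qed

definition zeros_poles :: "(complex \<Rightarrow> complex) \<Rightarrow> real \<Rightarrow> complex set" where
  "zeros_poles h R = {c\<in>ball 0 R. zorder h c \<noteq> 0}"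

lemma finite_zeros_poles_ball [intro]: "nonzero_meromorphic h \<Longrightarrow> finite (zeros_poles h R)"
  unfolding zeros_poles_def by (rule finite_subset[OF _ finite_zeros_poles[of h "cball 0 R"]]) auto

definition blaschke_product :: "(complex \<Rightarrow> complex) \<Rightarrow> real \<Rightarrow> complex \<Rightarrow> complex" where
  "blaschke_product h R z = (\<Prod>c\<in>zeros_poles h R. blaschke R c z powi zorder h c)"

lemma blaschke_product_regular:
  assumes "nonzero_meromorphic h" "norm z \<le> R" "zorder h z = 0"
  shows "blaschke_product h R analytic_on {z}" "blaschke_product h R z \<noteq> 0"
proof -
  have *: "blaschke R c analytic_on {z}" "blaschke R c z \<noteq> 0" if "c \<in> zeros_poles h R" for c
    using that assms blaschke_analytic[of c R z] blaschke_eq_0_iff[of c R z] by (auto simp: zeros_poles_def)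
  show "blaschke_product h R analytic_on {z}" unfolding blaschke_product_def[abs_def]
    by (intro analytic_intros *) (use * in auto)
  show "blaschke_product h R z \<noteq> 0" unfolding blaschke_product_def
    using * finite_zeros_poles_ball[OF assms(1)] by auto
qed

text \<open>The quotient of \<open>h\<close> by its Blaschke product has order 0 throughout the
  closed disc. After its removable singularities are filled in, it is holomorphic and free of zeros
  near the closed disc, by compactness on a larger concentric disc, and there it has a logarithm.
  Regularity of the radius matters since a Blaschke factor can only cancel a point of the open
  disc.\<close>

lemma blaschke_factorization:
  assumes h: "nonzero_meromorphic h" and reg: "regular_radius h R" and R: "R > 0"
  obtains R' \<phi> where "R < R'" "\<phi> holomorphic_on ball 0 R'"
    "\<And>z. norm z \<le> R \<Longrightarrow> h analytic_on {z} \<Longrightarrow> h z \<noteq> 0 \<Longrightarrow> h z = blaschke_product h R z * exp (\<phi> z)"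
proof -
  let ?Z = "zeros_poles h R"
  let ?B = "blaschke_product h R"
  define q where "q z = h z / ?B z" for z
  define Q where "Q = remove_sings q"
  have fin: "finite ?Z" using h by blast
  have Bm: "?B meromorphic_on A" for A
  proof (rule meromorphic_on_subset)
    show "?B meromorphic_on UNIV"
      unfolding blaschke_product_def[abs_def] blaschke_def[abs_def]
      by (intro meromorphic_intros analytic_on_imp_meromorphic_on analytic_intros)
  qed auto
  have qm: "q meromorphic_on A" for A
    unfolding q_def[abs_def] by (intro meromorphic_intros Bm nonzero_meromorphic_at'[OF h])
  \<comment> \<open>The second conjunct excludes a quotient vanishing near \<open>z\<close>, for
    which \<open>zorder\<close> carries no information.\<close>
  have ord: "zorder q z = 0 \<and> (\<exists>\<^sub>F w in at z. q w \<noteq> 0)" if z: "norm z \<le> R" for z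
  proof -
    have bev: "eventually (\<lambda>w. blaschke R c w \<noteq> 0) (at z)" if "c \<in> ?Z" for c
    proof -
      have ana: "blaschke R c analytic_on {z}" using blaschke_analytic[of c R z] that z by (auto simp: zeros_poles_def)
      show ?thesis
      proof (cases "z = c")
        case False
        hence "blaschke R c z \<noteq> 0" using that z blaschke_eq_0_iff[of c R z] by (auto simp: zeros_poles_def)
        hence "eventually (\<lambda>w. blaschke R c w \<noteq> 0) (nhds z)"
          using regular_at_imp_regular_near[OF ana] by (auto elim: eventually_mono)
        thus ?thesis by (simp add: eventually_nhds_conv_at)
      next
        case True
        have "eventually (\<lambda>w. w \<in> ball 0 R - {z}) (at z)"
          using that True by (intro eventually_at_in_open) (auto simp: zeros_poles_def)
        thus ?thesis
          by eventually_elim (use that True in \<open>auto simp: blaschke_eq_0_iff zeros_poles_def\<close>)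
      qed
    qed
    have ev: "eventually (\<lambda>w. (\<Prod>c\<in>?Z. blaschke R c w powi zorder h c) \<noteq> 0) (at z)"
    proof -
      have "eventually (\<lambda>w. \<forall>c\<in>?Z. blaschke R c w \<noteq> 0) (at z)"
        using fin bev by (simp add: eventually_ball_finite)
      thus ?thesis by eventually_elim (use fin in auto)
    qed
    have mb: "blaschke R c meromorphic_on {z}" if "c \<in> ?Z" for c
      by (rule analytic_on_imp_meromorphic_on) (use that z blaschke_analytic[of c R z] in \<open>auto simp: zeros_poles_def\<close>)
    have "zorder ?B z = (\<Sum>c\<in>?Z. zorder (\<lambda>w. blaschke R c w powi zorder h c) z)"
      unfolding blaschke_product_def[abs_def]
      by (rule zorder_prod[OF _ ev]) (intro meromorphic_intros mb)
    also have "\<dots> = (\<Sum>c\<in>?Z. if z = c then zorder h c else 0)"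
    proof (rule sum.cong)
      fix c assume c: "c \<in> ?Z"
      have "zorder (\<lambda>w. blaschke R c w powi zorder h c) z = zorder h c * zorder (blaschke R c) z"
        by (rule zorder_power_int[OF mb[OF c]]) (use bev[OF c] in \<open>auto intro: eventually_frequently\<close>)
      thus "zorder (\<lambda>w. blaschke R c w powi zorder h c) z = (if z = c then zorder h c else 0)"
        using c z by (subst (asm) zorder_blaschke) (auto simp: zeros_poles_def)
    qed auto
    also have "\<dots> = (if z \<in> ?Z then zorder h z else 0)" using fin by (simp add: sum.delta')
    also have "\<dots> = zorder h z"
      using z reg zorder_eq_0_at_regular[of h z] by (cases "norm z = R") (auto simp: zeros_poles_def regular_radius_def)
    finally have zB: "zorder ?B z = zorder h z" .
    have evB: "eventually (\<lambda>w. ?B w \<noteq> 0) (at z)" using ev by (simp add: blaschke_product_def)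
    have "zorder q z = zorder h z - zorder ?B z"
      unfolding q_def[abs_def]
      by (intro zorder_divide nonzero_meromorphic_at'[OF h] Bm eventually_frequently evB) auto
    moreover have "eventually (\<lambda>w. q w \<noteq> 0) (at z)"
      using evB nonzero_meromorphic_at'(3)[OF h] by eventually_elim (auto simp: q_def)
    ultimately show ?thesis using zB by (auto intro: eventually_frequently)
  qed
  have Qan: "Q analytic_on {z} \<and> Q z \<noteq> 0" if z: "norm z \<le> R" for z
  proof -
    have iso: "isolated_singularity_at q z" "not_essential q z"
      using qm meromorphic_at_iff by blast+
    obtain r where r: "zor_poly q z z \<noteq> 0" "r > 0" "zor_poly q z holomorphic_on cball z r"
      "\<And>w. w \<in> cball z r - {z} \<Longrightarrow> q w = zor_poly q z w"
      using zorder_exist[OF iso] ord[OF z] by auto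
    have "isCont (zor_poly q z) z"
      using r by (intro continuous_on_interior[OF holomorphic_on_imp_continuous_on[OF r(3)]]) auto
    hence "zor_poly q z \<midarrow>z\<rightarrow> zor_poly q z z" by (simp add: isCont_def)
    moreover have "eventually (\<lambda>w. w \<in> ball z r - {z}) (at z)"
      using r by (intro eventually_at_in_open) auto
    hence "eventually (\<lambda>w. q w = zor_poly q z w) (at z)" by eventually_elim (use r in auto)
    ultimately have lim: "q \<midarrow>z\<rightarrow> zor_poly q z z" using tendsto_cong by fastforce
    show ?thesis unfolding Q_def
      using remove_sings_analytic_at[OF iso(1) lim] remove_sings_eqI[OF lim] r by simp
  qed
  hence "Q analytic_on cball 0 R" by (subst analytic_on_analytic_at) auto
  then obtain U where U: "open U" "cball 0 R \<subseteq> U" "Q holomorphic_on U" by (auto simp: analytic_on_holomorphic)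
  have "open (U \<inter> Q -` (-{0}))"
    by (rule continuous_open_preimage[OF holomorphic_on_imp_continuous_on[OF U(3)] U(1)]) auto
  moreover have "cball 0 R \<subseteq> U \<inter> Q -` (-{0})" using Qan U by auto
  ultimately obtain e where e: "e > 0" "(\<Union>x\<in>cball 0 R. ball x e) \<subseteq> U \<inter> Q -` (-{0})"
    using compact_subset_open_imp_ball_epsilon_subset[OF compact_cball] by metis
  have sub: "ball 0 (R + e) \<subseteq> U \<inter> Q -` (-{0})"
  proof
    fix z :: complex assume z: "z \<in> ball 0 (R + e)"
    show "z \<in> U \<inter> Q -` (-{0})"
    proof (cases "norm z \<le> R")
      case True
      hence "z \<in> (\<Union>x\<in>cball 0 R. ball x e)" using e by (intro UN_I[of z]) auto
      thus ?thesis using e by blast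
    next
      case False
      have z0: "z \<noteq> 0" using False R by (metis norm_zero less_imp_le)
      \<comment> \<open>The radial projection onto the circle, at distance norm z - R < e from
        \<open>z\<close>.\<close>
      define x where "x = of_real (R / norm z) * z"
      have "dist x z = norm ((of_real (R / norm z) - 1) * z)" by (simp add: dist_norm x_def algebra_simps)
      also have "\<dots> = norm (of_real (R / norm z - 1) :: complex) * norm z" by (simp add: norm_mult)
      also have "\<dots> = \<bar>R / norm z - 1\<bar> * norm z" by (subst norm_of_real) simp
      also have "\<dots> = norm z - R" using z0 False R by (simp add: abs_if field_simps)
      finally have "dist x z < e" using z by simp
      moreover have "norm x = R" using z0 R by (simp add: x_def norm_mult norm_divide)
      ultimately have "z \<in> (\<Union>x\<in>cball 0 R. ball x e)" by force
      thus ?thesis using e by blast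
    qed
  qed
  obtain \<phi> where phi: "\<phi> holomorphic_on ball 0 (R + e)" "\<And>z. z \<in> ball 0 (R + e) \<Longrightarrow> Q z = exp (\<phi> z)"
    by (rule contractible_imp_holomorphic_log[of Q "ball 0 (R + e)"])
       (use sub U in \<open>auto intro: holomorphic_on_subset convex_imp_contractible\<close>)
  show ?thesis
  proof (rule that[OF _ phi(1)])
    show "R < R + e" using e by simp
    fix z assume z: "norm z \<le> R" "h analytic_on {z}" "h z \<noteq> 0"
    have B: "?B analytic_on {z}" "?B z \<noteq> 0"
      using blaschke_product_regular[OF h z(1)] zorder_eq_0_at_regular[OF z(2,3)] by auto
    have "q analytic_on {z}" unfolding q_def[abs_def] by (intro analytic_intros z B) (use B in auto)
    hence "Q z = h z / ?B z" unfolding Q_def by (simp add: q_def)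
    thus "h z = ?B z * exp (\<phi> z)" using B phi(2)[of z] z e by (auto simp: field_simps)
  qed
qed

section \<open>Pole orders and the counting function\<close>

text \<open>The guard gives 0 where \<open>h\<close> vanishes near \<open>b\<close> and
  \<open>zorder\<close> is unspecified, so that sums and products need no case distinction.\<close>

definition pole_order :: "(complex \<Rightarrow> complex) \<Rightarrow> complex \<Rightarrow> nat" where
  "pole_order h b = (if is_pole h b then nat (- zorder h b) else 0)"

lemma local_factorization:
  assumes "h meromorphic_on {b}" "\<exists>\<^sub>F w in at b. h w \<noteq> 0"
  obtains g where "g analytic_on {b}" "g b \<noteq> 0" "eventually (\<lambda>w. h w = g w * (w - b) powi zorder h b) (at b)"
proof -
  have iso: "isolated_singularity_at h b" "not_essential h b"
    using assms meromorphic_at_iff by blast+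
  obtain r where r: "zor_poly h b b \<noteq> 0" "r > 0" "zor_poly h b holomorphic_on cball b r"
    "\<And>w. w \<in> cball b r - {b} \<Longrightarrow> h w = zor_poly h b w * (w - b) powi zorder h b"
    using zorder_exist[OF iso assms(2)] by auto
  show ?thesis
  proof (rule that[of "zor_poly h b"])
    show "zor_poly h b analytic_on {b}"
      using r by (auto simp: analytic_at intro!: exI[of _ "ball b r"] holomorphic_on_subset[OF r(3)])
    have "eventually (\<lambda>w. w \<in> ball b r - {b}) (at b)"
      using r by (intro eventually_at_in_open) auto
    thus "eventually (\<lambda>w. h w = zor_poly h b w * (w - b) powi zorder h b) (at b)"
      by eventually_elim (use r in auto)
  qed fact
qed

lemma analytic_bigo_1: "g analytic_on {b} \<Longrightarrow> g \<in> O[at b](\<lambda>_. 1)"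
  by (rule bigoI_tendsto[where c = "g b"]) (auto dest: analytic_at_imp_isCont simp: isCont_def)

lemma not_bounded_negative_power:
  assumes "n < 0" shows "(\<lambda>w::complex. (w - b) powi n) \<notin> O[at b](\<lambda>_. 1)"
proof
  assume *: "(\<lambda>w::complex. (w - b) powi n) \<in> O[at b](\<lambda>_. 1)"
  define m where "m = nat (-n)"
  have m: "m > 0" "n = - int m" using assms by (auto simp: m_def)
  have "((\<lambda>w::complex. (w - b) ^ m) \<longlongrightarrow> (b - b) ^ m) (at b)"
    by (intro tendsto_intros)
  hence "(\<lambda>w::complex. (w - b) ^ m) \<in> o[at b](\<lambda>_. 1)"
    using m by (intro smalloI_tendsto) (auto simp: zero_power)
  hence "(\<lambda>w::complex. (w - b) powi n * (w - b) ^ m) \<in> o[at b](\<lambda>_. 1 * 1)"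
    using * by (rule landau_o.big_small_mult[rotated])
  moreover have "eventually (\<lambda>w. (w - b) powi n * (w - b) ^ m = 1) (at b)"
    unfolding eventually_at_filter by (auto simp: m power_int_minus)
  ultimately have "(\<lambda>w::complex. 1 :: complex) \<in> o[at b](\<lambda>_. 1 :: complex)"
    using landau_o.small.in_cong by fastforce
  thus False by (simp add: landau_o.small_refl_iff)
qed

text \<open>Turns pole orders into a growth condition, which is stable under sums and products by
  Landau calculus and which also covers functions vanishing near \<open>b\<close>.\<close>

lemma pole_order_le_iff:
  assumes "f meromorphic_on {b}"
  shows "pole_order f b \<le> n \<longleftrightarrow> (\<lambda>w. f w * (w - b) ^ n) \<in> O[at b](\<lambda>_. 1)"
proof (cases "\<exists>\<^sub>F w in at b. f w \<noteq> 0")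
  case False
  hence ev: "eventually (\<lambda>w. f w = 0) (at b)" by (simp add: frequently_def)
  have "\<not> is_pole f b"
    by (rule frequently_const_imp_not_is_pole[of f 0], rule eventually_frequently[OF _ ev]) auto
  moreover have "(\<lambda>w. f w * (w - b) ^ n) \<in> O[at b](\<lambda>_. 1)"
    by (rule bigoI[of _ 0]) (use ev in \<open>auto elim: eventually_mono\<close>)
  ultimately show ?thesis by (simp add: pole_order_def)
next
  case True
  obtain g where g: "g analytic_on {b}" "g b \<noteq> 0" "eventually (\<lambda>w. f w = g w * (w - b) powi zorder f b) (at b)"
    using local_factorization[OF assms True] by blast
  have p: "pole_order f b = nat (- zorder f b)"
  proof (cases "is_pole f b")
    case False
    have "\<not> zorder f b < 0"
      using neg_zorder_imp_is_pole[of f b] assms True False meromorphic_at_iff by blast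
    thus ?thesis using False by (simp add: pole_order_def)
  qed (simp add: pole_order_def)
  let ?k = "zorder f b + int n"
  have ev: "eventually (\<lambda>w. f w * (w - b) ^ n = g w * (w - b) powi ?k) (at b)"
    using g(3) unfolding eventually_at_filter
    by eventually_elim (auto simp: power_int_add)
  have eq: "(\<lambda>w. f w * (w - b) ^ n) \<in> O[at b](\<lambda>_. 1) \<longleftrightarrow> (\<lambda>w. g w * (w - b) powi ?k) \<in> O[at b](\<lambda>_. 1)"
    by (rule landau_o.big.in_cong[OF ev])
  show ?thesis
  proof (cases "?k \<ge> 0")
    case k: True
    have "(\<lambda>w. g w * (w - b) ^ nat ?k) \<in> O[at b](\<lambda>_. 1)"
      by (rule analytic_bigo_1) (intro analytic_intros g)
    thus ?thesis using eq p k by (simp add: power_int_def)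
  next
    case k: False
    have "\<not> (\<lambda>w. g w * (w - b) powi ?k) \<in> O[at b](\<lambda>_. 1)"
    proof
      assume *: "(\<lambda>w. g w * (w - b) powi ?k) \<in> O[at b](\<lambda>_. 1)"
      have "(\<lambda>w. 1 / g w) \<in> O[at b](\<lambda>_. 1)"
        by (rule analytic_bigo_1) (intro analytic_intros g, use g in auto)
      from landau_o.big.mult[OF this *]
      have "(\<lambda>w. 1 / g w * (g w * (w - b) powi ?k)) \<in> O[at b](\<lambda>_. 1)" by simp
      moreover have "eventually (\<lambda>w. 1 / g w * (g w * (w - b) powi ?k) = (w - b) powi ?k) (at b)"
        using regular_at_imp_regular_near[OF g(1,2)] unfolding eventually_at_filter
        by eventually_elim auto
      ultimately have "(\<lambda>w. (w - b) powi ?k) \<in> O[at b](\<lambda>_. 1)"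
        using landau_o.big.in_cong by fast
      thus False using not_bounded_negative_power[of ?k b] k by auto
    qed
    thus ?thesis using eq p k by auto
  qed
qed

lemma pole_order_bigo:
  assumes "f meromorphic_on {b}" "pole_order f b \<le> n"
  shows "(\<lambda>w. f w * (w - b) ^ n) \<in> O[at b](\<lambda>_. 1)"
  using pole_order_le_iff[OF assms(1)] assms(2) by blast

lemma pole_order_mult:
  assumes "f meromorphic_on {b}" "g meromorphic_on {b}"
  shows "pole_order (\<lambda>z. f z * g z) b \<le> pole_order f b + pole_order g b"
proof -
  have "(\<lambda>w. (f w * (w - b) ^ pole_order f b) * (g w * (w - b) ^ pole_order g b)) \<in> O[at b](\<lambda>_. 1 * 1)"
    by (intro landau_o.big.mult pole_order_bigo assms) auto
  thus ?thesis
    by (subst pole_order_le_iff) (auto intro!: meromorphic_intros assms simp: power_add mult_ac)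
qed

text \<open>The maximum of the two orders would be the sharp bound; the sum has the same shape as
  the bounds for products and logarithmic derivatives, so one comparison of counting functions
  serves all three.\<close>

lemma pole_order_add:
  assumes "f meromorphic_on {b}" "g meromorphic_on {b}"
  shows "pole_order (\<lambda>z. f z + g z) b \<le> pole_order f b + pole_order g b"
proof -
  have "(\<lambda>w. f w * (w - b) ^ (pole_order f b + pole_order g b) + g w * (w - b) ^ (pole_order f b + pole_order g b)) \<in> O[at b](\<lambda>_. 1)"
    by (intro sum_in_bigo pole_order_bigo assms) auto
  thus ?thesis
    by (subst pole_order_le_iff) (auto intro!: meromorphic_intros assms simp: algebra_simps)
qed

lemma pole_order_cong:
  assumes "eventually (\<lambda>w. f w = g w) (at b)"
  shows "pole_order f b = pole_order g b"
  using is_pole_cong[OF assms refl] zorder_cong[OF assms refl] by (simp add: pole_order_def)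

lemma pole_order_analytic [simp]: "f analytic_on {b} \<Longrightarrow> pole_order f b = 0"
  by (auto simp: pole_order_def dest: analytic_at_imp_no_pole)

lemma pole_order_eq:
  assumes "nonzero_meromorphic h"
  shows "pole_order h b = nat (- zorder h b)"
  using zorder_neg_imp_is_pole[of h b] nonzero_meromorphic_at'[OF assms]
  by (force simp: pole_order_def)

lemma nonzero_meromorphic_mult:
  assumes "nonzero_meromorphic f" "nonzero_meromorphic g"
  shows "nonzero_meromorphic (\<lambda>z. f z * g z)"
proof (rule nonzero_meromorphicI)
  show "eventually (\<lambda>w. f w * g w \<noteq> 0) (at 0)"
    using nonzero_meromorphic_at'(3)[OF assms(1), of 0] nonzero_meromorphic_at'(3)[OF assms(2), of 0]
    by eventually_elim auto
qed (intro meromorphic_intros nonzero_meromorphic_at' assms)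

lemma nonzero_meromorphic_inverse:
  assumes "nonzero_meromorphic f"
  shows "nonzero_meromorphic (\<lambda>z. 1 / f z)"
proof (rule nonzero_meromorphicI)
  show "eventually (\<lambda>w. 1 / f w \<noteq> 0) (at 0)"
    using nonzero_meromorphic_at'(3)[OF assms(1), of 0]
    by eventually_elim auto
qed (intro meromorphic_intros nonzero_meromorphic_at' assms)

lemma pole_order_inverse:
  assumes "nonzero_meromorphic h"
  shows "pole_order (\<lambda>z. 1 / h z) b = nat (zorder h b)"
proof -
  have "zorder (\<lambda>z. 1 / h z) b = zorder (\<lambda>z. 1) b - zorder h b"
    by (intro zorder_divide nonzero_meromorphic_at'[OF assms]) auto
  thus ?thesis using pole_order_eq[OF nonzero_meromorphic_inverse[OF assms]] by simp
qed

text \<open>Near a point of order n the logarithmic derivative is n / (z - b) plus an analytic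
  function. Its pole is at most simple, and occurs only where one of the two orders on the right is
  |n|, hence at least 1.\<close>

lemma pole_order_log_deriv:
  assumes "nonzero_meromorphic h"
  shows "pole_order (\<lambda>z. deriv h z / h z) b \<le> pole_order h b + pole_order (\<lambda>z. 1 / h z) b"
proof -
  let ?n = "zorder h b"
  obtain g where g: "g analytic_on {b}" "g b \<noteq> 0" "eventually (\<lambda>w. h w = g w * (w - b) powi ?n) (at b)"
    using local_factorization[OF nonzero_meromorphic_at'(1,2)[OF assms]] by blast
  have "eventually (\<lambda>w. deriv h w / h w = deriv g w / g w + of_int ?n * (1 / (w - b))) (at b)"
  proof -
    \<comment> \<open>Differentiating at \<open>w\<close> requires the factorization on a whole
      neighbourhood of \<open>w\<close>, not just at \<open>w\<close>.\<close>
    have 1: "eventually (\<lambda>w. eventually (\<lambda>w. h w = g w * (w - b) powi ?n) (nhds w)) (at b)"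
    proof -
      obtain S where S: "open S" "b \<in> S" "\<And>w. w \<in> S \<Longrightarrow> w \<noteq> b \<Longrightarrow> h w = g w * (w - b) powi ?n"
        using g(3) unfolding eventually_at_topological by blast
      have "eventually (\<lambda>w. w \<in> S - {b}) (at b)" using S by (intro eventually_at_in_open) auto
      thus ?thesis
      proof eventually_elim
        case (elim w)
        have "eventually (\<lambda>v. v \<in> S - {b}) (nhds w)" using S elim by (intro eventually_nhds_in_open) auto
        thus ?case by eventually_elim (use S in auto)
      qed
    qed
    have 2: "eventually (\<lambda>w. g analytic_on {w} \<and> g w \<noteq> 0) (at b)"
      using regular_at_imp_regular_near[OF g(1,2)] by (simp add: eventually_nhds_conv_at)
    have 3: "eventually (\<lambda>w. w \<noteq> b) (at b)" by (simp add: eventually_at_filter)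
    show ?thesis using 1 2 3
    proof eventually_elim
      case (elim w)
      have h: "h w = g w * (w - b) powi ?n" using eventually_nhds_x_imp_x[OF elim(1)] .
      have "deriv h w = deriv (\<lambda>w. g w * (w - b) powi ?n) w" by (rule deriv_cong_ev[OF elim(1) refl])
      also have "\<dots> = deriv g w * (w - b) powi ?n + g w * (of_int ?n * (w - b) powi (?n - 1))"
        using elim by (intro DERIV_imp_deriv) (auto intro!: derivative_eq_intros analytic_derivI)
      finally show ?case using elim h by (simp add: power_int_diff add_divide_distrib)
    qed
  qed
  hence eq: "pole_order (\<lambda>z. deriv h z / h z) b = pole_order (\<lambda>w. deriv g w / g w + of_int ?n * (1 / (w - b))) b"
    by (rule pole_order_cong)
  have ana: "(\<lambda>w. deriv g w / g w) analytic_on {b}" by (intro analytic_intros g) (use g in auto)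
  show ?thesis
  proof (cases "?n = 0")
    case True
    thus ?thesis using eq ana by simp
  next
    case False
    have "pole_order (\<lambda>w. deriv g w / g w + of_int ?n * (1 / (w - b))) b \<le> 1"
    proof (subst pole_order_le_iff)
      show "(\<lambda>w. deriv g w / g w + of_int ?n * (1 / (w - b))) meromorphic_on {b}"
        by (intro meromorphic_intros analytic_on_imp_meromorphic_on ana)
      have "eventually (\<lambda>w. (deriv g w / g w + of_int ?n * (1 / (w - b))) * (w - b)^1 = deriv g w / g w * (w - b) + of_int ?n) (at b)"
      proof -
        have "eventually (\<lambda>w. w \<noteq> b) (at b)" by (simp add: eventually_at_filter)
        thus ?thesis by eventually_elim (simp add: distrib_right)
      qed
      moreover have "(\<lambda>w. deriv g w / g w * (w - b) + of_int ?n) \<in> O[at b](\<lambda>_. 1)"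
        by (rule analytic_bigo_1) (intro analytic_intros ana)
      ultimately show "(\<lambda>w. (deriv g w / g w + of_int ?n * (1 / (w - b))) * (w - b)^1) \<in> O[at b](\<lambda>_. 1)"
        using landau_o.big.in_cong by fast
    qed
    also have "1 \<le> pole_order h b + pole_order (\<lambda>z. 1 / h z) b"
      using False pole_order_eq[OF assms] pole_order_inverse[OF assms] by simp
    finally show ?thesis using eq by simp
  qed
qed

text \<open>The contribution of one simple pole at \<open>b\<close> to N(r, .): the integral of 1 /
  t from norm b to \<open>r\<close>, with ln r as the separate term for the origin. The latter is
  why nonnegativity asks for 1 \<le> r.\<close>

definition log_weight :: "real \<Rightarrow> complex \<Rightarrow> real" where
  "log_weight r b = (if b = 0 then ln r else ln (r / norm b))"

lemma log_weight_nonneg: "1 \<le> r \<Longrightarrow> norm b \<le> r \<Longrightarrow> 0 \<le> log_weight r b"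
  by (auto simp: log_weight_def)

lemma finite_poles:
  assumes "h meromorphic_on UNIV"
  shows "finite {b. norm b \<le> r \<and> is_pole h b}"
proof -
  have "{z. is_pole h z} sparse_in UNIV"
    using meromorphic_on_imp_not_pole_cosparse[OF assms] by (simp add: eventually_cosparse)
  hence "finite (cball 0 r \<inter> {z. is_pole h z})"
    by (intro sparse_in_compact_finite) (auto intro: sparse_in_subset)
  thus ?thesis by (rule rev_finite_subset) auto
qed

lemma has_integral_inverse_tail:
  fixes r s :: real
  assumes "0 < s" "s \<le> r"
  shows "((\<lambda>t. if s \<le> t then 1 / t else 0) has_integral ln (r / s)) {0..r}"
proof -
  have "((\<lambda>t. 1 / t) has_integral (ln r - ln s)) {s..r}"
    by (rule fundamental_theorem_of_calculus[where f = ln and f' = "\<lambda>t. 1 / t"])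
       (use assms in \<open>auto intro!: derivative_eq_intros simp flip: has_real_derivative_iff_has_vector_derivative\<close>)
  hence "((\<lambda>t. if t \<in> {s..r} then 1 / t else 0) has_integral ln (r / s)) {0..r}"
    using assms by (subst has_integral_restrict) (auto simp: ln_div)
  thus ?thesis by (rule has_integral_eq[rotated]) auto
qed

text \<open>n(t) is a sum of indicators of norm b \<le> t, integrated term by term. \<open>S\<close>
  may be any finite superset of the poles, so that counting functions of several functions become
  sums over one set.\<close>

lemma nevanlinna_N_eq:
  assumes h: "h meromorphic_on UNIV" and r: "r > 0"
    and S: "finite S" "S \<subseteq> cball 0 r" "\<And>b. norm b \<le> r \<Longrightarrow> is_pole h b \<Longrightarrow> b \<in> S"
  shows "nevanlinna_N r h = (\<Sum>b\<in>S. real (pole_order h b) * log_weight r b)"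
proof -
  have pc: "real (pole_count t h) = (\<Sum>b\<in>S. if norm b \<le> t then real (pole_order h b) else 0)" if "t \<le> r" for t
  proof -
    have "pole_count t h = (\<Sum>b | norm b \<le> t \<and> is_pole h b. pole_order h b)"
      unfolding pole_count_def by (rule sum.cong) (auto simp: pole_order_def)
    also have "\<dots> = (\<Sum>b\<in>S. if norm b \<le> t then pole_order h b else 0)"
      by (rule sum.mono_neutral_cong_left) (use S that in \<open>auto simp: pole_order_def\<close>)
    finally show ?thesis by (simp only: of_nat_sum if_distrib[of real] of_nat_0)
  qed
  have pc0: "real (pole_count 0 h) = (\<Sum>b\<in>S. if b = 0 then real (pole_order h b) else 0)"
    using pc[of 0] r by simp
  have "((\<lambda>t. \<Sum>b\<in>S. if b = 0 then 0 else real (pole_order h b) * (if norm b \<le> t then 1 / t else 0))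
     has_integral (\<Sum>b\<in>S. if b = 0 then 0 else real (pole_order h b) * ln (r / norm b))) {0..r}"
  proof (rule has_integral_sum[OF S(1)])
    fix b assume "b \<in> S"
    hence "((\<lambda>t. if norm b \<le> t then 1 / t else 0) has_integral ln (r / norm b)) {0..r}" if "b \<noteq> 0"
      using that S by (intro has_integral_inverse_tail) auto
    thus "((\<lambda>t. if b = 0 then 0 else real (pole_order h b) * (if norm b \<le> t then 1 / t else 0))
     has_integral (if b = 0 then 0 else real (pole_order h b) * ln (r / norm b))) {0..r}"
      using has_integral_mult_right by (cases "b = 0") auto
  qed
  hence "((\<lambda>t. (real (pole_count t h) - real (pole_count 0 h)) / t)
     has_integral (\<Sum>b\<in>S. if b = 0 then 0 else real (pole_order h b) * ln (r / norm b))) {0..r}"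
  proof (rule has_integral_eq[rotated])
    fix t assume t: "t \<in> {0..r}"
    have "(real (pole_count t h) - real (pole_count 0 h)) / t
      = (\<Sum>b\<in>S. ((if norm b \<le> t then real (pole_order h b) else 0) - (if b = 0 then real (pole_order h b) else 0)) / t)"
      using t by (simp add: pc pc0 sum_subtractf[symmetric] sum_divide_distrib)
    also have "\<dots> = (\<Sum>b\<in>S. if b = 0 then 0 else real (pole_order h b) * (if norm b \<le> t then 1 / t else 0))"
      by (rule sum.cong) (use t in auto)
    finally show "(\<Sum>b\<in>S. if b = 0 then 0 else real (pole_order h b) * (if norm b \<le> t then 1 / t else 0))
      = (real (pole_count t h) - real (pole_count 0 h)) / t" ..
  qed
  hence "nevanlinna_N r h = (\<Sum>b\<in>S. if b = 0 then 0 else real (pole_order h b) * ln (r / norm b))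
    + (\<Sum>b\<in>S. if b = 0 then real (pole_order h b) else 0) * ln r"
    unfolding nevanlinna_N_def pc0[symmetric] by (simp add: integral_unique)
  also have "\<dots> = (\<Sum>b\<in>S. real (pole_order h b) * log_weight r b)"
    by (subst sum_distrib_right, subst sum.distrib[symmetric], rule sum.cong) (auto simp: log_weight_def)
  finally show ?thesis .
qed

lemma nevanlinna_N_nonneg:
  assumes "h meromorphic_on UNIV" "1 \<le> r"
  shows "0 \<le> nevanlinna_N r h"
  by (subst nevanlinna_N_eq[OF assms(1) _ finite_poles[OF assms(1), of r]])
     (use assms(2) in \<open>auto intro!: sum_nonneg mult_nonneg_nonneg log_weight_nonneg\<close>)

lemma nevanlinna_N_le:
  assumes "h meromorphic_on UNIV" "f meromorphic_on UNIV" "g meromorphic_on UNIV" "1 \<le> r"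
    and le: "\<And>b. norm b \<le> r \<Longrightarrow> pole_order h b \<le> pole_order f b + pole_order g b"
  shows "nevanlinna_N r h \<le> nevanlinna_N r f + nevanlinna_N r g"
proof -
  let ?S = "{b. norm b \<le> r \<and> is_pole h b} \<union> {b. norm b \<le> r \<and> is_pole f b} \<union> {b. norm b \<le> r \<and> is_pole g b}"
  have S: "finite ?S" "?S \<subseteq> cball 0 r" using assms finite_poles by auto
  have "nevanlinna_N r h = (\<Sum>b\<in>?S. real (pole_order h b) * log_weight r b)"
    by (rule nevanlinna_N_eq[OF assms(1) _ S]) (use assms(4) in auto)
  also have "\<dots> \<le> (\<Sum>b\<in>?S. real (pole_order f b) * log_weight r b + real (pole_order g b) * log_weight r b)"
  proof (rule sum_mono)
    fix b assume "b \<in> ?S"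
    hence b: "norm b \<le> r" by auto
    have "real (pole_order h b) * log_weight r b \<le> real (pole_order f b + pole_order g b) * log_weight r b"
      using le[OF b] log_weight_nonneg[OF assms(4) b] by (intro mult_right_mono of_nat_mono)
    thus "real (pole_order h b) * log_weight r b \<le> real (pole_order f b) * log_weight r b + real (pole_order g b) * log_weight r b"
      by (simp add: algebra_simps)
  qed
  also have "\<dots> = nevanlinna_N r f + nevanlinna_N r g"
    using nevanlinna_N_eq[OF assms(2) _ S] nevanlinna_N_eq[OF assms(3) _ S] assms(4)
    by (auto simp: sum.distrib)
  finally show ?thesis .
qed

section \<open>Jensen's formula and the characteristic\<close>

lemma log_plus_nonneg [simp]: "0 \<le> log_plus x"
  by (simp add: log_plus_def)

lemma log_plus_mono: "x \<le> y \<Longrightarrow> log_plus x \<le> log_plus y"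
  by (simp add: log_plus_def)

lemma log_plus_ge_ln: "x > 0 \<Longrightarrow> ln x \<le> log_plus x"
  by (simp add: log_plus_def)

lemma log_plus_le: "x > 0 \<Longrightarrow> ln x \<le> y \<Longrightarrow> 0 \<le> y \<Longrightarrow> log_plus x \<le> y"
  by (simp add: log_plus_def max_def)

lemma ln_eq_log_plus: "x > 0 \<Longrightarrow> ln x = log_plus x - log_plus (1 / x)"
  by (simp add: log_plus_def max_def ln_div)

lemma abs_ln_eq_log_plus: "x > 0 \<Longrightarrow> \<bar>ln x\<bar> = log_plus x + log_plus (1 / x)"
  by (auto simp: log_plus_def max_def ln_div)

lemma log_plus_mult_le: "0 \<le> x \<Longrightarrow> 0 \<le> y \<Longrightarrow> log_plus (x * y) \<le> log_plus x + log_plus y"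
proof -
  assume *: "0 \<le> x" "0 \<le> y"
  have "max 1 (x * y) \<le> max 1 x * max 1 y"
    using mult_mono[of x "max 1 x" y "max 1 y"] mult_mono[of 1 "max 1 x" 1 "max 1 y"] * by auto
  hence "ln (max 1 (x * y)) \<le> ln (max 1 x * max 1 y)"
    by (subst ln_le_cancel_iff) (auto intro!: mult_pos_pos simp: less_max_iff_disj)
  also have "\<dots> = ln (max 1 x) + ln (max 1 y)" by (rule ln_mult_pos) auto
  finally show ?thesis by (simp add: log_plus_def)
qed

lemma log_plus_add_le: "0 \<le> x \<Longrightarrow> 0 \<le> y \<Longrightarrow> log_plus (x + y) \<le> log_plus x + log_plus y + ln 2"
proof -
  assume *: "0 \<le> x" "0 \<le> y"
  have 1: "1 \<le> max 1 x" "1 \<le> max 1 y" by auto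
  have "max 1 x \<le> max 1 x * max 1 y" "max 1 y \<le> max 1 x * max 1 y"
    using mult_left_mono[OF 1(2), of "max 1 x"] mult_right_mono[OF 1(1), of "max 1 y"] by auto
  hence "x + y \<le> 2 * (max 1 x * max 1 y)" "1 \<le> 2 * (max 1 x * max 1 y)" using 1 by linarith+
  hence "max 1 (x + y) \<le> 2 * (max 1 x * max 1 y)" by simp
  hence "ln (max 1 (x + y)) \<le> ln (2 * (max 1 x * max 1 y))"
    by (subst ln_le_cancel_iff) (auto intro!: mult_pos_pos simp: less_max_iff_disj)
  also have "\<dots> = ln 2 + ln (max 1 x) + ln (max 1 y)"
    by (subst ln_mult_pos, simp, simp add: less_max_iff_disj, subst ln_mult_pos) auto
  finally show ?thesis by (simp add: log_plus_def)
qed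

lemma log_plus_power: "0 \<le> x \<Longrightarrow> log_plus (x ^ n) = real n * log_plus x"
proof (cases "n = 0 \<or> x \<le> 1")
  case True
  moreover assume "0 \<le> x"
  ultimately show ?thesis using power_le_one[of x n] by (auto simp: log_plus_def max_def)
next
  case False
  hence "x ^ n > 1" by (simp add: one_less_power)
  thus ?thesis using False by (simp add: log_plus_def max_def ln_realpow)
qed

lemma continuous_on_log_plus [continuous_intros]:
  "continuous_on A f \<Longrightarrow> continuous_on A (\<lambda>x. log_plus (f x))"
  unfolding log_plus_def by (intro continuous_intros) auto

lemma circle_mean_nonneg:
  fixes u :: "complex \<Rightarrow> real"
  assumes "continuous_on (sphere 0 r) u" "r \<ge> 0" "\<And>w. norm w = r \<Longrightarrow> 0 \<le> u w"
  shows "0 \<le> circle_mean r u"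
  using circle_mean_mono[of r "\<lambda>_. 0" u] assms by simp

lemma nevanlinna_m_eq: "nevanlinna_m r h = circle_mean r (\<lambda>z. log_plus (norm (h z)))"
  by (simp add: nevanlinna_m_def circle_mean_def)

lemma continuous_on_regular:
  assumes "\<And>z. norm z = r \<Longrightarrow> h analytic_on {z}"
  shows "continuous_on (sphere 0 r) h"
  by (rule continuous_at_imp_continuous_on) (use assms analytic_at_imp_isCont in auto)

lemma regular_radiusD:
  assumes "regular_radius h r"
  shows "norm z = r \<Longrightarrow> h analytic_on {z}" "norm z = r \<Longrightarrow> h z \<noteq> 0" "continuous_on (sphere 0 r) h"
  using assms continuous_on_regular[of r h] unfolding regular_radius_def by auto

lemma regular_radius_inverse: "regular_radius h r \<Longrightarrow> regular_radius (\<lambda>z. 1 / h z) r"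
  unfolding regular_radius_def by (auto intro!: analytic_intros)

lemma nevanlinna_N_eq_zeros_poles:
  assumes h: "nonzero_meromorphic h" and reg: "regular_radius h R" and R: "R > 0"
  shows "nevanlinna_N R h = (\<Sum>c\<in>zeros_poles h R. real (nat (- zorder h c)) * log_weight R c)"
    "nevanlinna_N R (\<lambda>z. 1 / h z) = (\<Sum>c\<in>zeros_poles h R. real (nat (zorder h c)) * log_weight R c)"
proof -
  have reg': "zorder h b = 0" if "norm b = R" for b
    using reg that by (auto intro: zorder_eq_0_at_regular simp: regular_radius_def)
  have pole: "pole_order f b > 0" if "is_pole f b" "nonzero_meromorphic f" for f b
    using that isolated_pole_imp_neg_zorder[of f b] nonzero_meromorphic_at'(1)[OF that(2), of "{b}"]
    by (auto simp: pole_order_def meromorphic_at_iff)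
  have S: "finite (zeros_poles h R)" "zeros_poles h R \<subseteq> cball 0 R" using finite_zeros_poles_ball[OF h] by (simp, auto simp: zeros_poles_def)
  have m: "h meromorphic_on UNIV" "(\<lambda>z. 1 / h z) meromorphic_on UNIV"
    using h nonzero_meromorphic_inverse[OF h] by (auto simp: nonzero_meromorphic_def)
  show "nevanlinna_N R h = (\<Sum>c\<in>zeros_poles h R. real (nat (- zorder h c)) * log_weight R c)"
  proof (subst nevanlinna_N_eq[where S = "zeros_poles h R"])
    fix b assume b: "norm b \<le> R" "is_pole h b"
    thus "b \<in> zeros_poles h R"
      using reg'[of b] pole[OF b(2) h] pole_order_eq[OF h, of b] by (auto simp: zeros_poles_def order_less_le)
  qed (use m R S in \<open>auto simp: pole_order_eq[OF h]\<close>)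
  show "nevanlinna_N R (\<lambda>z. 1 / h z) = (\<Sum>c\<in>zeros_poles h R. real (nat (zorder h c)) * log_weight R c)"
  proof (subst nevanlinna_N_eq[where S = "zeros_poles h R"])
    fix b assume b: "norm b \<le> R" "is_pole (\<lambda>z. 1 / h z) b"
    thus "b \<in> zeros_poles h R"
      using reg'[of b] pole[OF b(2) nonzero_meromorphic_inverse[OF h]] pole_order_inverse[OF h, of b]
      by (auto simp: zeros_poles_def order_less_le)
  qed (use m R S in \<open>auto simp: pole_order_inverse[OF h]\<close>)
qed

lemma norm_blaschke_product_sphere:
  assumes "norm z = R"
  shows "norm (blaschke_product h R z) = 1"
proof -
  have "norm (blaschke R c z powi zorder h c) = 1" if "c \<in> zeros_poles h R" for c
    using that assms norm_blaschke_sphere[of c R z] by (simp add: norm_power_int zeros_poles_def)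
  thus ?thesis unfolding blaschke_product_def by (simp add: prod_norm[symmetric])
qed

lemma ln_power_int: "x > 0 \<Longrightarrow> ln (x powi n) = of_int n * ln (x :: real)"
  by (auto simp: power_int_def ln_realpow ln_inverse)

lemma ln_norm_blaschke_product:
  assumes "nonzero_meromorphic h" "norm z \<le> R" "zorder h z = 0"
  shows "ln (norm (blaschke_product h R z)) = (\<Sum>c\<in>zeros_poles h R. of_int (zorder h c) * ln (norm (blaschke R c z)))"
proof -
  have nz: "blaschke R c z \<noteq> 0" if "c \<in> zeros_poles h R" for c
    using that assms blaschke_eq_0_iff[of c R z] by (auto simp: zeros_poles_def)
  have "ln (norm (blaschke_product h R z)) = ln (\<Prod>c\<in>zeros_poles h R. norm (blaschke R c z) powi zorder h c)"
    by (simp add: blaschke_product_def prod_norm[symmetric] norm_power_int)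
  also have "\<dots> = (\<Sum>c\<in>zeros_poles h R. ln (norm (blaschke R c z) powi zorder h c))"
    by (rule ln_prod) (use nz finite_zeros_poles_ball[OF assms(1)] in \<open>auto intro!: zero_less_power_int\<close>)
  also have "\<dots> = (\<Sum>c\<in>zeros_poles h R. of_int (zorder h c) * ln (norm (blaschke R c z)))"
    by (rule sum.cong) (use nz in \<open>auto simp: ln_power_int\<close>)
  finally show ?thesis .
qed

lemma factorization_Re:
  assumes "norm z = R" "h z = blaschke_product h R z * exp (\<phi> z)"
  shows "Re (\<phi> z) = ln (norm (h z))"
  using assms norm_blaschke_product_sphere[OF assms(1), of h] by (simp add: norm_mult)

text \<open>The mean of ln |h| is Re (\<phi> 0) in the Blaschke factorization. This value is found
  by comparing leading Laurent coefficients at the origin; \<open>zor_poly h 0 0\<close> is that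
  coefficient of \<open>h\<close>.\<close>

theorem Jensen_formula:
  assumes h: "nonzero_meromorphic h" and reg: "regular_radius h R" and R: "R > 0"
  shows "circle_mean R (\<lambda>z. ln (norm (h z)))
    = ln (norm (zor_poly h 0 0)) + nevanlinna_N R (\<lambda>z. 1 / h z) - nevanlinna_N R h"
proof -
  let ?Z = "zeros_poles h R" and ?n = "zorder h 0"
  obtain R' \<phi> where phi: "R < R'" "\<phi> holomorphic_on ball 0 R'"
    "\<And>z. norm z \<le> R \<Longrightarrow> h analytic_on {z} \<Longrightarrow> h z \<noteq> 0 \<Longrightarrow> h z = blaschke_product h R z * exp (\<phi> z)"
    using blaschke_factorization[OF h reg R] by blast
  have fin: "finite ?Z" using h by blast
  have iso: "isolated_singularity_at h 0" "not_essential h 0"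
    using nonzero_meromorphic_at'(1)[OF h, of "{0}"] meromorphic_at_iff by blast+
  obtain r where g0: "zor_poly h 0 0 \<noteq> 0" "r > 0" "zor_poly h 0 holomorphic_on cball 0 r"
    "\<And>w. w \<in> cball 0 r - {0} \<Longrightarrow> h w = zor_poly h 0 w * w powi ?n"
    using zorder_exist[OF iso nonzero_meromorphic_at'(2)[OF h]] by auto
  \<comment> \<open>The Blaschke factor of the origin is w / R. It is split off because its power
    has to cancel against the power of \<open>w\<close> in the Laurent form of \<open>h\<close>; the
    rest is nonzero at 0.\<close>
  define P where "P w = (\<Prod>c\<in>?Z - {0}. blaschke R c w powi zorder h c)" for w
  have split: "blaschke_product h R w = (w / of_real R) powi ?n * P w" for w
  proof -
    have "blaschke R 0 w = w / of_real R" using R by (simp add: blaschke_def power2_eq_square)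
    thus ?thesis unfolding blaschke_product_def P_def using R
      by (cases "0 \<in> ?Z") (simp_all add: prod.remove[OF fin, of 0], simp add: zeros_poles_def)
  qed
  have contg: "zor_poly h 0 \<midarrow>0\<rightarrow> zor_poly h 0 0"
    using continuous_on_interior[OF holomorphic_on_imp_continuous_on[OF g0(3)], of 0] g0(2) by (simp add: isCont_def)
  have contphi: "\<phi> \<midarrow>0\<rightarrow> \<phi> 0"
    using continuous_on_interior[OF holomorphic_on_imp_continuous_on[OF phi(2)], of 0] R phi(1) by (simp add: isCont_def)
  have Pan: "P analytic_on {0}" "P 0 \<noteq> 0"
  proof -
    have *: "blaschke R c analytic_on {0} \<and> blaschke R c 0 \<noteq> 0" if "c \<in> ?Z - {0}" for c
      using that R blaschke_analytic[of c R 0] blaschke_eq_0_iff[of c R 0] by (auto simp: zeros_poles_def)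
    show "P analytic_on {0}" unfolding P_def[abs_def] by (intro analytic_intros) (use * in auto)
    show "P 0 \<noteq> 0" using * fin by (auto simp: P_def)
  qed
  \<comment> \<open>The factorization holds only at regular points near 0, so the coefficients are
    compared as limits.\<close>
  have lim2: "(\<lambda>w. of_real R powi (- ?n) * P w * exp (\<phi> w)) \<midarrow>0\<rightarrow> of_real R powi (- ?n) * P 0 * exp (\<phi> 0)"
    using Pan(1) by (intro tendsto_intros contphi) (use analytic_at_imp_isCont[OF Pan(1)] isCont_def in blast)
  have "eventually (\<lambda>w. w \<in> ball 0 (min r R) - {0}) (at (0::complex))"
    using g0(2) R by (intro eventually_at_in_open) auto
  hence "eventually (\<lambda>w. zor_poly h 0 w = of_real R powi (- ?n) * P w * exp (\<phi> w)) (at 0)"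
    using nonzero_meromorphic_at[OF h, of 0]
  proof eventually_elim
    case (elim w)
    have "zor_poly h 0 w * w powi ?n = (w / of_real R) powi ?n * P w * exp (\<phi> w)"
      using g0(4)[of w] phi(3)[of w] elim split[of w] by simp
    thus ?case using elim R by (simp add: power_int_divide_distrib power_int_minus field_simps)
  qed
  hence "(\<lambda>w. of_real R powi (- ?n) * P w * exp (\<phi> w)) \<midarrow>0\<rightarrow> zor_poly h 0 0"
    using contg tendsto_cong by fast
  hence "zor_poly h 0 0 = of_real R powi (- ?n) * P 0 * exp (\<phi> 0)"
    using LIM_unique lim2 by blast
  hence "ln (norm (zor_poly h 0 0)) = ln (R powi (- ?n)) + ln (norm (P 0)) + Re (\<phi> 0)"
    using R Pan(2) by (simp add: norm_mult norm_power_int ln_mult)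
  moreover have "ln (norm (P 0)) = (\<Sum>c\<in>?Z - {0}. - of_int (zorder h c) * log_weight R c)"
  proof -
    have "norm (P 0) = (\<Prod>c\<in>?Z - {0}. (norm c / R) powi zorder h c)"
      unfolding P_def prod_norm[symmetric]
      by (rule prod.cong) (use R in \<open>auto simp: norm_power_int blaschke_def norm_divide norm_mult power2_eq_square\<close>)
    also have "ln \<dots> = (\<Sum>c\<in>?Z - {0}. ln ((norm c / R) powi zorder h c))"
      by (rule ln_prod) (use R fin in \<open>auto intro!: zero_less_power_int\<close>)
    also have "\<dots> = (\<Sum>c\<in>?Z - {0}. - of_int (zorder h c) * log_weight R c)"
      by (rule sum.cong) (use R in \<open>auto simp: ln_power_int log_weight_def ln_div algebra_simps\<close>)
    finally show ?thesis .
  qed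
  moreover have "ln (R powi (- ?n)) = - of_int ?n * log_weight R 0"
    using R by (simp add: ln_power_int log_weight_def)
  moreover have "(\<Sum>c\<in>?Z - {0}. - of_int (zorder h c) * log_weight R c) + - of_int ?n * log_weight R 0
     = (\<Sum>c\<in>?Z. - of_int (zorder h c) * log_weight R c)"
  proof (cases "0 \<in> ?Z")
    case True
    thus ?thesis using sum.remove[OF fin True, of "\<lambda>c. - of_int (zorder h c) * log_weight R c"] by simp
  next
    case False
    thus ?thesis using R by (simp add: zeros_poles_def)
  qed
  moreover have "(\<Sum>c\<in>?Z. - of_int (zorder h c) * log_weight R c) = nevanlinna_N R h - nevanlinna_N R (\<lambda>z. 1 / h z)"
    unfolding nevanlinna_N_eq_zeros_poles[OF h reg R] sum_subtractf[symmetric]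
  proof (rule sum.cong)
    fix c
    have "- of_int (zorder h c) = real (nat (- zorder h c)) - real (nat (zorder h c))" by simp
    thus "- of_int (zorder h c) * log_weight R c = real (nat (- zorder h c)) * log_weight R c - real (nat (zorder h c)) * log_weight R c"
      by (simp only: left_diff_distrib)
  qed simp
  moreover have "circle_mean R (\<lambda>z. ln (norm (h z))) = Re (\<phi> 0)"
  proof -
    note c = continuous_on_sphere_holomorphic[OF phi(2,1)]
    have "circle_mean R (\<lambda>z. ln (norm (h z))) = circle_mean R (\<lambda>z. Re (\<phi> z))"
      by (rule circle_mean_cong) (use factorization_Re[of _ R h \<phi>] phi(3) regular_radiusD[OF reg] R in auto)
    also have "\<dots> = Re (circle_mean R \<phi>)"
      by (rule circle_mean_bounded_linear[OF bounded_linear_Re c]) (use R in auto)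
    finally show ?thesis using circle_mean_holomorphic[OF phi(2) R phi(1)] by simp
  qed
  ultimately show ?thesis by linarith
qed

text \<open>Jensen's formula with ln x split as log_plus x - log_plus (1 / x). At regular radii this
  is an identity, with an explicit constant.\<close>

theorem first_main_theorem:
  assumes h: "nonzero_meromorphic h" and reg: "regular_radius h R" and R: "R > 0"
  shows "nevanlinna_T R h = nevanlinna_T R (\<lambda>z. 1 / h z) + ln (norm (zor_poly h 0 0))"
proof -
  have "circle_mean R (\<lambda>z. ln (norm (h z)) + log_plus (norm (1 / h z))) = nevanlinna_m R h"
    unfolding nevanlinna_m_eq
    by (rule circle_mean_cong) (use regular_radiusD[OF reg] R in \<open>auto simp: ln_eq_log_plus norm_divide\<close>)
  moreover have "circle_mean R (\<lambda>z. ln (norm (h z)) + log_plus (norm (1 / h z)))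
    = circle_mean R (\<lambda>z. ln (norm (h z))) + nevanlinna_m R (\<lambda>z. 1 / h z)"
    unfolding nevanlinna_m_eq
    by (rule circle_mean_add) (use regular_radiusD[OF reg] R in \<open>auto intro!: continuous_intros\<close>)
  ultimately show ?thesis using Jensen_formula[OF assms] by (simp add: nevanlinna_T_def)
qed

lemma norm_blaschke_le_1:
  assumes "norm c < R" "norm z \<le> R"
  shows "norm (blaschke R c z) \<le> 1"
proof -
  have R: "R > 0" using assms norm_ge_zero[of c] by linarith
  have "(norm (of_real (R\<^sup>2) - cnj c * z))\<^sup>2 - R\<^sup>2 * (norm (z - c))\<^sup>2 = (R\<^sup>2 - (norm c)\<^sup>2) * (R\<^sup>2 - (norm z)\<^sup>2)"
    unfolding cmod_power2 by (simp add: power2_eq_square algebra_simps)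
  moreover have "\<dots> \<ge> 0" using assms by (intro mult_nonneg_nonneg) (auto intro!: power_mono)
  ultimately have "(R * norm (z - c))\<^sup>2 \<le> (norm (of_real (R\<^sup>2) - cnj c * z))\<^sup>2"
    by (simp add: power_mult_distrib)
  hence "R * norm (z - c) \<le> norm (of_real (R\<^sup>2) - cnj c * z)" by (rule power2_le_imp_le) simp
  thus ?thesis using R blaschke_denom[OF assms]
    by (simp add: blaschke_def norm_divide norm_mult divide_le_eq)
qed

text \<open>Take logarithms in the Blaschke factorization and apply Poisson's formula to its
  holomorphic exponent. Blaschke factors have modulus at most 1 in the disc, so zeros only lower ln
  |h| and may be dropped, while poles leave the sum on the right. Both terms are nonnegative, which
  upgrades \<open>ln\<close> to \<open>log_plus\<close> on the left.\<close>

theorem Poisson_Jensen_inequality: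
  assumes h: "nonzero_meromorphic h" and reg: "regular_radius h R" and R: "R > 0"
    and z: "norm z < R" "h analytic_on {z}" "h z \<noteq> 0"
  shows "log_plus (norm (h z)) \<le> circle_mean R (\<lambda>w. log_plus (norm (h w)) * poisson R z w)
    + (\<Sum>c\<in>zeros_poles h R. real (pole_order h c) * - ln (norm (blaschke R c z)))"
proof -
  let ?Z = "zeros_poles h R"
  obtain R' \<phi> where phi: "R < R'" "\<phi> holomorphic_on ball 0 R'"
    "\<And>z. norm z \<le> R \<Longrightarrow> h analytic_on {z} \<Longrightarrow> h z \<noteq> 0 \<Longrightarrow> h z = blaschke_product h R z * exp (\<phi> z)"
    using blaschke_factorization[OF h reg R] by blast
  note c = continuous_on_sphere_holomorphic[OF phi(2,1)]
  have Re: "Re (\<phi> w) = ln (norm (h w))" if "norm w = R" for w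
    using factorization_Re[of w R h \<phi>] phi(3)[of w] regular_radiusD(1,2)[OF reg, of w] that by auto
  have b: "ln (norm (blaschke R c z)) \<le> 0" if "c \<in> ?Z" for c
  proof -
    have "blaschke R c z \<noteq> 0"
      using that z blaschke_eq_0_iff[of c R z] zorder_eq_0_at_regular[OF z(2,3)] by (auto simp: zeros_poles_def)
    thus ?thesis using that z norm_blaschke_le_1[of c R z] by (auto simp: zeros_poles_def)
  qed
  have "h z = blaschke_product h R z * exp (\<phi> z)" using phi(3) z by simp
  hence "ln (norm (h z)) = ln (norm (blaschke_product h R z)) + Re (\<phi> z)"
    using z by (auto simp: norm_mult ln_mult)
  also have "Re (\<phi> z) = circle_mean R (\<lambda>w. Re (\<phi> w) * poisson R z w)"
    by (rule poisson_formula[symmetric, OF phi(2) R phi(1) z(1)])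
  also have "\<dots> \<le> circle_mean R (\<lambda>w. log_plus (norm (h w)) * poisson R z w)"
    by (rule circle_mean_mono)
       (use c R z regular_radiusD[OF reg] in \<open>auto intro!: continuous_intros mult_right_mono poisson_nonneg log_plus_ge_ln simp: Re\<close>)
  also have "ln (norm (blaschke_product h R z)) = (\<Sum>c\<in>?Z. of_int (zorder h c) * ln (norm (blaschke R c z)))"
    by (rule ln_norm_blaschke_product[OF h]) (use z in \<open>auto intro: zorder_eq_0_at_regular\<close>)
  also have "\<dots> \<le> (\<Sum>c\<in>?Z. real (pole_order h c) * - ln (norm (blaschke R c z)))"
  proof (rule sum_mono)
    fix c assume "c \<in> ?Z"
    hence "- of_int (zorder h c) * - ln (norm (blaschke R c z)) \<le> real (pole_order h c) * - ln (norm (blaschke R c z))"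
      using b by (intro mult_right_mono) (auto simp: pole_order_eq[OF h])
    thus "of_int (zorder h c) * ln (norm (blaschke R c z)) \<le> real (pole_order h c) * - ln (norm (blaschke R c z))" by simp
  qed
  finally have "ln (norm (h z)) \<le> circle_mean R (\<lambda>w. log_plus (norm (h w)) * poisson R z w)
    + (\<Sum>c\<in>?Z. real (pole_order h c) * - ln (norm (blaschke R c z)))" by simp
  moreover have "0 \<le> circle_mean R (\<lambda>w. log_plus (norm (h w)) * poisson R z w)"
    using R z regular_radiusD[OF reg]
    by (intro circle_mean_nonneg) (auto intro!: continuous_intros mult_nonneg_nonneg poisson_nonneg)
  moreover have "0 \<le> (\<Sum>c\<in>?Z. real (pole_order h c) * - ln (norm (blaschke R c z)))"
    using b by (intro sum_nonneg mult_nonneg_nonneg) auto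
  ultimately show ?thesis using z by (intro log_plus_le) auto
qed

section \<open>Monotonicity of the characteristic\<close>

lemma circle_mean_ln_norm_holomorphic:
  assumes G: "G holomorphic_on ball 0 R'" "\<And>z. z \<in> ball 0 R' \<Longrightarrow> G z \<noteq> 0" and r: "0 < r" "r < R'"
  shows "circle_mean r (\<lambda>z. ln (norm (G z))) = ln (norm (G 0))"
proof -
  obtain \<phi> where phi: "\<phi> holomorphic_on ball 0 R'" "\<And>z. z \<in> ball 0 R' \<Longrightarrow> G z = exp (\<phi> z)"
    by (rule contractible_imp_holomorphic_log[OF G(1)])
       (use G in \<open>auto intro: convex_imp_contractible\<close>)
  note c = continuous_on_sphere_holomorphic[OF phi(1) r(2)]
  have "circle_mean r (\<lambda>z. ln (norm (G z))) = circle_mean r (\<lambda>z. Re (\<phi> z))"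
    by (rule circle_mean_cong) (use r phi in auto)
  also have "\<dots> = Re (circle_mean r \<phi>)"
    by (rule circle_mean_bounded_linear[OF bounded_linear_Re c]) (use r in auto)
  also have "\<dots> = ln (norm (G 0))"
    using circle_mean_holomorphic[OF phi(1) r] phi(2)[of 0] r by simp
  finally show ?thesis .
qed

text \<open>For norm c > r the factor has no zero in the disc of radius \<open>r\<close>, and the
  mean value property applies. Otherwise z - c is replaced by (r^2 - cnj c z) / r, which has the
  same modulus on the circle of radius \<open>r\<close> and no zero inside.\<close>

lemma circle_mean_ln_norm_blaschke:
  assumes c: "norm c < R" "norm c \<noteq> r" and r: "0 < r" "r < R"
  shows "circle_mean r (\<lambda>z. ln (norm (blaschke R c z))) = (if norm c < r then ln (r / R) else ln (norm c / R))"
proof (cases "norm c < r")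
  case True
  define G where "G z = of_real R * (of_real (r\<^sup>2) - cnj c * z) / (of_real r * (of_real (R\<^sup>2) - cnj c * z))" for z
  obtain R2 where R2: "r < R2" "R2 \<le> R" "\<And>w. norm w < R2 \<Longrightarrow> of_real (r\<^sup>2) - cnj c * w \<noteq> 0"
    using reflected_radius[OF True r] by blast
  have d: "of_real (R\<^sup>2) - cnj c * w \<noteq> 0" if "norm w < R2" for w
    using blaschke_denom[OF c(1), of w] that R2 by auto
  have "circle_mean r (\<lambda>z. ln (norm (blaschke R c z))) = circle_mean r (\<lambda>z. ln (norm (G z)))"
  proof (rule circle_mean_cong)
    fix z :: complex assume z: "norm z = r"
    have "of_real (r\<^sup>2) = z * cnj z" using z by (simp add: complex_norm_square[symmetric] of_real_power)
    hence "of_real (r\<^sup>2) - cnj c * z = z * cnj (z - c)" by (simp add: algebra_simps)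
    hence "norm (of_real (r\<^sup>2) - cnj c * z) = r * norm (z - c)" using z by (simp add: norm_mult del: complex_cnj_diff)
    thus "ln (norm (blaschke R c z)) = ln (norm (G z))"
      unfolding G_def blaschke_def using r by (simp only: norm_mult norm_divide) simp
  qed (use r in auto)
  also have "\<dots> = ln (norm (G 0))"
    by (rule circle_mean_ln_norm_holomorphic[where R' = R2])
       (use R2 r d in \<open>auto simp: G_def intro!: holomorphic_intros\<close>)
  also have "norm (G 0) = r / R" using r by (simp add: G_def norm_divide norm_mult power2_eq_square)
  finally show ?thesis using True by simp
next
  case False
  hence cr: "norm c > r" using c by auto
  have "circle_mean r (\<lambda>z. ln (norm (blaschke R c z))) = ln (norm (blaschke R c 0))"
  proof (rule circle_mean_ln_norm_holomorphic[where R' = "norm c"])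
    have "blaschke R c analytic_on {z}" if "z \<in> ball 0 (norm c)" for z
      using blaschke_analytic[OF c(1), of z] that c by auto
    thus "blaschke R c holomorphic_on ball 0 (norm c)"
      using analytic_imp_holomorphic analytic_on_analytic_at by blast
    show "blaschke R c z \<noteq> 0" if "z \<in> ball 0 (norm c)" for z
      using blaschke_eq_0_iff[OF c(1), of z] that c by auto
  qed (use cr r in auto)
  also have "norm (blaschke R c 0) = norm c / R"
    using r by (simp add: blaschke_def norm_divide norm_mult power2_eq_square)
  finally show ?thesis using False by simp
qed

text \<open>Borel's lemma needs monotonicity. It follows by averaging the Poisson-Jensen inequality
  over the circle of radius \<open>r\<close>: after exchanging the means the kernel averages to 1
  and leaves m(R, h). A pole \<open>c\<close> contributes ln (R / r) if norm c < r and its full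
  weight at \<open>R\<close> otherwise, in total N(R, h) - N(r, h).\<close>

theorem nevanlinna_T_mono:
  assumes h: "nonzero_meromorphic h" and reg: "regular_radius h r" "regular_radius h R" and r: "0 < r" "r < R"
  shows "nevanlinna_T r h \<le> nevanlinna_T R h"
proof -
  let ?Z = "zeros_poles h R"
  have fin: "finite ?Z" using h by blast
  have R: "R > 0" using r by simp
  define k where "k z w = log_plus (norm (h w)) * poisson R z w" for z w
  have ck: "continuous_on (sphere 0 r \<times> sphere 0 R) (\<lambda>(z, w). k z w)"
    unfolding k_def poisson_def case_prod_beta
    by (intro continuous_intros continuous_on_compose2[OF regular_radiusD(3)[OF reg(2)]]) (use r in auto)
  have cn: "norm c \<noteq> r" if "c \<in> ?Z" for c
    using that regular_radiusD(1,2)[OF reg(1), of c] by (auto simp: zeros_poles_def dest: zorder_eq_0_at_regular)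
  have ckm: "continuous_on (sphere 0 r) (\<lambda>z. circle_mean R (\<lambda>w. k z w))"
  proof -
    have "continuous_on (sphere 0 r) (\<lambda>z. integral (cbox 0 (2*pi)) (\<lambda>\<theta>. k z (of_real R * cis \<theta>)))"
      by (rule integral_continuous_on_param, unfold case_prod_beta)
         (rule continuous_on_compose2[OF ck, where f = "\<lambda>p. (fst p, of_real R * cis (snd p))", simplified],
          use R in \<open>auto intro!: continuous_intros simp: norm_mult\<close>)
    thus ?thesis unfolding circle_mean_def by (auto intro!: continuous_intros simp: cbox_interval)
  qed
  have cb: "continuous_on (sphere 0 r) (\<lambda>z. ln (norm (blaschke R c z)))" if "c \<in> ?Z" for c
  proof (intro continuous_intros)
    have c: "norm c < R" using that by (simp add: zeros_poles_def)
    show "continuous_on (sphere 0 r) (blaschke R c)"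
      by (rule continuous_on_regular) (use c r in \<open>auto intro!: blaschke_analytic\<close>)
    show "\<forall>z\<in>sphere 0 r. norm (blaschke R c z) \<noteq> 0"
      using c r cn[OF that] by (auto simp: blaschke_eq_0_iff)
  qed
  have "nevanlinna_m r h \<le> circle_mean r (\<lambda>z. circle_mean R (\<lambda>w. k z w) + (\<Sum>c\<in>?Z. real (pole_order h c) * - ln (norm (blaschke R c z))))"
    unfolding nevanlinna_m_eq
    by (rule circle_mean_mono)
       (use Poisson_Jensen_inequality[OF h reg(2) R] regular_radiusD[OF reg(1)] r in
         \<open>auto intro!: continuous_intros ckm[unfolded k_def] cb simp: k_def\<close>)
  also have "\<dots> = circle_mean r (\<lambda>z. circle_mean R (\<lambda>w. k z w)) + circle_mean r (\<lambda>z. \<Sum>c\<in>?Z. real (pole_order h c) * - ln (norm (blaschke R c z)))"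
    by (rule circle_mean_add) (use r in \<open>auto intro!: continuous_intros ckm cb\<close>)
  also have "circle_mean r (\<lambda>z. circle_mean R (\<lambda>w. k z w)) = circle_mean R (\<lambda>w. circle_mean r (\<lambda>z. k z w))"
    by (rule circle_mean_swap[OF ck]) (use r in auto)
  also have "\<dots> = nevanlinna_m R h"
    unfolding nevanlinna_m_eq
  proof (rule circle_mean_cong)
    fix w :: complex assume w: "norm w = R"
    have "circle_mean r (\<lambda>z. k z w) = log_plus (norm (h w)) * circle_mean r (\<lambda>z. poisson R z w)"
      unfolding k_def poisson_def
      by (rule circle_mean_cmult) (use w r in \<open>auto intro!: continuous_intros\<close>)
    thus "circle_mean r (\<lambda>z. k z w) = log_plus (norm (h w))" using circle_mean_poisson[OF w r] by simp
  qed (use r in auto)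
  also have "circle_mean r (\<lambda>z. \<Sum>c\<in>?Z. real (pole_order h c) * - ln (norm (blaschke R c z)))
    = (\<Sum>c\<in>?Z. - real (pole_order h c) * circle_mean r (\<lambda>z. ln (norm (blaschke R c z))))"
  proof (subst circle_mean_sum)
    have "circle_mean r (\<lambda>z. real (pole_order h c) * - ln (norm (blaschke R c z)))
      = - real (pole_order h c) * circle_mean r (\<lambda>z. ln (norm (blaschke R c z)))" if "c \<in> ?Z" for c
      using circle_mean_cmult[OF cb[OF that], of "- real (pole_order h c)"] r by simp
    thus "(\<Sum>c\<in>?Z. circle_mean r (\<lambda>z. real (pole_order h c) * - ln (norm (blaschke R c z))))
      = (\<Sum>c\<in>?Z. - real (pole_order h c) * circle_mean r (\<lambda>z. ln (norm (blaschke R c z))))"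
      by (intro sum.cong refl)
  qed (use r fin in \<open>auto intro!: continuous_intros cb\<close>)
  also have "\<dots> = (\<Sum>c\<in>?Z. real (pole_order h c) * log_weight R c - (if norm c < r then real (pole_order h c) * log_weight r c else 0))"
  proof (rule sum.cong)
    fix c assume c: "c \<in> ?Z"
    show "- real (pole_order h c) * circle_mean r (\<lambda>z. ln (norm (blaschke R c z)))
      = real (pole_order h c) * log_weight R c - (if norm c < r then real (pole_order h c) * log_weight r c else 0)"
      using c cn[OF c] r by (subst circle_mean_ln_norm_blaschke) (auto simp: zeros_poles_def log_weight_def ln_div algebra_simps)
  qed simp
  also have "\<dots> = nevanlinna_N R h - nevanlinna_N r h"
  proof -
    have "nevanlinna_N r h = (\<Sum>c\<in>zeros_poles h r. real (pole_order h c) * log_weight r c)"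
      using nevanlinna_N_eq_zeros_poles(1)[OF h reg(1) r(1)] by (simp add: pole_order_eq[OF h])
    also have "\<dots> = (\<Sum>c\<in>?Z. if norm c < r then real (pole_order h c) * log_weight r c else 0)"
      by (rule sum.mono_neutral_cong_left) (use fin r in \<open>auto simp: zeros_poles_def\<close>)
    finally show ?thesis
      using nevanlinna_N_eq_zeros_poles(1)[OF h reg(2) R] by (simp add: sum_subtractf pole_order_eq[OF h])
  qed
  finally show ?thesis by (simp add: nevanlinna_T_def)
qed

section \<open>The logarithmic derivative\<close>

lemma deriv_blaschke_product:
  assumes h: "nonzero_meromorphic h" and z: "norm z < R" "zorder h z = 0"
  shows "deriv (blaschke_product h R) z = blaschke_product h R z *
    (\<Sum>c\<in>zeros_poles h R. of_int (zorder h c) * (1 / (z - c) + cnj c / (of_real (R\<^sup>2) - cnj c * z)))"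
proof (rule DERIV_imp_deriv)
  let ?Z = "zeros_poles h R" and ?t = "\<lambda>c. 1 / (z - c) + cnj c / (of_real (R\<^sup>2) - cnj c * z)"
  have R: "R > 0" using z norm_ge_zero[of z] by linarith
  have nz: "blaschke R c z \<noteq> 0" "z - c \<noteq> 0" "of_real (R\<^sup>2) - cnj c * z \<noteq> 0" if "c \<in> ?Z" for c
    using that z blaschke_eq_0_iff[of c R z] blaschke_denom[of c R z] by (auto simp: zeros_poles_def)
  have d: "((\<lambda>w. blaschke R c w powi zorder h c) has_field_derivative
     (blaschke R c z powi zorder h c * (of_int (zorder h c) * ?t c))) (at z)"
    if c: "c \<in> ?Z" for c
  proof -
    have "(blaschke R c has_field_derivative
       (of_real R * (of_real (R\<^sup>2) - cnj c * z) + of_real R * (z - c) * cnj c) / (of_real (R\<^sup>2) - cnj c * z)\<^sup>2) (at z)"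
      unfolding blaschke_def[abs_def]
      using nz(3)[OF c] by (auto intro!: derivative_eq_intros simp: power2_eq_square)
    also have "(of_real R * (of_real (R\<^sup>2) - cnj c * z) + of_real R * (z - c) * cnj c) / (of_real (R\<^sup>2) - cnj c * z)\<^sup>2
      = blaschke R c z * ?t c"
    proof -
      have "(\<rho> * D + \<rho> * u * e) / D\<^sup>2 = \<rho> * u / D * (1 / u + e / D)" if "u \<noteq> 0" "D \<noteq> 0" for \<rho> D u e :: complex
        using that by (simp add: field_simps power2_eq_square)
      from this[OF nz(2,3)[OF c]] show ?thesis unfolding blaschke_def .
    qed
    finally have b: "(blaschke R c has_field_derivative blaschke R c z * ?t c) (at z)" .
    show ?thesis
      using nz(1)[OF c] by (auto intro!: derivative_eq_intros b simp: power_int_diff)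
  qed
  show "(blaschke_product h R has_field_derivative blaschke_product h R z *
    (\<Sum>c\<in>?Z. of_int (zorder h c) * ?t c)) (at z)"
  proof -
    have "((\<lambda>w. \<Prod>c\<in>?Z. blaschke R c w powi zorder h c) has_field_derivative
      (\<Prod>c\<in>?Z. blaschke R c z powi zorder h c) * (\<Sum>c\<in>?Z. blaschke R c z powi zorder h c * (of_int (zorder h c) * ?t c) / blaschke R c z powi zorder h c)) (at z)"
      by (rule has_field_derivative_prod') (use d nz in auto)
    also have "(\<Sum>c\<in>?Z. blaschke R c z powi zorder h c * (of_int (zorder h c) * ?t c) / blaschke R c z powi zorder h c)
      = (\<Sum>c\<in>?Z. of_int (zorder h c) * ?t c)"
      by (rule sum.cong) (use nz in auto)
    finally show ?thesis unfolding blaschke_product_def[abs_def] .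
  qed
qed

text \<open>Only the term with a pole at \<open>c\<close> can be large. The reflected pole lies
  outside the disc, and |R^2 - cnj c z| \<ge> R (R - |z|) bounds its term uniformly in
  \<open>c\<close>.\<close>

lemma norm_log_deriv_blaschke_le:
  assumes c: "norm c < R" and z: "norm z < R"
  shows "norm (1 / (z - c) + cnj c / (of_real (R\<^sup>2) - cnj c * z)) \<le> 1 / norm (z - c) + 1 / (R - norm z)"
proof -
  have R: "R > 0" using z norm_ge_zero[of z] by linarith
  have "R * (R - norm z) \<le> R * R - norm c * norm z"
    using c mult_right_mono[of "norm c" R "norm z"] by (simp add: algebra_simps)
  also have "\<dots> \<le> norm (of_real (R\<^sup>2) - cnj c * z)"
    using norm_triangle_ineq2[of "of_real (R\<^sup>2)" "cnj c * z"] by (simp add: norm_mult norm_power power2_eq_square)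
  finally have d: "R * (R - norm z) \<le> norm (of_real (R\<^sup>2) - cnj c * z)" .
  have "norm (cnj c / (of_real (R\<^sup>2) - cnj c * z)) = norm c / norm (of_real (R\<^sup>2) - cnj c * z)"
    by (simp add: norm_divide)
  also have "\<dots> \<le> R / (R * (R - norm z))"
    by (rule frac_le) (use d c z R in auto)
  also have "\<dots> = 1 / (R - norm z)" using R by simp
  finally have "norm (cnj c / (of_real (R\<^sup>2) - cnj c * z)) \<le> 1 / (R - norm z)" .
  thus ?thesis using norm_triangle_ineq[of "1 / (z - c)" "cnj c / (of_real (R\<^sup>2) - cnj c * z)"]
    by (simp add: norm_divide)
qed

text \<open>The logarithmic derivative of the Blaschke factorization is \<phi>' plus one term for
  each zero or pole. The former is controlled by the boundary values of |Re \<phi>| = |ln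
  |h||.\<close>

lemma norm_log_deriv_le:
  assumes h: "nonzero_meromorphic h" and reg: "regular_radius h R"
    and z: "norm z < R" "h analytic_on {z}" "h z \<noteq> 0"
  shows "norm (deriv h z / h z) \<le> 2 * R / (R - norm z)\<^sup>2 * circle_mean R (\<lambda>w. \<bar>ln (norm (h w))\<bar>)
    + (\<Sum>c\<in>zeros_poles h R. \<bar>of_int (zorder h c)\<bar> * (1 / norm (z - c) + 1 / (R - norm z)))"
proof -
  let ?Z = "zeros_poles h R"
  have R: "R > 0" using z norm_ge_zero[of z] by linarith
  have fin: "finite ?Z" using h by blast
  obtain R' \<phi> where phi: "R < R'" "\<phi> holomorphic_on ball 0 R'"
    "\<And>z. norm z \<le> R \<Longrightarrow> h analytic_on {z} \<Longrightarrow> h z \<noteq> 0 \<Longrightarrow> h z = blaschke_product h R z * exp (\<phi> z)"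
    using blaschke_factorization[OF h reg R] by blast
  have Re: "Re (\<phi> w) = ln (norm (h w))" if "norm w = R" for w
    using factorization_Re[of w R h \<phi>] phi(3)[of w] regular_radiusD(1,2)[OF reg, of w] that by auto
  let ?S = "\<Sum>c\<in>?Z. of_int (zorder h c) * (1 / (z - c) + cnj c / (of_real (R\<^sup>2) - cnj c * z))"
  note z0 = zorder_eq_0_at_regular[OF z(2,3)]
  have "eventually (\<lambda>w. w \<in> ball 0 R) (nhds z)" using z by (intro eventually_nhds_in_open) auto
  hence "eventually (\<lambda>w. h w = blaschke_product h R w * exp (\<phi> w)) (nhds z)"
    using regular_at_imp_regular_near[OF z(2,3)] by eventually_elim (use phi(3) in auto)
  hence "deriv h z = deriv (\<lambda>w. blaschke_product h R w * exp (\<phi> w)) z"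
    by (rule deriv_cong_ev) simp
  also have "\<dots> = deriv (blaschke_product h R) z * exp (\<phi> z) + blaschke_product h R z * (exp (\<phi> z) * deriv \<phi> z)"
  proof (rule DERIV_imp_deriv)
    have "(\<phi> has_field_derivative deriv \<phi> z) (at z)"
      using holomorphic_derivI[OF phi(2), of z] z phi(1) by simp
    moreover have "(blaschke_product h R has_field_derivative deriv (blaschke_product h R) z) (at z)"
      using blaschke_product_regular(1)[OF h, of z R] z z0 by (intro analytic_derivI) auto
    ultimately show "((\<lambda>w. blaschke_product h R w * exp (\<phi> w)) has_field_derivative
       deriv (blaschke_product h R) z * exp (\<phi> z) + blaschke_product h R z * (exp (\<phi> z) * deriv \<phi> z)) (at z)"
      by (auto intro!: derivative_eq_intros)
  qed
  finally have d: "deriv h z = deriv (blaschke_product h R) z * exp (\<phi> z) + blaschke_product h R z * (exp (\<phi> z) * deriv \<phi> z)" .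
  have hz: "h z = blaschke_product h R z * exp (\<phi> z)" by (rule phi(3)) (use z in auto)
  have alg: "B * s * e + B * (e * p) = (p + s) * (B * e)" for B s e p :: complex
    by (simp add: algebra_simps)
  have eq: "deriv h z = (deriv \<phi> z + ?S) * h z"
    unfolding d hz deriv_blaschke_product[OF h z(1) z0] by (rule alg)
  have "deriv h z / h z = deriv \<phi> z + ?S"
    unfolding eq using z(3) by (rule nonzero_mult_div_cancel_right)
  hence 1: "norm (deriv h z / h z) \<le> norm (deriv \<phi> z) + norm ?S" by (simp only: norm_triangle_ineq)
  have 2: "norm (deriv \<phi> z) \<le> 2 * R / (R - norm z)\<^sup>2 * circle_mean R (\<lambda>w. \<bar>Re (\<phi> w)\<bar>)"
    by (rule norm_deriv_le_circle_mean[OF phi(2) R phi(1) z(1)])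
  have 3: "circle_mean R (\<lambda>w. \<bar>Re (\<phi> w)\<bar>) = circle_mean R (\<lambda>w. \<bar>ln (norm (h w))\<bar>)"
    by (rule circle_mean_cong) (use Re R in auto)
  have 4: "norm ?S \<le> (\<Sum>c\<in>?Z. \<bar>of_int (zorder h c)\<bar> * (1 / norm (z - c) + 1 / (R - norm z)))"
  proof (rule sum_norm_le)
    fix c assume "c \<in> ?Z"
    hence "norm (1 / (z - c) + cnj c / (of_real (R\<^sup>2) - cnj c * z)) \<le> 1 / norm (z - c) + 1 / (R - norm z)"
      by (intro norm_log_deriv_blaschke_le z(1)) (simp add: zeros_poles_def)
    thus "norm (of_int (zorder h c) * (1 / (z - c) + cnj c / (of_real (R\<^sup>2) - cnj c * z)))
       \<le> \<bar>of_int (zorder h c)\<bar> * (1 / norm (z - c) + 1 / (R - norm z))"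
      unfolding norm_mult norm_of_int by (rule mult_left_mono) simp
  qed
  show ?thesis using order_trans[OF 1 add_mono[OF 2 4]] unfolding 3 .
qed

section \<open>Means of inverse square roots of distances on a circle\<close>

lemma abs_sin_ge:
  fixes x :: real assumes "\<bar>x\<bar> \<le> pi / 2"
  shows "\<bar>x\<bar> / 4 \<le> \<bar>sin x\<bar>"
proof -
  have "y / 4 \<le> sin y" if y: "0 < y" "y \<le> pi / 2" for y :: real
  proof (cases "y \<le> pi / 3")
    case True
    have "\<exists>w. 0 < w \<and> w < y \<and> sin y - sin 0 = (y - 0) * cos w"
      by (rule MVT2) (use y in \<open>auto intro!: derivative_eq_intros\<close>)
    then obtain w where w: "0 < w" "w < y" "sin y = y * cos w" by auto
    have "cos (pi / 3) \<le> cos w" using w True by (intro cos_monotone_0_pi_le) auto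
    hence "y * (1/4) \<le> y * cos w" using y by (intro mult_left_mono) (auto simp: cos_60)
    thus ?thesis using w by simp
  next
    case False
    have "sin (pi / 6) \<le> sin y" using False y by (intro sin_monotone_2pi_le) auto
    thus ?thesis using y pi_less_4 by (simp add: sin_30)
  qed
  from this[of x] this[of "-x"] show ?thesis using assms by (cases "x > 0"; cases "x = 0") auto
qed

text \<open>The primitive 2 sgn (t - b) sqrt |t - b| stays continuous across \<open>b\<close>, so
  the fundamental theorem of calculus tolerates the singular point, whether or not it lies in the
  interval.\<close>

lemma has_integral_inverse_sqrt_abs:
  fixes b :: real
  shows "((\<lambda>t. 1 / sqrt \<bar>t - b\<bar>) has_integral
     (2 * sgn (2 * pi - b) * sqrt \<bar>2 * pi - b\<bar> - 2 * sgn (0 - b) * sqrt \<bar>0 - b\<bar>)) {0..2*pi}"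
proof (rule fundamental_theorem_of_calculus_interior_strong[where S = "{b}" and f = "\<lambda>t. 2 * sgn (t - b) * sqrt \<bar>t - b\<bar>"])
  fix t assume "t \<in> {0<..<2*pi} - {b}"
  hence t: "t \<noteq> b" by auto
  have "((\<lambda>t. 2 * sgn (t - b) * sqrt \<bar>t - b\<bar>) has_real_derivative 1 / sqrt \<bar>t - b\<bar>) (at t)"
  proof (cases "t > b")
    case True
    have "((\<lambda>t. 2 * sqrt (t - b)) has_real_derivative 1 / sqrt \<bar>t - b\<bar>) (at t)"
      using True by (auto intro!: derivative_eq_intros simp: field_simps)
    moreover have "eventually (\<lambda>t. 2 * sqrt (t - b) = 2 * sgn (t - b) * sqrt \<bar>t - b\<bar>) (nhds t)"
      using eventually_nhds_in_open[of "{b<..}" t] True by (auto elim!: eventually_mono)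
    ultimately show ?thesis using DERIV_cong_ev[OF refl _ refl] by fast
  next
    case False
    have "((\<lambda>t. - 2 * sqrt (b - t)) has_real_derivative 1 / sqrt \<bar>t - b\<bar>) (at t)"
      using False t by (auto intro!: derivative_eq_intros simp: field_simps)
    moreover have "eventually (\<lambda>t. - 2 * sqrt (b - t) = 2 * sgn (t - b) * sqrt \<bar>t - b\<bar>) (nhds t)"
      using eventually_nhds_in_open[of "{..<b}" t] False t by (auto elim!: eventually_mono)
    ultimately show ?thesis using DERIV_cong_ev[OF refl _ refl] by fast
  qed
  thus "((\<lambda>t. 2 * sgn (t - b) * sqrt \<bar>t - b\<bar>) has_vector_derivative 1 / sqrt \<bar>t - b\<bar>) (at t)"
    by (simp add: has_real_derivative_iff_has_vector_derivative)
next
  have "(\<lambda>t. 2 * sgn (t - b) * sqrt \<bar>t - b\<bar>) = (\<lambda>t. 2 * sqrt (max 0 (t - b)) - 2 * sqrt (max 0 (b - t)))"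
    by (rule ext) (auto simp: sgn_if max_def)
  thus "continuous_on {0..2*pi} (\<lambda>t. 2 * sgn (t - b) * sqrt \<bar>t - b\<bar>)"
    by (simp only:) (intro continuous_intros)
qed auto

text \<open>The bound must not depend on \<open>c\<close>, although \<open>c\<close> may come
  arbitrarily close to the circle. With 1 / norm (z - c) itself no such bound exists; the exponent
  1/2 makes the singularity integrable. The constant is generous.\<close>

lemma circle_mean_inverse_sqrt_le:
  assumes r: "1 \<le> r" and c: "norm c \<noteq> r"
  shows "circle_mean r (\<lambda>z. 1 / sqrt (norm (z - c))) \<le> 32"
proof -
  define \<alpha> where "\<alpha> = Arg c"
  have al: "- pi < \<alpha>" "\<alpha> \<le> pi" using Arg_bounded[of c] by (auto simp: \<alpha>_def)
  have ca: "c = of_real (norm c) * cis \<alpha>" using rcis_cmod_Arg[of c] by (simp add: \<alpha>_def rcis_def)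
  \<comment> \<open>The argument of \<open>c\<close> lies in (-pi, pi], so within [0, 2 pi] the
    nearest singular angle is \<alpha> or \<alpha> + 2 pi; both are included.\<close>
  define B where "B t = 3 * (1 / sqrt \<bar>t - \<alpha>\<bar>) + 3 * (1 / sqrt \<bar>t - (\<alpha> + 2 * pi)\<bar>)" for t :: real
  \<comment> \<open>At a singular angle one term of \<open>B\<close> is 1 / 0 = 0 and the pointwise
    bound could fail, so the integrand is set to 0 there.\<close>
  define f where "f t = (if t = \<alpha> \<or> t = \<alpha> + 2 * pi then 0 else 1 / sqrt (norm (of_real r * cis t - c)))" for t
  let ?I = "\<lambda>b. 2 * sgn (2 * pi - b) * sqrt \<bar>2 * pi - b\<bar> - 2 * sgn (0 - b) * sqrt \<bar>0 - b\<bar>"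
  have B: "(B has_integral 3 * ?I \<alpha> + 3 * ?I (\<alpha> + 2 * pi)) {0..2*pi}"
    unfolding B_def by (intro has_integral_add has_integral_mult_right has_integral_inverse_sqrt_abs)
  have I: "?I b \<le> 16" if "- pi < b" "b \<le> 3 * pi" for b
  proof -
    have s: "s * sqrt y \<le> 4" if "y \<le> 16" "\<bar>s\<bar> \<le> 1" "0 \<le> y" for s y :: real
    proof -
      have "sqrt y \<le> 4" using that real_sqrt_le_mono[of y 16] by simp
      moreover have "s * sqrt y \<le> 1 * sqrt y" using that by (intro mult_right_mono) auto
      ultimately show ?thesis by simp
    qed
    have "sgn (2 * pi - b) * sqrt \<bar>2 * pi - b\<bar> \<le> 4" "(- sgn (0 - b)) * sqrt \<bar>0 - b\<bar> \<le> 4"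
      using that pi_less_4 by (intro s; auto simp: abs_if sgn_if)+
    thus ?thesis by linarith
  qed
  have cont: "continuous_on (sphere 0 r) (\<lambda>z. 1 / sqrt (norm (z - c)))"
    using c by (intro continuous_intros) auto
  have "(\<lambda>t. 1 / sqrt (norm (of_real r * cis t - c))) integrable_on {0..2*pi}"
    by (rule circle_integrable[OF cont]) (use r in auto)
  hence "((\<lambda>t. 1 / sqrt (norm (of_real r * cis t - c))) has_integral
     integral {0..2*pi} (\<lambda>t. 1 / sqrt (norm (of_real r * cis t - c)))) {0..2*pi}" by (rule integrable_integral)
  hence "(f has_integral integral {0..2*pi} (\<lambda>t. 1 / sqrt (norm (of_real r * cis t - c)))) {0..2*pi}"
    by (rule has_integral_spike_finite[of "{\<alpha>, \<alpha> + 2 * pi}", rotated 2]) (auto simp: f_def)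
  hence "integral {0..2*pi} (\<lambda>t. 1 / sqrt (norm (of_real r * cis t - c))) \<le> 3 * ?I \<alpha> + 3 * ?I (\<alpha> + 2 * pi)"
  proof (rule has_integral_le[OF _ B])
    fix t assume t: "t \<in> {0..2*pi}"
    show "f t \<le> B t"
    proof (cases "t = \<alpha> \<or> t = \<alpha> + 2 * pi")
      case False
      let ?d = "norm (of_real r * cis t - c)"
      define x where "x = (t - \<alpha>) / 2"
      have x2: "2 * x = t - \<alpha>" by (simp add: x_def)
      \<comment> \<open>\<open>x\<close> reduced modulo pi to [-pi/2, pi/2], which preserves |sin|.
        The two cases belong to the two singular angles.\<close>
      define y where "y = (if x \<le> pi / 2 then x else x - pi)"
      have xb: "- (pi / 2) \<le> x" "x \<le> 3 * pi / 2" using t al by (auto simp: x_def)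
      have y: "\<bar>y\<bar> \<le> pi / 2" "y \<noteq> 0" "\<bar>sin x\<bar> = \<bar>sin y\<bar>"
      proof -
        show "\<bar>y\<bar> \<le> pi / 2" using xb unfolding y_def by (auto simp: abs_if)
        show "y \<noteq> 0" using False by (auto simp: y_def x_def field_simps)
        show "\<bar>sin x\<bar> = \<bar>sin y\<bar>" by (simp add: y_def sin_diff)
      qed
      have "(norm (cis t - cis \<alpha>))\<^sup>2 = (2 * sin x)\<^sup>2"
      proof -
        have "(norm (cis t - cis \<alpha>))\<^sup>2 = (cos t - cos \<alpha>)\<^sup>2 + (sin t - sin \<alpha>)\<^sup>2" by (simp add: cmod_power2)
        also have "\<dots> = (cos t)\<^sup>2 + (sin t)\<^sup>2 + ((cos \<alpha>)\<^sup>2 + (sin \<alpha>)\<^sup>2) - 2 * cos (t - \<alpha>)"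
          unfolding cos_diff by (simp add: power2_eq_square algebra_simps)
        also have "\<dots> = 2 - 2 * cos (2 * x)" by (simp add: x2)
        also have "\<dots> = (2 * sin x)\<^sup>2" unfolding cos_double_sin by (simp add: power2_eq_square)
        finally show ?thesis .
      qed
      hence "(norm (cis t - cis \<alpha>))\<^sup>2 = (2 * \<bar>sin x\<bar>)\<^sup>2" by (simp add: power_mult_distrib)
      hence nd: "norm (cis t - cis \<alpha>) = 2 * \<bar>sin x\<bar>" by (subst (asm) power2_eq_iff_nonneg) auto
      \<comment> \<open>Triangle inequality through the point of the circle on the ray of
        \<open>c\<close>. Its distance from \<open>c\<close> is |norm c - r| \<le>
        \<open>?d\<close>, so the chord 2 r |sin x| is at most 2 \<open>?d\<close>.\<close>
      have "norm (of_real r * cis t - of_real r * cis \<alpha>) = \<bar>r\<bar> * norm (cis t - cis \<alpha>)"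
        by (simp only: right_diff_distrib[symmetric] norm_mult norm_of_real)
      hence "norm (of_real r * cis t - of_real r * cis \<alpha>) = 2 * (r * \<bar>sin x\<bar>)"
        using r by (simp add: nd)
      moreover have "norm (of_real r * cis t - of_real r * cis \<alpha>)
         \<le> ?d + norm (c - of_real r * cis \<alpha>)"
        using norm_triangle_ineq[of "of_real r * cis t - c" "c - of_real r * cis \<alpha>"] by simp
      moreover have "norm (c - of_real r * cis \<alpha>) = \<bar>norm c - r\<bar>"
      proof -
        have "c - of_real r * cis \<alpha> = of_real (norm c - r) * cis \<alpha>" by (subst ca) (simp add: algebra_simps)
        thus ?thesis by (simp only: norm_mult norm_of_real norm_cis mult_1_right)
      qed
      moreover have "\<bar>norm c - r\<bar> \<le> ?d"
        using norm_triangle_ineq3[of c "of_real r * cis t"] r by (simp add: norm_mult norm_minus_commute)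
      ultimately have "r * \<bar>sin x\<bar> \<le> ?d" by linarith
      moreover have "\<bar>sin x\<bar> \<le> r * \<bar>sin x\<bar>" using r mult_right_mono[of 1 r "\<bar>sin x\<bar>"] by simp
      ultimately have "\<bar>y\<bar> / 4 \<le> ?d" using abs_sin_ge[OF y(1)] y(3) by linarith
      \<comment> \<open>Weakened from 8 to 9 to have an integral square root, the factor 3 in
        \<open>B\<close>.\<close>
      hence "\<bar>2 * y\<bar> / 9 \<le> ?d" by simp
      hence "sqrt (\<bar>2 * y\<bar> / 9) \<le> sqrt (?d)" by (rule real_sqrt_le_mono)
      moreover have "sqrt (\<bar>2 * y\<bar> / 9) = sqrt \<bar>2 * y\<bar> / 3" by (simp add: real_sqrt_divide)
      moreover have "0 < sqrt \<bar>2 * y\<bar>" using y by simp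
      ultimately have "1 / sqrt (?d) \<le> 1 / (sqrt \<bar>2 * y\<bar> / 3)"
        by (intro divide_left_mono) (auto intro!: mult_pos_pos)
      hence "f t \<le> 3 * (1 / sqrt \<bar>2 * y\<bar>)" using False by (simp add: f_def)
      also have "2 * y = t - \<alpha> \<or> 2 * y = t - (\<alpha> + 2 * pi)" by (auto simp: y_def x_def)
      hence "3 * (1 / sqrt \<bar>2 * y\<bar>) \<le> B t" unfolding B_def by (auto simp del: abs_mult)
      finally show ?thesis .
    qed (auto simp: f_def B_def)
  qed
  also have "\<dots> \<le> 96" using I[of \<alpha>] I[of "\<alpha> + 2 * pi"] al by auto
  finally have "integral {0..2*pi} (\<lambda>t. 1 / sqrt (norm (of_real r * cis t - c))) \<le> 96" .
  hence "circle_mean r (\<lambda>z. 1 / sqrt (norm (z - c))) \<le> 1 / (2 * pi) * 96"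
    unfolding circle_mean_def real_scaleR_def by (intro mult_left_mono) auto
  also have "\<dots> \<le> 32" using pi_ge_two pi_gt3 by (simp add: field_simps)
  finally show ?thesis .
qed

definition divisor_degree :: "(complex \<Rightarrow> complex) \<Rightarrow> real \<Rightarrow> real" where
  "divisor_degree h R = (\<Sum>c\<in>zeros_poles h R. \<bar>of_int (zorder h c)\<bar>)"

lemma divisor_degree_nonneg: "0 \<le> divisor_degree h R"
  unfolding divisor_degree_def by (rule sum_nonneg) simp

text \<open>Trades each singularity 1 / norm (z - c) for its square root, whose circle mean is
  bounded.\<close>

lemma log_plus_le_2_ln_sqrt: "0 \<le> x \<Longrightarrow> log_plus x \<le> 2 * ln (1 + sqrt x)"
proof -
  assume x: "0 \<le> x"
  have "max 1 x \<le> (1 + sqrt x)\<^sup>2" using x by (auto simp: power2_sum)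
  hence "ln (max 1 x) \<le> ln ((1 + sqrt x)\<^sup>2)" by (subst ln_le_cancel_iff) (use x in \<open>auto simp: add_pos_nonneg\<close>)
  also have "\<dots> = 2 * ln (1 + sqrt x)" using x by (simp add: ln_realpow add_pos_nonneg)
  finally show ?thesis by (simp add: log_plus_def)
qed

lemma sqrt_sum_le:
  assumes "finite S" "\<And>i. i \<in> S \<Longrightarrow> 0 \<le> f i"
  shows "sqrt (\<Sum>i\<in>S. f i) \<le> (\<Sum>i\<in>S. sqrt (f i))"
  using assms
proof (induction S rule: finite_induct)
  case (insert i S)
  have "sqrt (f i + sum f S) \<le> sqrt (f i) + sqrt (sum f S)"
    by (rule sqrt_add_le_add_sqrt) (use insert in \<open>auto intro: sum_nonneg\<close>)
  thus ?case using insert by simp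
qed simp

text \<open>A property of integers, not of reals; it keeps the sum over multiplicities equal to
  \<open>divisor_degree\<close>.\<close>

lemma abs_of_int_sqrt_le: "sqrt \<bar>of_int n\<bar> \<le> \<bar>of_int n :: real\<bar>"
proof (cases "n = 0")
  case False
  hence "1 \<le> \<bar>n\<bar>" by simp
  hence "1 \<le> \<bar>of_int n :: real\<bar>" by (metis of_int_abs of_int_1_le_iff)
  hence "\<bar>of_int n :: real\<bar> \<le> \<bar>of_int n :: real\<bar>\<^sup>2" using mult_right_mono[of 1 "\<bar>of_int n :: real\<bar>" "\<bar>of_int n :: real\<bar>"]
    by (simp add: power2_eq_square)
  hence "sqrt \<bar>of_int n :: real\<bar> \<le> sqrt (\<bar>of_int n :: real\<bar>\<^sup>2)" by (rule real_sqrt_le_mono)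
  thus ?thesis by simp
qed simp

text \<open>The square root is subadditive and, by concavity of the logarithm, the mean may be taken inside.\<close>

lemma nevanlinna_m_log_deriv_le:
  assumes h: "nonzero_meromorphic h" and reg: "regular_radius h r" "regular_radius h R" and r: "1 \<le> r" "r < R"
  defines "M \<equiv> nevanlinna_m R h + nevanlinna_m R (\<lambda>z. 1 / h z)" and "n \<equiv> divisor_degree h R"
  shows "nevanlinna_m r (\<lambda>z. deriv h z / h z) \<le> 2 * ln (1 + sqrt (2 * R / (R - r)\<^sup>2 * M + n / (R - r)) + 32 * n)"
proof -
  let ?Z = "zeros_poles h R"
  have fin: "finite ?Z" using h by blast
  have R: "R > 0" using r by simp
  define A where "A = 2 * R / (R - r)\<^sup>2 * M + n / (R - r)"
  define a where "a c = \<bar>of_int (zorder h c) :: real\<bar>" for c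
  have cn: "norm c \<noteq> r" if "c \<in> ?Z" for c
    using that regular_radiusD(1,2)[OF reg(1), of c] by (auto simp: zeros_poles_def dest: zorder_eq_0_at_regular)
  have M: "circle_mean R (\<lambda>w. \<bar>ln (norm (h w))\<bar>) = M"
  proof -
    have "circle_mean R (\<lambda>w. \<bar>ln (norm (h w))\<bar>) = circle_mean R (\<lambda>w. log_plus (norm (h w)) + log_plus (norm (1 / h w)))"
      by (rule circle_mean_cong) (use regular_radiusD[OF reg(2)] R in \<open>auto simp: abs_ln_eq_log_plus norm_divide\<close>)
    also have "\<dots> = M" unfolding M_def nevanlinna_m_eq
      by (rule circle_mean_add) (use regular_radiusD[OF reg(2)] R in \<open>auto intro!: continuous_intros\<close>)
    finally show ?thesis .
  qed
  have M0: "0 \<le> M" unfolding M[symmetric]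
    by (rule circle_mean_nonneg) (use regular_radiusD[OF reg(2)] R in \<open>auto intro!: continuous_intros\<close>)
  have n0: "0 \<le> n" unfolding n_def by (rule divisor_degree_nonneg)
  have A0: "0 \<le> A" unfolding A_def using M0 n0 r by auto
  define Y where "Y z = 1 + sqrt A + (\<Sum>c\<in>?Z. a c * (1 / sqrt (norm (z - c))))" for z
  \<comment> \<open>An upper bound for the mean of \<open>Y\<close>; the 32 is the bound for the
    mean of each inverse square root.\<close>
  define m where "m = 1 + sqrt A + 32 * n"
  have m: "m > 0" unfolding m_def using A0 n0 by (auto intro!: add_pos_nonneg)
  have Y1: "1 \<le> Y z" for z unfolding Y_def using A0 by (auto intro!: add_increasing2 sum_nonneg simp: a_def)
  have pw: "log_plus (norm (deriv h z / h z)) \<le> 2 * (ln m + Y z / m - 1)" if z: "norm z = r" for z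
  proof -
    let ?q = "norm (deriv h z / h z)"
    have "?q \<le> A + (\<Sum>c\<in>?Z. a c * (1 / norm (z - c)))"
      using norm_log_deriv_le[OF h reg(2), of z] z r regular_radiusD(1,2)[OF reg(1) z] M
      by (simp add: A_def a_def n_def divisor_degree_def distrib_left sum.distrib sum_divide_distrib)
    hence "sqrt ?q \<le> sqrt (A + (\<Sum>c\<in>?Z. a c * (1 / norm (z - c))))" by (rule real_sqrt_le_mono)
    also have "\<dots> \<le> sqrt A + sqrt (\<Sum>c\<in>?Z. a c * (1 / norm (z - c)))"
      by (rule sqrt_add_le_add_sqrt) (use A0 in \<open>auto intro!: sum_nonneg simp: a_def\<close>)
    also have "sqrt (\<Sum>c\<in>?Z. a c * (1 / norm (z - c))) \<le> (\<Sum>c\<in>?Z. sqrt (a c * (1 / norm (z - c))))"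
      by (rule sqrt_sum_le[OF fin]) (simp add: a_def)
    also have "\<dots> \<le> (\<Sum>c\<in>?Z. a c * (1 / sqrt (norm (z - c))))"
    proof (rule sum_mono)
      fix c
      have "sqrt (a c) * (1 / sqrt (norm (z - c))) \<le> a c * (1 / sqrt (norm (z - c)))"
        unfolding a_def by (rule mult_right_mono[OF abs_of_int_sqrt_le]) simp
      thus "sqrt (a c * (1 / norm (z - c))) \<le> a c * (1 / sqrt (norm (z - c)))"
        by (simp add: real_sqrt_mult real_sqrt_divide)
    qed
    finally have "1 + sqrt ?q \<le> Y z" by (simp add: Y_def)
    hence 1: "ln (1 + sqrt ?q) \<le> ln (Y z)" by (subst ln_le_cancel_iff) (use Y1[of z] in \<open>auto intro: add_pos_nonneg\<close>)
    \<comment> \<open>\<open>ln\<close> lies below its tangent at \<open>m\<close>. The mean of this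
      tangent bound is at most ln m because the mean of \<open>Y\<close> is at most
      \<open>m\<close>.\<close>
    have 2: "ln (Y z) \<le> ln m + Y z / m - 1"
    proof -
      have "ln (Y z / m) \<le> Y z / m - 1" by (rule ln_le_minus_one) (use m Y1[of z] in auto)
      thus ?thesis using m Y1[of z] by (simp add: ln_div)
    qed
    have "log_plus ?q \<le> 2 * ln (1 + sqrt ?q)" by (rule log_plus_le_2_ln_sqrt) simp
    also have "\<dots> \<le> 2 * (ln m + Y z / m - 1)" by (rule mult_left_mono[OF order_trans[OF 1 2]]) simp
    finally show ?thesis .
  qed
  have cd: "continuous_on (sphere 0 r) (\<lambda>z. deriv h z / h z)"
    by (rule continuous_on_regular) (use regular_radiusD[OF reg(1)] in \<open>auto intro!: analytic_intros\<close>)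
  have cs: "continuous_on (sphere 0 r) (\<lambda>z. 1 / sqrt (norm (z - c)))" if "c \<in> ?Z" for c
    using cn[OF that] by (auto intro!: continuous_intros)
  have cS: "continuous_on (sphere 0 r) (\<lambda>z. a c * (1 / sqrt (norm (z - c))))" if "c \<in> ?Z" for c
    by (rule continuous_on_mult_left[OF cs[OF that]])
  have cSum: "continuous_on (sphere 0 r) (\<lambda>z. \<Sum>c\<in>?Z. a c * (1 / sqrt (norm (z - c))))"
    by (rule continuous_on_sum[OF cS])
  have cY: "continuous_on (sphere 0 r) Y" unfolding Y_def by (intro continuous_on_add continuous_on_const cSum)
  have "circle_mean r Y = circle_mean r (\<lambda>z. 1 + sqrt A) + circle_mean r (\<lambda>z. \<Sum>c\<in>?Z. a c * (1 / sqrt (norm (z - c))))"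
    unfolding Y_def by (rule circle_mean_add[OF continuous_on_const cSum]) (use r in auto)
  also have "circle_mean r (\<lambda>z. \<Sum>c\<in>?Z. a c * (1 / sqrt (norm (z - c)))) = (\<Sum>c\<in>?Z. circle_mean r (\<lambda>z. a c * (1 / sqrt (norm (z - c)))))"
    by (rule circle_mean_sum[OF cS]) (use r fin in auto)
  also have "\<dots> \<le> (\<Sum>c\<in>?Z. a c * 32)"
  proof (rule sum_mono)
    fix c assume c: "c \<in> ?Z"
    have "circle_mean r (\<lambda>z. a c * (1 / sqrt (norm (z - c)))) = a c * circle_mean r (\<lambda>z. 1 / sqrt (norm (z - c)))"
      by (rule circle_mean_cmult[OF cs[OF c]]) (use r in auto)
    also have "\<dots> \<le> a c * 32"
      by (rule mult_left_mono[OF circle_mean_inverse_sqrt_le]) (use r cn[OF c] in \<open>auto simp: a_def\<close>)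
    finally show "circle_mean r (\<lambda>z. a c * (1 / sqrt (norm (z - c)))) \<le> a c * 32" .
  qed
  also have "\<dots> = 32 * n" by (simp add: n_def divisor_degree_def a_def sum_distrib_left mult.commute)
  finally have mY: "circle_mean r Y \<le> m" by (simp add: m_def)
  have "nevanlinna_m r (\<lambda>z. deriv h z / h z) \<le> circle_mean r (\<lambda>z. 2 * (ln m - 1) + (2 / m) * Y z)"
    unfolding nevanlinna_m_eq
  proof (rule circle_mean_mono)
    show "log_plus (norm (deriv h w / h w)) \<le> 2 * (ln m - 1) + (2 / m) * Y w" if "norm w = r" for w
      using pw[OF that] by (simp add: algebra_simps)
  qed (use cd cY r m in \<open>auto intro!: continuous_intros\<close>)
  also have "\<dots> = circle_mean r (\<lambda>z. 2 * (ln m - 1)) + circle_mean r (\<lambda>z. (2 / m) * Y z)"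
    by (rule circle_mean_add) (use r cY m in \<open>auto intro!: continuous_intros\<close>)
  also have "circle_mean r (\<lambda>z. (2 / m) * Y z) = (2 / m) * circle_mean r Y"
    by (rule circle_mean_cmult[OF cY]) (use r in auto)
  also have "(2 / m) * circle_mean r Y \<le> (2 / m) * m" using mY m by (intro mult_left_mono) auto
  finally have "nevanlinna_m r (\<lambda>z. deriv h z / h z) \<le> 2 * ln m" using m by simp
  thus ?thesis by (simp only: m_def A_def)
qed

text \<open>Each zero or pole in the disc of radius \<open>R\<close> has weight at least ln (R2 / R)
  at the larger radius. For the origin, of weight ln R2, this uses 1 \<le> R.\<close>

lemma divisor_degree_le:
  assumes h: "nonzero_meromorphic h" and reg: "regular_radius h R2" and R: "1 \<le> R" "R < R2"
  shows "divisor_degree h R * ln (R2 / R) \<le> nevanlinna_N R2 h + nevanlinna_N R2 (\<lambda>z. 1 / h z)"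
proof -
  have "nevanlinna_N R2 h + nevanlinna_N R2 (\<lambda>z. 1 / h z) = (\<Sum>c\<in>zeros_poles h R2. \<bar>of_int (zorder h c)\<bar> * log_weight R2 c)"
  proof -
    have "real (nat (- k)) + real (nat k) = \<bar>of_int k\<bar>" for k :: int by (cases "k \<ge> 0") auto
    thus ?thesis using nevanlinna_N_eq_zeros_poles[OF h reg] R
      by (simp add: sum.distrib[symmetric] distrib_right[symmetric])
  qed
  moreover have "divisor_degree h R * ln (R2 / R) \<le> (\<Sum>c\<in>zeros_poles h R2. \<bar>of_int (zorder h c)\<bar> * log_weight R2 c)"
  proof -
    have "divisor_degree h R * ln (R2 / R) \<le> (\<Sum>c\<in>zeros_poles h R. \<bar>of_int (zorder h c)\<bar> * log_weight R2 c)"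
      unfolding divisor_degree_def sum_distrib_right
    proof (intro sum_mono mult_left_mono)
      fix c assume "c \<in> zeros_poles h R"
      hence c: "norm c < R" by (simp add: zeros_poles_def)
      show "ln (R2 / R) \<le> log_weight R2 c"
      proof (cases "c = 0")
        case True
        have "R2 / R \<le> R2 / 1" using R by (intro divide_left_mono) auto
        thus ?thesis using True R by (simp add: log_weight_def)
      next
        case False
        have "R2 / R \<le> R2 / norm c" using R c False by (intro divide_left_mono) auto
        thus ?thesis using False R by (simp add: log_weight_def)
      qed
    qed simp
    also have "\<dots> \<le> (\<Sum>c\<in>zeros_poles h R2. \<bar>of_int (zorder h c)\<bar> * log_weight R2 c)"
    proof (rule sum_mono2)
      show "finite (zeros_poles h R2)" using h by blast
      show "zeros_poles h R \<subseteq> zeros_poles h R2" using R by (auto simp: zeros_poles_def)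
      fix c assume "c \<in> zeros_poles h R2 - zeros_poles h R"
      thus "0 \<le> \<bar>of_int (zorder h c) :: real\<bar> * log_weight R2 c"
        using R by (intro mult_nonneg_nonneg log_weight_nonneg) (auto simp: zeros_poles_def)
    qed
    finally show ?thesis .
  qed
  ultimately show ?thesis by simp
qed

section \<open>Exceptional sets and Borel's lemma\<close>

text \<open>The infimum over all exceptional sets at once, so the set may depend on the property.
  Conclusions with different exceptional sets then combine by ordinary filter reasoning, since
  finite measure is preserved by finite unions.\<close>

definition nev_filter :: "real filter" where
  "nev_filter = (INF E\<in>lmeasurable. inf at_top (principal (- E)))"

lemma eventually_nev_filter:
  "eventually P nev_filter \<longleftrightarrow> (\<exists>E\<in>lmeasurable. \<exists>r0. \<forall>r\<ge>r0. r \<notin> E \<longrightarrow> P r)"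
proof -
  have "eventually P nev_filter \<longleftrightarrow> (\<exists>E\<in>lmeasurable. eventually P (inf at_top (principal (- E))))"
    unfolding nev_filter_def
  proof (rule eventually_INF_base)
    fix A B :: "real set" assume "A \<in> lmeasurable" "B \<in> lmeasurable"
    moreover have "inf at_top (principal (- (A \<union> B))) \<le> inf (inf at_top (principal (- A))) (inf at_top (principal (- B)))"
      by (intro le_infI inf_mono) (auto intro: le_infI1 le_infI2)
    ultimately show "\<exists>X\<in>lmeasurable. inf at_top (principal (- X)) \<le> inf (inf at_top (principal (- A))) (inf at_top (principal (- B)))"
      by (intro bexI[of _ "A \<union> B"]) auto
  qed auto
  thus ?thesis by (simp add: eventually_inf_principal eventually_at_top_linorder)
qed

lemma nev_filter_le: "E \<in> lmeasurable \<Longrightarrow> nev_filter \<le> inf at_top (principal (- E))"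
  unfolding nev_filter_def by (rule INF_lower)

lemma nev_filter_le_at_top: "nev_filter \<le> at_top"
  using nev_filter_le[of "{}"] by (simp add: inf.coboundedI1)

lemma nev_filter_not_bot: "nev_filter \<noteq> bot"
proof
  assume "nev_filter = bot"
  hence "eventually (\<lambda>_. False) nev_filter" by simp
  then obtain E :: "real set" and r0 where E: "E \<in> lmeasurable" "\<forall>r\<ge>r0. r \<in> E"
    unfolding eventually_nev_filter by blast
  obtain n :: nat where n: "measure lebesgue E < real n" using reals_Archimedean2 by blast
  have "measure lebesgue {r0..r0 + real n} \<le> measure lebesgue E"
    by (rule measure_mono_fmeasurable[OF _ _ E(1)]) (use E(2) in auto)
  thus False using n by simp
qed

lemma eventually_nev_filter_ge: "eventually (\<lambda>r. r \<ge> (c :: real)) nev_filter"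
  using nev_filter_le_at_top eventually_ge_at_top filter_leD by blast

lemma countable_irregular_radii:
  assumes "nonzero_meromorphic h" shows "countable {r. \<not> regular_radius h r}"
proof -
  have "countable (UNIV \<inter> {z. \<not> (h analytic_on {z} \<and> h z \<noteq> 0)})"
    by (rule sparse_imp_countable[OF open_UNIV sparse_singular_points[OF assms]])
  hence "countable (norm ` {z. \<not> (h analytic_on {z} \<and> h z \<noteq> 0)})" by simp
  thus ?thesis by (rule countable_subset[rotated]) (auto simp: regular_radius_def)
qed

text \<open>A sparse set is countable, so the radii of circles meeting it form a null set, which is
  an admissible exceptional set.\<close>

lemma eventually_avoids_sparse:
  fixes S :: "complex set"
  assumes "S sparse_in UNIV"
  shows "eventually (\<lambda>r. \<forall>z. norm z = r \<longrightarrow> z \<notin> S) nev_filter"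
proof -
  have "countable (norm ` S)" using sparse_imp_countable[OF open_UNIV assms] by simp
  hence "norm ` S \<in> null_sets lebesgue"
    by (rule null_sets_completionI[OF countable_imp_null_set_lborel])
  hence "norm ` S \<in> lmeasurable" by (rule fmeasurableI_null_sets)
  thus ?thesis unfolding eventually_nev_filter by (intro bexI exI[of _ 0]) auto
qed

lemma eventually_circle_cosparse:
  fixes P :: "complex \<Rightarrow> bool"
  assumes "eventually P (cosparse UNIV)"
  shows "eventually (\<lambda>r. \<forall>z. norm z = r \<longrightarrow> P z) nev_filter"
  using eventually_avoids_sparse[of "{z. \<not> P z}"] assms by (simp add: eventually_cosparse)

lemma eventually_regular_radius:
  assumes "nonzero_meromorphic h" shows "eventually (regular_radius h) nev_filter"
  using eventually_circle_cosparse[OF nonzero_meromorphic_cosparse[OF assms]]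
  by (auto elim!: eventually_mono simp: regular_radius_def)

lemma regular_radius_between:
  fixes a b :: real
  assumes "nonzero_meromorphic h" "a < b" obtains r where "a < r" "r < b" "regular_radius h r"
proof -
  have "\<not> {a<..<b} \<subseteq> {r. \<not> regular_radius h r}"
    using countable_subset countable_irregular_radii[OF assms(1)] uncountable_open_interval assms(2) by blast
  thus ?thesis using that by auto
qed

text \<open>Within the level \<open>2 ^ n \<le> \<tau> r < 2 ^ (n + 1)\<close> only an interval of length \<open>2 ^ (- n)\<close>
  at the right end has to be excluded.\<close>

lemma Borel_growth_lemma:
  fixes \<tau> :: "real \<Rightarrow> real"
  assumes mono: "\<And>r s. r \<in> D \<Longrightarrow> s \<in> D \<Longrightarrow> r \<le> s \<Longrightarrow> \<tau> r \<le> \<tau> s"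
    and ge: "\<And>r. r \<in> D \<Longrightarrow> r \<le> \<tau> r" "\<And>r. r \<in> D \<Longrightarrow> 1 \<le> r"
  shows "\<exists>E\<in>lmeasurable. \<forall>r\<in>D - E. \<forall>R\<in>D. R \<le> r + 1 / \<tau> r \<longrightarrow> \<tau> R \<le> 2 * \<tau> r"
proof -
  \<comment> \<open>These sublevel sets are bounded because r \<le> \<tau> r; their suprema need not
    belong to \<open>D\<close>.\<close>
  define L where "L n = {q\<in>D. \<tau> q < 2 ^ Suc n}" for n
  define b where "b n = Sup (L n)" for n
  define J where "J n = {b n - (1/2) ^ n..b n}" for n :: nat
  have bdd: "bdd_above (L n)" for n
  proof (rule bdd_aboveI[of _ "2 ^ Suc n"])
    fix q assume "q \<in> L n"
    thus "q \<le> 2 ^ Suc n" using ge(1)[of q] by (simp add: L_def del: power_Suc)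
  qed
  have "emeasure lebesgue (\<Union>n. J n) \<le> (\<Sum>n. emeasure lebesgue (J n))"
    by (rule emeasure_subadditive_countably) (simp add: J_def image_subset_iff)
  also have "\<dots> = (\<Sum>n. ennreal ((1/2) ^ n))" by (simp add: J_def)
  also have "\<dots> < \<infinity>"
    by (subst suminf_ennreal2) (auto intro: summable_geometric)
  finally have "(\<Union>n. J n) \<in> lmeasurable" by (intro fmeasurableI) (auto simp: J_def)
  moreover have "\<tau> R \<le> 2 * \<tau> r" if r: "r \<in> D" "r \<notin> (\<Union>n. J n)" and R: "R \<in> D" "R \<le> r + 1 / \<tau> r" for r R
  proof -
    have t1: "1 \<le> \<tau> r" using ge[OF r(1)] by linarith
    define n where "n = nat \<lfloor>log 2 (\<tau> r)\<rfloor>"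
    have "0 \<le> log 2 (\<tau> r)" using t1 by simp
    hence n: "real n \<le> log 2 (\<tau> r)" "log 2 (\<tau> r) < real n + 1" unfolding n_def by linarith+
    have n1: "2 ^ n \<le> \<tau> r" using n(1) t1 by (simp add: le_log_iff powr_realpow)
    have n2: "\<tau> r < 2 ^ Suc n"
    proof -
      have "\<tau> r < 2 powr (real n + 1)" using n(2) t1 by (subst (asm) log_less_iff) auto
      also have "\<dots> = 2 powr real (Suc n)" by (simp add: add.commute)
      also have "\<dots> = 2 ^ Suc n" by (subst powr_realpow) auto
      finally show ?thesis .
    qed
    have rL: "r \<in> L n" using r n2 by (simp add: L_def)
    have "r \<le> b n" unfolding b_def by (rule cSup_upper[OF rL bdd])
    hence "r < b n - (1/2) ^ n" using r by (auto simp: J_def not_le)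
    \<comment> \<open>Some \<open>q\<close> in the level set lies beyond r + 2^(-n). As 1 / \<tau> r
      \<le> 2^(-n), also R \<le> q, and monotonicity is applied to \<open>R\<close> and
      \<open>q\<close>, both in \<open>D\<close>.\<close>
    hence "r + (1/2) ^ n < Sup (L n)" by (simp add: b_def)
    then obtain q where q: "q \<in> L n" "r + (1/2) ^ n < q" using less_cSupD rL by blast
    have "1 / \<tau> r \<le> 1 / 2 ^ n" using n1 t1 by (intro divide_left_mono) auto
    hence "R \<le> q" using q R by (simp add: power_one_over)
    hence "\<tau> R \<le> \<tau> q" using mono R q by (simp add: L_def)
    also have "\<dots> \<le> 2 * 2 ^ n" using q by (simp add: L_def)
    finally show ?thesis using n1 by linarith
  qed
  ultimately show ?thesis by (intro bexI[of _ "\<Union>n. J n"]) auto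
qed

lemma nevanlinna_m_nonneg:
  assumes "\<And>z. norm z = r \<Longrightarrow> h analytic_on {z}" "r \<ge> 0" shows "0 \<le> nevanlinna_m r h"
  unfolding nevanlinna_m_eq
  by (rule circle_mean_nonneg) (use continuous_on_regular[OF assms(1)] assms(2) in \<open>auto intro!: continuous_intros\<close>)

lemma nevanlinna_nonneg:
  assumes "nonzero_meromorphic h" "regular_radius h r" "1 \<le> r"
  shows "0 \<le> nevanlinna_N r h" "0 \<le> nevanlinna_m r h" "0 \<le> nevanlinna_T r h"
  using nevanlinna_m_nonneg[of r h] nevanlinna_N_nonneg[of h r] assms nonzero_meromorphic_at'(1)[OF assms(1)]
  by (auto simp: nevanlinna_T_def regular_radius_def)

text \<open>The pointwise bound at \<open>r\<close> involves T at larger radii and inverse powers of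
  the gaps between the radii. With gaps of order 1 / \<tau> r, Borel's lemma bounds the former by 2
  \<tau> r. Everything under the logarithm is then polynomial in \<tau> r.\<close>

theorem log_derivative_lemma:
  assumes h: "nonzero_meromorphic h"
  shows "\<exists>C. eventually (\<lambda>r. nevanlinna_m r (\<lambda>z. deriv h z / h z) \<le> C * (1 + ln (nevanlinna_T r h + r))) nev_filter"
proof -
  define D where "D = {r. 1 \<le> r \<and> regular_radius h r}"
  \<comment> \<open>The summand \<open>r\<close> secures r \<le> \<tau> r, which Borel's lemma
    requires, and \<tau> r \<ge> 1.\<close>
  define \<tau> where "\<tau> r = nevanlinna_T r h + r" for r
  define K where "K = \<bar>ln (norm (zor_poly h 0 0))\<bar>"
  have K: "K \<ge> 0" by (simp add: K_def)
  have "\<exists>E\<in>lmeasurable. \<forall>r\<in>D - E. \<forall>R\<in>D. R \<le> r + 1 / \<tau> r \<longrightarrow> \<tau> R \<le> 2 * \<tau> r"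
  proof (rule Borel_growth_lemma)
    fix r s assume rs: "r \<in> D" "s \<in> D" "r \<le> s"
    show "\<tau> r \<le> \<tau> s"
    proof (cases "r = s")
      case False
      thus ?thesis using nevanlinna_T_mono[OF h, of r s] rs by (auto simp: D_def \<tau>_def)
    qed simp
  qed (use nevanlinna_nonneg[OF h] in \<open>auto simp: D_def \<tau>_def\<close>)
  then obtain E where E: "E \<in> lmeasurable" "\<And>r R. r \<in> D \<Longrightarrow> r \<notin> E \<Longrightarrow> R \<in> D \<Longrightarrow> R \<le> r + 1 / \<tau> r \<Longrightarrow> \<tau> R \<le> 2 * \<tau> r"
    by blast
  \<comment> \<open>Twice the logarithm of 353 (5 + 2 K) t^4, the bound reached below: the power of
    \<open>t\<close> accounts for 8 = 2 * 4.\<close>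
  define C where "C = 2 * ln (353 * (5 + 2 * K)) + 8"
  have C8: "8 \<le> C" unfolding C_def using K by simp
  have main: "nevanlinna_m r (\<lambda>z. deriv h z / h z) \<le> C * (1 + ln (\<tau> r))" if rD: "r \<in> D" "r \<notin> E" for r
  proof -
    have r: "1 \<le> r" "regular_radius h r" using rD by (auto simp: D_def)
    define t where "t = \<tau> r"
    have t: "r \<le> t" "1 \<le> t" using nevanlinna_nonneg(3)[OF h r(2,1)] r by (auto simp: t_def \<tau>_def)
    \<comment> \<open>A quarter of the admissible step 1 / t leaves room for r < R < R2 with both
      gaps larger than \<open>d\<close>. Two radii are needed because the zeros and poles within
      \<open>R\<close> are counted by N at \<open>R2\<close>.\<close>
    define d where "d = 1 / (4 * t)"
    have d: "0 < d" using t by (simp add: d_def)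
    obtain R where R: "r + d < R" "R < r + 2 * d" "regular_radius h R"
      using regular_radius_between[OF h, of "r + d" "r + 2 * d"] d by auto
    obtain R2 where R2: "r + 3 * d < R2" "R2 < r + 4 * d" "regular_radius h R2"
      using regular_radius_between[OF h, of "r + 3 * d" "r + 4 * d"] d by auto
    have d4: "4 * d = 1 / t" using t by (simp add: d_def)
    have d1: "4 * d \<le> 1" using t by (simp add: d4)
    have R2t: "R2 \<le> 2 * t" and Rt: "R \<le> 2 * t" using R R2 d d1 t r by linarith+
    have ord: "1 \<le> R" "R < R2" "r < R" "0 < R" "0 < R2" "1 \<le> R2" using R R2 d r by linarith+
    have "R2 \<in> D" using R2 ord by (auto simp: D_def)
    hence "\<tau> R2 \<le> 2 * t" using E(2)[OF rD, of R2] R2(2) d4 by (simp add: t_def)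
    hence T2: "nevanlinna_T R2 h \<le> 2 * t" using ord by (simp add: \<tau>_def)
    have T1: "nevanlinna_T R h \<le> 2 * t" using nevanlinna_T_mono[OF h R(3) R2(3)] ord T2 by simp
    \<comment> \<open>First main theorem: T(h) + T(1 / h) exceeds 2 T(h) \<le> 4 t by at most
      \<open>K\<close>; the slack makes X \<ge> 1.\<close>
    define X where "X = 1 + 4 * t + 2 * K"
    have inv: "nevanlinna_T \<rho> h + nevanlinna_T \<rho> (\<lambda>z. 1 / h z) \<le> X"
      if "nevanlinna_T \<rho> h \<le> 2 * t" "regular_radius h \<rho>" "0 < \<rho>" for \<rho>
      using first_main_theorem[OF h that(2,3)] that(1) K by (simp add: X_def K_def)
    note nn = nevanlinna_nonneg[OF h] nevanlinna_nonneg[OF nonzero_meromorphic_inverse[OF h]]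
    note reg' = regular_radius_inverse
    define M where "M = nevanlinna_m R h + nevanlinna_m R (\<lambda>z. 1 / h z)"
    define n where "n = divisor_degree h R"
    have M: "M \<le> X" using inv[OF T1 R(3)] nn(1,4)[of R] R(3) reg'[OF R(3)] ord
      by (simp add: M_def nevanlinna_T_def)
    have M0: "0 \<le> M" using nn(2,5)[of R] R(3) reg'[OF R(3)] ord by (simp add: M_def)
    have n0: "0 \<le> n" by (simp add: n_def divisor_degree_nonneg)
    have X1: "1 \<le> X" "0 \<le> X" using t K by (auto simp: X_def)
    have "n * ln (R2 / R) \<le> X"
      using divisor_degree_le[OF h R2(3) ord(1,2)] inv[OF T2 R2(3)] nn(2,5)[of R2] R2(3) reg'[OF R2(3)] ord
      by (simp add: n_def nevanlinna_T_def)
    moreover have "d / (2 * t) \<le> ln (R2 / R)"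
    proof -
      have "d / (2 * t) \<le> (R2 - R) / R2" using R R2 d ord R2t by (intro frac_le) auto
      also have "\<dots> = 1 - R / R2" using ord by (simp add: diff_divide_distrib)
      also have "\<dots> \<le> - ln (R / R2)" using ln_le_minus_one[of "R / R2"] ord by simp
      also have "\<dots> = ln (R2 / R)" using ord by (simp add: ln_div)
      finally show ?thesis .
    qed
    ultimately have "n * (d / (2 * t)) \<le> X" using mult_left_mono[OF _ n0] order_trans by blast
    hence n: "n \<le> 8 * t\<^sup>2 * X" using t d by (simp add: d_def field_simps power2_eq_square)
    define A where "A = 2 * R / (R - r)\<^sup>2 * M + n / (R - r)"
    have "2 * R / (R - r)\<^sup>2 * M \<le> (2 * (2 * t) / d\<^sup>2) * X"
    proof (intro mult_mono frac_le)
      show "d\<^sup>2 \<le> (R - r)\<^sup>2" using R d by (intro power_mono) auto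
    qed (use Rt t d M M0 ord in auto)
    also have "\<dots> = 64 * t ^ 3 * X" using t by (simp add: d_def power2_eq_square power3_eq_cube)
    finally have A1: "2 * R / (R - r)\<^sup>2 * M \<le> 64 * t ^ 3 * X" .
    have "n / (R - r) \<le> 8 * t\<^sup>2 * X / d" using n n0 R d X1 by (intro frac_le) auto
    also have "\<dots> = 32 * t ^ 3 * X" using t by (simp add: d_def power2_eq_square power3_eq_cube)
    finally have A2: "A \<le> 96 * t ^ 3 * X" using A1 by (simp add: A_def)
    have t3: "1 \<le> t ^ 3" "t\<^sup>2 \<le> t ^ 3" using t by (auto intro: one_le_power power_increasing)
    hence tX: "1 \<le> t ^ 3 * X" using X1 t mult_mono[of 1 "t ^ 3" 1 X] by simp
    have A0: "0 \<le> A" unfolding A_def using M0 n0 ord by auto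
    \<comment> \<open>A number \<ge> 1 is at most its square; the loss is harmless under the
      logarithm.\<close>
    have "sqrt A \<le> 96 * (t ^ 3 * X)"
    proof (rule real_le_lsqrt)
      have "A \<le> 96 * (t ^ 3 * X)" using A2 by simp
      also have "\<dots> \<le> (96 * (t ^ 3 * X))\<^sup>2" by (rule self_le_power) (use tX in auto)
      finally show "A \<le> (96 * (t ^ 3 * X))\<^sup>2" .
    qed (use tX in auto)
    moreover have "32 * n \<le> 256 * (t ^ 3 * X)"
      using n[unfolded mult.assoc] mult_right_mono[OF t3(2) X1(2)] by linarith
    \<comment> \<open>353 = 1 + 96 + 256.\<close>
    ultimately have "1 + sqrt A + 32 * n \<le> 353 * (t ^ 3 * X)" using tX by linarith
    also have "\<dots> \<le> 353 * (t ^ 3 * ((5 + 2 * K) * t))"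
    proof -
      have "X \<le> (5 + 2 * K) * t" using t K mult_left_mono[OF t(2), of "1 + 2 * K"] by (simp add: X_def algebra_simps)
      thus ?thesis using t by (intro mult_left_mono) auto
    qed
    also have "\<dots> = 353 * (5 + 2 * K) * t ^ 4" by (simp add: power4_eq_xxxx power3_eq_cube)
    finally have "ln (1 + sqrt A + 32 * n) \<le> ln (353 * (5 + 2 * K) * t ^ 4)"
      by (subst ln_le_cancel_iff) (use A0 n0 t K in \<open>auto intro!: add_pos_nonneg mult_pos_pos\<close>)
    also have "\<dots> = ln (353 * (5 + 2 * K)) + 4 * ln t"
      using t K by (subst ln_mult_pos) (auto simp: ln_realpow)
    finally have "nevanlinna_m r (\<lambda>z. deriv h z / h z) \<le> (C - 8) + 8 * ln t"
      using nevanlinna_m_log_deriv_le[OF h r(2) R(3) r(1) ord(3)] by (simp add: A_def M_def n_def C_def)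
    also have "\<dots> \<le> C + C * ln t" using C8 t by (intro add_mono mult_right_mono) auto
    finally show ?thesis by (simp add: t_def algebra_simps)
  qed
  have "eventually (\<lambda>r. r \<notin> E) nev_filter"
    unfolding eventually_nev_filter using E(1) by blast
  with eventually_regular_radius[OF h] eventually_nev_filter_ge[of 1]
  have "eventually (\<lambda>r. nevanlinna_m r (\<lambda>z. deriv h z / h z) \<le> C * (1 + ln (nevanlinna_T r h + r))) nev_filter"
    by eventually_elim (use main in \<open>auto simp: D_def \<tau>_def\<close>)
  thus ?thesis by blast
qed

section \<open>Growth of transcendental functions\<close>

text \<open>Cauchy's inequality on circles of arbitrarily large radius kills all Taylor coefficients
  beyond \<open>K\<close>, so a bound along a sequence of radii suffices.\<close>

lemma entire_slow_growth_imp_polynomial: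
  assumes e: "e holomorphic_on UNIV"
    and bound: "\<And>r0. \<exists>r\<ge>r0. \<forall>z. norm z = r \<longrightarrow> norm (e z) \<le> c * r ^ K"
  shows "\<exists>p. \<forall>z. e z = poly p z"
proof -
  have zero: "(deriv ^^ n) e 0 = 0" if n: "n > K" for n
  proof (rule ccontr)
    assume "(deriv ^^ n) e 0 \<noteq> 0"
    hence pos: "0 < norm ((deriv ^^ n) e 0)" by simp
    obtain r where r: "r \<ge> max 1 ((fact n * \<bar>c\<bar> + 1) / norm ((deriv ^^ n) e 0))"
      "\<And>z. norm z = r \<Longrightarrow> norm (e z) \<le> c * r ^ K"
      using bound[of "max 1 ((fact n * \<bar>c\<bar> + 1) / norm ((deriv ^^ n) e 0))"] by blast
    have r1: "r \<ge> 1" using r by simp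
    have "norm ((deriv ^^ n) e 0) \<le> fact n * (\<bar>c\<bar> * r ^ K) / r ^ n"
    proof (rule Cauchy_inequality)
      show "e holomorphic_on ball 0 r" "continuous_on (cball 0 r) e"
        using e by (auto intro: holomorphic_on_subset holomorphic_on_imp_continuous_on)
      show "norm (e x) \<le> \<bar>c\<bar> * r ^ K" if "norm (0 - x) = r" for x
      proof -
        have "c * r ^ K \<le> \<bar>c\<bar> * r ^ K" using r1 by (intro mult_right_mono) auto
        thus ?thesis using r(2)[of x] that by simp
      qed
    qed (use r1 in auto)
    also have "\<dots> = fact n * \<bar>c\<bar> / r ^ (n - K)"
      using n r1 by (simp add: power_diff)
    also have "\<dots> \<le> fact n * \<bar>c\<bar> / r"
      using n r1 self_le_power[of r "n - K"] by (intro divide_left_mono) auto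
    finally have "norm ((deriv ^^ n) e 0) * r \<le> fact n * \<bar>c\<bar>"
      using r1 by (simp add: field_simps)
    moreover have "fact n * \<bar>c\<bar> + 1 \<le> r * norm ((deriv ^^ n) e 0)"
      using r(1) pos by (simp add: pos_divide_le_eq)
    ultimately show False by (simp add: mult.commute)
  qed
  define p where "p = (\<Sum>n\<le>K. monom ((deriv ^^ n) e 0 / fact n) n)"
  have "e z = poly p z" for z
  proof -
    have "(\<lambda>n. (deriv ^^ n) e 0 / fact n * (z - 0) ^ n) sums e z"
      by (rule holomorphic_power_series[of _ _ "norm z + 1"]) (use e in \<open>auto intro: holomorphic_on_subset\<close>)
    moreover have "(\<lambda>n. (deriv ^^ n) e 0 / fact n * (z - 0) ^ n) sums (\<Sum>n\<le>K. (deriv ^^ n) e 0 / fact n * (z - 0) ^ n)"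
      by (rule sums_finite) (auto simp: zero not_le)
    ultimately have "e z = (\<Sum>n\<le>K. (deriv ^^ n) e 0 / fact n * (z - 0) ^ n)" using sums_unique2 by blast
    thus ?thesis by (simp add: p_def poly_sum poly_monom)
  qed
  thus ?thesis by blast
qed

text \<open>Poisson-Jensen without poles; 3 bounds the kernel when norm z is half the
  radius.\<close>

lemma log_plus_entire_le:
  assumes e: "e holomorphic_on UNIV" and nz: "nonzero_meromorphic e" and reg: "regular_radius e r" and r: "r > 0"
    and z: "norm z = r / 2"
  shows "log_plus (norm (e z)) \<le> 3 * nevanlinna_m r e"
proof (cases "e z = 0")
  case True
  have "0 \<le> nevanlinna_m r e" using nevanlinna_m_nonneg[of r e] reg r by (auto simp: regular_radius_def)
  thus ?thesis using True by (simp add: log_plus_def)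
next
  case False
  have an: "e analytic_on {w}" for w using e by (metis analytic_on_holomorphic open_UNIV subset_UNIV)
  have "log_plus (norm (e z)) \<le> circle_mean r (\<lambda>w. log_plus (norm (e w)) * poisson r z w)
    + (\<Sum>c\<in>zeros_poles e r. real (pole_order e c) * - ln (norm (blaschke r c z)))"
    by (rule Poisson_Jensen_inequality[OF nz reg r]) (use z r an False in auto)
  also have "(\<Sum>c\<in>zeros_poles e r. real (pole_order e c) * - ln (norm (blaschke r c z))) = 0"
    by (rule sum.neutral) (simp add: an)
  also have "circle_mean r (\<lambda>w. log_plus (norm (e w)) * poisson r z w) \<le> circle_mean r (\<lambda>w. 3 * log_plus (norm (e w)))"
  proof (rule circle_mean_mono)
    fix w :: complex assume w: "norm w = r"
    have "poisson r z w \<le> (r + norm z) / (r - norm z)" by (rule poisson_le) (use w z r in auto)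
    also have "\<dots> = 3" using z r by (simp add: field_simps)
    finally show "log_plus (norm (e w)) * poisson r z w \<le> 3 * log_plus (norm (e w))"
      using mult_left_mono[of "poisson r z w" 3 "log_plus (norm (e w))"] by simp
  qed (use regular_radiusD[OF reg] r z in \<open>auto intro!: continuous_intros\<close>)
  also have "\<dots> = 3 * nevanlinna_m r e" unfolding nevanlinna_m_eq
    by (rule circle_mean_cmult) (use regular_radiusD[OF reg] r in \<open>auto intro!: continuous_intros\<close>)
  finally show ?thesis by simp
qed

text \<open>A pole within the square root of \<open>r\<close> has weight at least (ln r) / 2, so the
  bound on the number of poles is independent of the radius.\<close>

lemma sum_pole_order_le:
  assumes f: "f meromorphic_on UNIV" and r: "1 < \<rho>" "\<rho>\<^sup>2 \<le> r" and N: "nevanlinna_N r f \<le> C * ln r"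
    and S: "finite S" "S \<subseteq> {b. norm b \<le> \<rho> \<and> is_pole f b}"
  shows "(\<Sum>b\<in>S. real (pole_order f b)) \<le> 2 * C"
proof -
  have \<rho>r: "\<rho> \<le> r" using r self_le_power[of \<rho> 2] by simp
  have r1: "1 < r" using \<rho>r r by linarith
  let ?P = "{b. norm b \<le> r \<and> is_pole f b}"
  have "(\<Sum>b\<in>S. real (pole_order f b)) * (ln r / 2) \<le> (\<Sum>b\<in>S. real (pole_order f b) * log_weight r b)"
    unfolding sum_distrib_right
  proof (intro sum_mono mult_left_mono)
    fix b assume "b \<in> S"
    hence b: "norm b \<le> \<rho>" using S by auto
    show "ln r / 2 \<le> log_weight r b"
    proof (cases "b = 0")
      case False
      have "ln (norm b) \<le> ln \<rho>" using False b r by (subst ln_le_cancel_iff) auto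
      moreover have "2 * ln \<rho> = ln (\<rho>\<^sup>2)" using r by (simp add: ln_realpow)
      moreover have "ln (\<rho>\<^sup>2) \<le> ln r" using r r1 by (subst ln_le_cancel_iff) auto
      ultimately show ?thesis using False r1 by (simp add: log_weight_def ln_div)
    qed (use r1 in \<open>auto simp: log_weight_def\<close>)
  qed simp
  also have "\<dots> \<le> (\<Sum>b\<in>?P. real (pole_order f b) * log_weight r b)"
    by (rule sum_mono2[OF finite_poles[OF f]]) (use S \<rho>r r1 in \<open>auto intro!: mult_nonneg_nonneg log_weight_nonneg\<close>)
  also have "\<dots> = nevanlinna_N r f"
    by (rule nevanlinna_N_eq[symmetric, OF f _ finite_poles[OF f]]) (use r1 in auto)
  also have "\<dots> \<le> C * ln r" by fact
  finally have "(\<Sum>b\<in>S. real (pole_order f b)) * ln r \<le> (2 * C) * ln r" by simp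
  thus ?thesis using r1 by (simp add: mult_le_cancel_right)
qed

text \<open>The bound on N leaves finitely many poles. Clearing them with a polynomial
  \<open>q\<close> gives an entire function whose proximity function is still O(ln r) on the given
  circles, hence a polynomial.\<close>

lemma slow_growth_imp_rational:
  assumes f: "nonzero_meromorphic f"
    and slow: "\<And>r0. \<exists>r\<ge>r0. regular_radius f r \<and> nevanlinna_T r f \<le> C * ln r"
  shows "rational_function f"
proof -
  have fm: "f meromorphic_on A" for A by (rule nonzero_meromorphic_at'(1)[OF f])
  let ?P = "{b. is_pole f b}"
  have p1: "1 \<le> pole_order f b" if "b \<in> ?P" for b
    using that isolated_pole_imp_neg_zorder[of f b] fm[of "{b}"] by (auto simp: pole_order_def meromorphic_at_iff)
  have finP: "finite ?P"
  proof -
    \<comment> \<open>The bound 2 C does not depend on the finite set \<open>G\<close>, though the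
      radius used to prove it does.\<close>
    have "card G \<le> nat \<lceil>2 * C\<rceil>" if G: "G \<subseteq> ?P" "finite G" for G
    proof -
      obtain \<rho>0 where \<rho>0: "\<And>b. b \<in> G \<Longrightarrow> norm b \<le> \<rho>0" using finite_imp_bounded[OF G(2)] by (auto simp: bounded_iff)
      define \<rho> where "\<rho> = max 2 \<rho>0"
      obtain r where r: "r \<ge> \<rho>\<^sup>2" "regular_radius f r" "nevanlinna_T r f \<le> C * ln r" using slow by blast
      have \<rho>2: "2 \<le> \<rho>" by (simp add: \<rho>_def)
      have r1: "1 \<le> r" using r(1) one_le_power[of \<rho> 2] \<rho>2 by linarith
      have "nevanlinna_N r f \<le> C * ln r" using nevanlinna_nonneg(2)[OF f r(2) r1] r(3) by (simp add: nevanlinna_T_def)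
      hence "(\<Sum>b\<in>G. real (pole_order f b)) \<le> 2 * C"
        by (intro sum_pole_order_le[OF fm _ r(1)]) (use \<rho>2 G \<rho>0 in \<open>auto simp: \<rho>_def le_max_iff_disj\<close>)
      moreover have "real (card G) \<le> (\<Sum>b\<in>G. real (pole_order f b))"
        using sum_mono[of G "\<lambda>_. 1 :: real" "\<lambda>b. real (pole_order f b)"] p1 G by fastforce
      ultimately show ?thesis by linarith
    qed
    thus ?thesis using finite_if_finite_subsets_card_bdd[of ?P] by blast
  qed
  define q where "q = (\<Prod>b\<in>?P. [:-b, 1:] ^ pole_order f b)"
  have q0: "q \<noteq> 0" using finP by (auto simp: q_def)
  have pq: "poly q z = (\<Prod>b\<in>?P. (z - b) ^ pole_order f b)" for z by (simp add: q_def poly_prod)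
  have "{z. poly q z = 0} sparse_in UNIV" by (rule finite_imp_sparse[OF poly_roots_finite[OF q0]])
  hence qev: "eventually (\<lambda>z. poly q z \<noteq> 0) (cosparse UNIV)" by (simp add: eventually_cosparse)
  define u where "u z = f z * poly q z" for z
  define e where "e = remove_sings u"
  have qan [analytic_intros]: "poly q analytic_on A" for A
    unfolding pq[abs_def] by (intro analytic_intros)
  have um: "u meromorphic_on A" for A unfolding u_def by (intro meromorphic_intros fm analytic_on_imp_meromorphic_on analytic_intros)
  have unp: "\<not> is_pole u b" for b
  proof
    assume pole: "is_pole u b"
    have "pole_order u b \<le> 0"
    proof (subst pole_order_le_iff[OF um])
      obtain s where s: "\<And>w. poly q w = (w - b) ^ pole_order f b * s w" "s analytic_on {b}"
      proof (cases "b \<in> ?P")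
        case True
        show thesis
          by (rule that[of "\<lambda>w. \<Prod>c\<in>?P - {b}. (w - c) ^ pole_order f c"])
             (auto simp: pq prod.remove[OF finP True] intro!: analytic_intros)
      next
        case False
        show thesis by (rule that[of "poly q"]) (use False in \<open>auto simp: pole_order_def intro!: analytic_intros\<close>)
      qed
      have "(\<lambda>w. (f w * (w - b) ^ pole_order f b) * s w) \<in> O[at b](\<lambda>_. 1 * 1)"
        by (intro landau_o.big.mult pole_order_bigo[OF fm order_refl] analytic_bigo_1 s)
      thus "(\<lambda>w. u w * (w - b) ^ 0) \<in> O[at b](\<lambda>_. 1)" by (simp add: u_def s(1) mult.assoc)
    qed
    thus False using pole isolated_pole_imp_neg_zorder[of u b] um[of "{b}"] by (auto simp: pole_order_def meromorphic_at_iff)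
  qed
  have ean: "e analytic_on {z}" for z
  proof -
    have "isolated_singularity_at u z" "not_essential u z" using um[of "{z}"] by (auto simp: meromorphic_at_iff)
    thus ?thesis unfolding e_def using unp remove_sings_analytic_at by (auto simp: not_essential_def)
  qed
  have hol: "e holomorphic_on UNIV" using ean analytic_imp_holomorphic analytic_on_analytic_at by blast
  have eu: "e z = f z * poly q z" if "f analytic_on {z}" for z
  proof -
    have "u analytic_on {z}" unfolding u_def by (intro analytic_intros that)
    thus ?thesis by (simp add: e_def u_def)
  qed
  have enz: "nonzero_meromorphic e"
  proof (rule nonzero_meromorphicI)
    show "e meromorphic_on UNIV" unfolding e_def by (intro meromorphic_intros um)
    have "eventually (\<lambda>w. poly q w \<noteq> 0) (at 0)" 
      by (rule eventually_cosparse_imp_eventually_at[OF qev]) auto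
    with nonzero_meromorphic_at[OF f, of 0] show "eventually (\<lambda>w. e w \<noteq> 0) (at 0)"
      by eventually_elim (auto simp: eu)
  qed
  define D where "D = (\<Sum>b\<in>?P. pole_order f b)"
  \<comment> \<open>The 3 is lost in passing from m to pointwise bounds; 2 D appears because each
    linear factor of \<open>q\<close> has modulus at most 2 r \<le> r^2.\<close>
  define K where "K = nat \<lceil>3 * (C + 2 * real D)\<rceil>"
  obtain \<rho>1 where \<rho>1: "\<And>b. b \<in> ?P \<Longrightarrow> norm b \<le> \<rho>1" using finite_imp_bounded[OF finP] by (auto simp: bounded_iff)
  have "\<exists>r\<ge>r0. \<forall>z. norm z = r \<longrightarrow> norm (e z) \<le> 2 ^ K * r ^ K" for r0
  proof -
    obtain r where r: "r \<ge> max (2 * r0) (max 2 (\<rho>1 + 1))" "regular_radius f r" "nevanlinna_T r f \<le> C * ln r" using slow by blast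
    have r2: "2 \<le> r" "2 * r0 \<le> r" "\<rho>1 < r" using r(1) by auto
    have lnr: "0 \<le> ln r" using r2 by simp
    have qnz: "poly q z \<noteq> 0" if "norm z = r" for z using that \<rho>1 r2 finP by (force simp: pq)
    have ereg: "regular_radius e r" using r(2) qnz by (auto simp: regular_radius_def ean eu)
    have qle: "log_plus (norm (poly q z)) \<le> 2 * real D * ln r" if z: "norm z = r" for z
    proof (rule log_plus_le)
      show "0 < norm (poly q z)" using qnz[OF z] by simp
      have "norm (poly q z) = (\<Prod>b\<in>?P. norm (z - b) ^ pole_order f b)" by (simp add: pq prod_norm[symmetric] norm_power)
      also have "\<dots> \<le> (\<Prod>b\<in>?P. (r\<^sup>2) ^ pole_order f b)"
      proof (rule prod_mono, safe)
        fix b assume b: "is_pole f b"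
        have "norm (z - b) \<le> r + \<rho>1" using norm_triangle_ineq4[of z b] \<rho>1[of b] b z by simp
        also have "\<dots> \<le> 2 * r" using r2 by simp
        also have "\<dots> \<le> r * r" using r2 by (intro mult_right_mono) auto
        finally show "norm (z - b) ^ pole_order f b \<le> (r\<^sup>2) ^ pole_order f b" by (intro power_mono) (auto simp: power2_eq_square)
      qed auto
      also have "\<dots> = (r\<^sup>2) ^ D" by (simp add: D_def power_sum)
      also have "\<dots> = r ^ (2 * D)" by (simp add: power_mult)
      finally have "ln (norm (poly q z)) \<le> ln (r ^ (2 * D))" using qnz[OF z] r2 by (subst ln_le_cancel_iff) auto
      thus "ln (norm (poly q z)) \<le> 2 * real D * ln r" using r2 by (simp add: ln_realpow)
    qed (use lnr in auto)
    have "nevanlinna_m r e \<le> circle_mean r (\<lambda>w. log_plus (norm (f w)) + 2 * real D * ln r)"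
      unfolding nevanlinna_m_eq
    proof (rule circle_mean_mono)
      fix w :: complex assume w: "norm w = r"
      have "log_plus (norm (e w)) \<le> log_plus (norm (f w)) + log_plus (norm (poly q w))"
        using log_plus_mult_le[of "norm (f w)" "norm (poly q w)"] regular_radiusD(1)[OF r(2) w] by (simp add: eu norm_mult)
      thus "log_plus (norm (e w)) \<le> log_plus (norm (f w)) + 2 * real D * ln r" using qle[OF w] by simp
    qed (use regular_radiusD[OF ereg] regular_radiusD[OF r(2)] r2 in \<open>auto intro!: continuous_intros\<close>)
    also have "\<dots> = nevanlinna_m r f + 2 * real D * ln r" unfolding nevanlinna_m_eq
      by (subst circle_mean_add) (use regular_radiusD[OF r(2)] r2 in \<open>auto intro!: continuous_intros\<close>)
    also have "nevanlinna_m r f \<le> C * ln r"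
      using r(3) nevanlinna_nonneg(1)[OF f r(2)] r2 by (simp add: nevanlinna_T_def)
    finally have me: "nevanlinna_m r e \<le> (C + 2 * real D) * ln r" by (simp add: algebra_simps)
    \<comment> \<open>The estimate on the circle of radius \<open>r\<close> controls
      \<open>e\<close> on the circle of radius r / 2; the factor 2^K compensates.\<close>
    show ?thesis
    proof (intro exI[of _ "r / 2"] conjI allI impI)
      fix z :: complex assume z: "norm z = r / 2"
      have "log_plus (norm (e z)) \<le> 3 * ((C + 2 * real D) * ln r)"
        using log_plus_entire_le[OF hol enz ereg _ z] me r2 by simp
      also have "\<dots> = (3 * (C + 2 * real D)) * ln r" by simp
      also have "\<dots> \<le> real K * ln r" unfolding K_def by (rule mult_right_mono[OF real_nat_ceiling_ge lnr])
      also have "\<dots> = ln (r ^ K)" using r2 by (simp add: ln_realpow)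
      finally have "max 1 (norm (e z)) \<le> r ^ K" unfolding log_plus_def using r2 by (subst (asm) ln_le_cancel_iff) auto
      thus "norm (e z) \<le> 2 ^ K * (r / 2) ^ K" by (simp add: power_divide)
    qed (use r2 in auto)
  qed
  then obtain p where p: "\<And>z. e z = poly p z" using entire_slow_growth_imp_polynomial[OF hol] by blast
  have "eventually (\<lambda>z. f z = poly p z / poly q z) (cosparse UNIV)"
  proof -
    show ?thesis using qev meromorphic_on_imp_analytic_cosparse[OF fm]
      by eventually_elim (use p eu in \<open>auto simp: field_simps\<close>)
  qed
  thus ?thesis unfolding rational_function_def using q0 by blast
qed

lemma transcendental_nonzero_meromorphic:
  assumes "transcendental_meromorphic f" shows "nonzero_meromorphic f"
proof -
  have "rational_function f" if "eventually (\<lambda>z. f z = 0) (cosparse UNIV)"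
    unfolding rational_function_def by (intro exI[of _ 0] exI[of _ 1]) (use that in auto)
  thus ?thesis using assms by (auto simp: transcendental_meromorphic_def nonzero_meromorphic_def)
qed

text \<open>If T(r, f) \<le> (1 / c) ln r held at arbitrarily large regular radii, \<open>f\<close>
  would be rational.\<close>

theorem ln_smallo_characteristic:
  assumes "transcendental_meromorphic f"
  shows "ln \<in> o[nev_filter](\<lambda>r. nevanlinna_T r f)"
proof (rule landau_o.smallI)
  fix c :: real assume c: "c > 0"
  note f = transcendental_nonzero_meromorphic[OF assms]
  obtain r0 where r0: "\<And>r. r \<ge> r0 \<Longrightarrow> regular_radius f r \<Longrightarrow> \<not> nevanlinna_T r f \<le> (1 / c) * ln r"
    using slow_growth_imp_rational[OF f, of "1 / c"] assms unfolding transcendental_meromorphic_def by blast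
  show "eventually (\<lambda>r. norm (ln r) \<le> c * norm (nevanlinna_T r f)) nev_filter"
    using eventually_regular_radius[OF f] eventually_nev_filter_ge[of r0] eventually_nev_filter_ge[of 1]
  proof eventually_elim
    case (elim r)
    have "ln r < c * nevanlinna_T r f" using r0[of r] elim c by (simp add: not_le field_simps)
    thus ?case using nevanlinna_nonneg(3)[OF f elim(1,3)] elim by simp
  qed
qed

section \<open>Functions small relative to a scale\<close>

lemma eventually_circle_analytic:
  assumes "h meromorphic_on UNIV"
  shows "eventually (\<lambda>r. \<forall>z. norm z = r \<longrightarrow> h analytic_on {z}) nev_filter"
  by (rule eventually_circle_cosparse[OF meromorphic_on_imp_analytic_cosparse[OF assms]])

lemma nevanlinna_N_cong:
  assumes "eventually (\<lambda>z. f z = g z) (cosparse UNIV)"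
  shows "nevanlinna_N r f = nevanlinna_N r g"
proof -
  have ev: "eventually (\<lambda>w. f w = g w) (at z)" for z
    by (rule eventually_cosparse_imp_eventually_at[OF assms]) auto
  have "is_pole f z \<longleftrightarrow> is_pole g z" "zorder f z = zorder g z" for z
    by (rule is_pole_cong[OF ev refl], rule zorder_cong[OF ev refl])
  thus ?thesis by (simp add: nevanlinna_N_def pole_count_def)
qed

text \<open>The proximity function reads values on the circle itself, so radii whose circle meets
  the sparse set have to be left out, unlike for N.\<close>

lemma nevanlinna_T_cong:
  assumes "eventually (\<lambda>z. f z = g z) (cosparse UNIV)"
  shows "eventually (\<lambda>r. nevanlinna_T r f = nevanlinna_T r g) nev_filter"
  using eventually_circle_cosparse[OF assms] eventually_nev_filter_ge[of 0]
proof eventually_elim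
  case (elim r)
  have "nevanlinna_m r f = nevanlinna_m r g"
    unfolding nevanlinna_m_eq by (rule circle_mean_cong) (use elim in auto)
  thus ?case by (simp add: nevanlinna_T_def nevanlinna_N_cong[OF assms])
qed

lemma eventually_nevanlinna_nonneg:
  assumes "h meromorphic_on UNIV"
  shows "eventually (\<lambda>r. 0 \<le> nevanlinna_N r h \<and> 0 \<le> nevanlinna_m r h) nev_filter"
  using eventually_circle_analytic[OF assms] eventually_nev_filter_ge[of 1]
  by eventually_elim (auto intro!: nevanlinna_N_nonneg nevanlinna_m_nonneg assms)

lemma nevanlinna_N_mult_le:
  assumes "f meromorphic_on UNIV" "g meromorphic_on UNIV" "1 \<le> r"
  shows "nevanlinna_N r (\<lambda>z. f z * g z) \<le> nevanlinna_N r f + nevanlinna_N r g"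
  by (rule nevanlinna_N_le)
     (use assms in \<open>auto intro!: meromorphic_intros pole_order_mult intro: meromorphic_on_subset\<close>)

lemma nevanlinna_N_add_le:
  assumes "f meromorphic_on UNIV" "g meromorphic_on UNIV" "1 \<le> r"
  shows "nevanlinna_N r (\<lambda>z. f z + g z) \<le> nevanlinna_N r f + nevanlinna_N r g"
  by (rule nevanlinna_N_le)
     (use assms in \<open>auto intro!: meromorphic_intros pole_order_add intro: meromorphic_on_subset\<close>)

lemma nevanlinna_T_mult_le:
  assumes "f meromorphic_on UNIV" "g meromorphic_on UNIV"
  shows "eventually (\<lambda>r. nevanlinna_T r (\<lambda>z. f z * g z) \<le> nevanlinna_T r f + nevanlinna_T r g) nev_filter"
  using eventually_circle_analytic[OF assms(1)] eventually_circle_analytic[OF assms(2)] eventually_nev_filter_ge[of 1]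
proof eventually_elim
  case (elim r)
  have c: "continuous_on (sphere 0 r) f" "continuous_on (sphere 0 r) g"
    using elim by (auto intro!: continuous_on_regular)
  have "nevanlinna_m r (\<lambda>z. f z * g z) \<le> circle_mean r (\<lambda>z. log_plus (norm (f z)) + log_plus (norm (g z)))"
    unfolding nevanlinna_m_eq
    by (rule circle_mean_mono) (use elim c in \<open>auto intro!: continuous_intros log_plus_mult_le simp: norm_mult\<close>)
  also have "\<dots> = nevanlinna_m r f + nevanlinna_m r g"
    unfolding nevanlinna_m_eq by (rule circle_mean_add) (use elim c in \<open>auto intro!: continuous_intros\<close>)
  finally show ?case using nevanlinna_N_mult_le[OF assms elim(3)] by (simp add: nevanlinna_T_def)
qed

lemma nevanlinna_T_add_le:
  assumes "f meromorphic_on UNIV" "g meromorphic_on UNIV"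
  shows "eventually (\<lambda>r. nevanlinna_T r (\<lambda>z. f z + g z) \<le> nevanlinna_T r f + nevanlinna_T r g + ln 2) nev_filter"
  using eventually_circle_analytic[OF assms(1)] eventually_circle_analytic[OF assms(2)] eventually_nev_filter_ge[of 1]
proof eventually_elim
  case (elim r)
  have c: "continuous_on (sphere 0 r) f" "continuous_on (sphere 0 r) g"
    using elim by (auto intro!: continuous_on_regular)
  have "nevanlinna_m r (\<lambda>z. f z + g z) \<le> circle_mean r (\<lambda>z. (log_plus (norm (f z)) + log_plus (norm (g z))) + ln 2)"
    unfolding nevanlinna_m_eq
  proof (rule circle_mean_mono)
    fix w
    show "log_plus (norm (f w + g w)) \<le> (log_plus (norm (f w)) + log_plus (norm (g w))) + ln 2"
      using log_plus_mono[OF norm_triangle_ineq[of "f w" "g w"]] log_plus_add_le[of "norm (f w)" "norm (g w)"] by simp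
  qed (use elim c in \<open>auto intro!: continuous_intros\<close>)
  also have "\<dots> = circle_mean r (\<lambda>z. log_plus (norm (f z)) + log_plus (norm (g z))) + ln 2"
    by (subst circle_mean_add) (use elim c in \<open>auto intro!: continuous_intros\<close>)
  also have "circle_mean r (\<lambda>z. log_plus (norm (f z)) + log_plus (norm (g z))) = nevanlinna_m r f + nevanlinna_m r g"
    unfolding nevanlinna_m_eq by (rule circle_mean_add) (use elim c in \<open>auto intro!: continuous_intros\<close>)
  finally show ?case using nevanlinna_N_add_le[OF assms elim(3)] by (simp add: nevanlinna_T_def)
qed

lemma nevanlinna_T_inverse:
  assumes "nonzero_meromorphic h"
  shows "eventually (\<lambda>r. nevanlinna_T r (\<lambda>z. 1 / h z) = nevanlinna_T r h - ln (norm (zor_poly h 0 0))) nev_filter"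
  using eventually_regular_radius[OF assms] eventually_nev_filter_ge[of 1]
  by eventually_elim (use first_main_theorem[OF assms] in auto)

lemma nevanlinna_N_finite_poles:
  assumes h: "h meromorphic_on UNIV" and S: "finite S" "\<And>b. is_pole h b \<Longrightarrow> b \<in> S"
  shows "\<exists>A B. eventually (\<lambda>r. nevanlinna_N r h \<le> A * ln r + B) nev_filter"
proof -
  obtain \<rho> where \<rho>: "\<And>b. b \<in> S \<Longrightarrow> norm b \<le> \<rho>" using finite_imp_bounded[OF S(1)] by (auto simp: bounded_iff)
  have "eventually (\<lambda>r. nevanlinna_N r h \<le> (\<Sum>b\<in>S. real (pole_order h b)) * ln r + (\<Sum>b\<in>S. real (pole_order h b) * \<bar>ln (norm b)\<bar>)) nev_filter"
    using eventually_nev_filter_ge[of "max 1 \<rho>"]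
  proof eventually_elim
    case (elim r)
    have "nevanlinna_N r h = (\<Sum>b\<in>S. real (pole_order h b) * log_weight r b)"
      by (rule nevanlinna_N_eq[OF h _ S(1)]) (use elim \<rho> S in force)+
    also have "\<dots> \<le> (\<Sum>b\<in>S. real (pole_order h b) * (ln r + \<bar>ln (norm b)\<bar>))"
      by (intro sum_mono mult_left_mono) (use elim in \<open>auto simp: log_weight_def ln_div\<close>)
    finally show ?case by (simp add: distrib_left sum.distrib sum_distrib_right)
  qed
  thus ?thesis by blast
qed

text \<open>The plane minus a sparse closed set is still open and connected.\<close>

lemma deriv_zero_imp_constant:
  assumes h: "h meromorphic_on UNIV" and d: "eventually (\<lambda>z. deriv h z = 0) (cosparse UNIV)"
  shows "\<exists>c. eventually (\<lambda>z. h z = c) (cosparse UNIV)"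
proof -
  define S where "S = {z. \<not> (h analytic_on {z} \<and> deriv h z = 0)}"
  have ev: "eventually (\<lambda>z. h analytic_on {z} \<and> deriv h z = 0) (cosparse UNIV)"
    using meromorphic_on_imp_analytic_cosparse[OF h] d by eventually_elim auto
  hence S: "S sparse_in UNIV" by (simp add: eventually_cosparse S_def)
  have "connected (UNIV - S)" "open (UNIV - S)"
    using sparse_imp_connected[OF _ _ _ S] open_diff_sparse_pts[OF _ S] by (auto simp: connected_UNIV)
  moreover have "(h has_field_derivative 0) (at z)" if "z \<in> UNIV - S" for z
    using that analytic_derivI[of h z] by (auto simp: S_def)
  ultimately have "\<exists>c. \<forall>z\<in>UNIV - S. h z = c"
    using DERIV_zero_connected_constant[of "UNIV - S" "{}" h] holomorphic_on_imp_continuous_on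
    by (metis (no_types, lifting) DERIV_isCont Diff_empty continuous_at_imp_continuous_on finite.emptyI)
  then obtain c where c: "\<And>z. z \<notin> S \<Longrightarrow> h z = c" by auto
  have "eventually (\<lambda>z. h z = c) (cosparse UNIV)"
    using ev by eventually_elim (use c in \<open>auto simp: S_def\<close>)
  thus ?thesis by blast
qed

lemma nevanlinna_T_const: "nevanlinna_T r (\<lambda>_. c) = log_plus (norm c)"
  using nevanlinna_N_def[of r "\<lambda>_. c"] by (simp add: nevanlinna_T_def nevanlinna_m_eq pole_count_def)

text \<open>Relative to a comparison function \<open>\<tau>\<close>, the functions with \<open>T(r, h) = o(\<tau>)\<close> form a field, and those with
  few zeros and poles form a group on which the logarithmic derivative takes values in that field.\<close>

locale nevanlinna_scale =
  fixes \<tau> :: "real \<Rightarrow> real"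
  assumes ln_small: "ln \<in> o[nev_filter](\<tau>)"
begin

definition negligible_function :: "(complex \<Rightarrow> complex) \<Rightarrow> bool" where
  "negligible_function h \<longleftrightarrow> h meromorphic_on UNIV \<and> (\<lambda>r. nevanlinna_T r h) \<in> o[nev_filter](\<tau>)"

text \<open>The bound T = O(\<tau>) is what makes the term ln T of the logarithmic derivative lemma
  o(\<tau>).\<close>

definition near_unit :: "(complex \<Rightarrow> complex) \<Rightarrow> bool" where
  "near_unit h \<longleftrightarrow> nonzero_meromorphic h \<and> (\<lambda>r. nevanlinna_N r h) \<in> o[nev_filter](\<tau>) \<and>
     (\<lambda>r. nevanlinna_N r (\<lambda>z. 1 / h z)) \<in> o[nev_filter](\<tau>) \<and> (\<lambda>r. nevanlinna_T r h) \<in> O[nev_filter](\<tau>)"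

lemma smallo_le:
  fixes \<phi> \<psi> :: "real \<Rightarrow> real"
  assumes "\<psi> \<in> o[nev_filter](\<tau>)" "eventually (\<lambda>r. 0 \<le> \<phi> r \<and> \<phi> r \<le> \<psi> r) nev_filter"
  shows "\<phi> \<in> o[nev_filter](\<tau>)"
proof -
  have "\<phi> \<in> O[nev_filter](\<psi>)"
    by (rule bigoI[of _ 1]) (use assms(2) in \<open>auto elim!: eventually_mono\<close>)
  thus ?thesis using assms(1) landau_o.big_small_trans by blast
qed

lemma bigo_le:
  fixes \<phi> \<psi> :: "real \<Rightarrow> real"
  assumes "\<psi> \<in> O[nev_filter](\<tau>)" "eventually (\<lambda>r. 0 \<le> \<phi> r \<and> \<phi> r \<le> \<psi> r) nev_filter"
  shows "\<phi> \<in> O[nev_filter](\<tau>)"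
proof -
  have "\<phi> \<in> O[nev_filter](\<psi>)"
    by (rule bigoI[of _ 1]) (use assms(2) in \<open>auto elim!: eventually_mono\<close>)
  thus ?thesis using assms(1) landau_o.big_trans by blast
qed

lemma const_small: "(\<lambda>_. c :: real) \<in> o[nev_filter](\<tau>)"
proof -
  have "(\<lambda>_. c) \<in> O[nev_filter](\<lambda>r. ln r)"
  proof (rule bigoI[of _ "\<bar>c\<bar>"])
    show "eventually (\<lambda>r. norm c \<le> \<bar>c\<bar> * norm (ln r)) nev_filter"
      using eventually_nev_filter_ge[of "exp 1"]
    proof eventually_elim
      case (elim r)
      have "1 \<le> ln r" using elim by (subst ln_ge_iff) (auto intro: less_le_trans[OF exp_gt_zero])
      thus ?case using mult_left_mono[of 1 "\<bar>ln r\<bar>" "\<bar>c\<bar>"] by simp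
    qed
  qed
  thus ?thesis using ln_small landau_o.big_small_trans by blast
qed

lemma scale_at_top: "filterlim (\<lambda>r. \<bar>\<tau> r\<bar>) at_top nev_filter"
proof -
  have "eventually (\<lambda>r. ln r \<le> \<bar>\<tau> r\<bar>) nev_filter"
    using landau_o.smallD[OF ln_small, of 1] by (auto elim: eventually_mono)
  moreover have "filterlim ln at_top nev_filter"
    using ln_at_top nev_filter_le_at_top filterlim_mono by blast
  ultimately show ?thesis by (rule filterlim_at_top_mono[rotated])
qed

text \<open>ln (\<phi> r + r) is at most a constant plus ln |\<tau>| + ln r, and ln |\<tau>| =
  o(\<tau>) because |\<tau>| tends to infinity.\<close>

lemma ln_characteristic_small:
  assumes "\<phi> \<in> O[nev_filter](\<tau>)" "eventually (\<lambda>r. 0 \<le> \<phi> r) nev_filter"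
  shows "(\<lambda>r. ln (\<phi> r + r)) \<in> o[nev_filter](\<tau>)"
proof -
  obtain K where K: "K > 0" "eventually (\<lambda>r. norm (\<phi> r) \<le> K * norm (\<tau> r)) nev_filter"
    using landau_o.bigE[OF assms(1)] by blast
  have "(\<lambda>x :: real. ln x) \<in> o(\<lambda>x. x)"
    by (rule smalloI_tendsto[OF ln_x_over_x_tendsto_0]) (auto simp: eventually_at_top_dense)
  hence "(\<lambda>r. ln \<bar>\<tau> r\<bar>) \<in> o[nev_filter](\<lambda>r. \<bar>\<tau> r\<bar>)"
    by (rule landau_o.small.compose[OF _ scale_at_top])
  hence l: "(\<lambda>r. ln \<bar>\<tau> r\<bar>) \<in> o[nev_filter](\<tau>)" by simp
  have s: "(\<lambda>r. ln (K + 1) + ln \<bar>\<tau> r\<bar> + ln r) \<in> o[nev_filter](\<tau>)"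
    by (intro sum_in_smallo const_small l ln_small)
  have t1: "eventually (\<lambda>r. 1 \<le> \<bar>\<tau> r\<bar>) nev_filter"
    using scale_at_top by (auto simp: filterlim_at_top)
  have "eventually (\<lambda>r. 0 \<le> ln (\<phi> r + r) \<and> ln (\<phi> r + r) \<le> ln (K + 1) + ln \<bar>\<tau> r\<bar> + ln r) nev_filter"
    using K(2) t1 assms(2) eventually_nev_filter_ge[of 1]
  proof eventually_elim
    case (elim r)
    have "\<phi> r + r \<le> K * \<bar>\<tau> r\<bar> * r + 1 * r"
    proof -
      have "K * \<bar>\<tau> r\<bar> * 1 \<le> K * \<bar>\<tau> r\<bar> * r" using elim K(1) by (intro mult_left_mono) auto
      thus ?thesis using elim by simp
    qed
    also have "\<dots> \<le> K * \<bar>\<tau> r\<bar> * r + \<bar>\<tau> r\<bar> * r"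
      using elim by (intro add_left_mono mult_right_mono) auto
    also have "\<dots> = (K + 1) * \<bar>\<tau> r\<bar> * r" by (simp add: algebra_simps)
    finally have "ln (\<phi> r + r) \<le> ln ((K + 1) * \<bar>\<tau> r\<bar> * r)"
      by (subst ln_le_cancel_iff) (use elim K in auto)
    also have "\<dots> = ln (K + 1) + ln \<bar>\<tau> r\<bar> + ln r"
      using elim K by (subst ln_mult_pos, simp, simp, subst ln_mult_pos) auto
    finally show ?case using elim by simp
  qed
  thus ?thesis by (rule smallo_le[OF s])
qed

lemma eventually_T_nonneg: "h meromorphic_on UNIV \<Longrightarrow> eventually (\<lambda>r. 0 \<le> nevanlinna_T r h) nev_filter"
  using eventually_nevanlinna_nonneg[of h] by (auto elim!: eventually_mono simp: nevanlinna_T_def)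

lemma negligible_functionI:
  assumes "h meromorphic_on UNIV" "\<psi> \<in> o[nev_filter](\<tau>)" "eventually (\<lambda>r. nevanlinna_T r h \<le> \<psi> r) nev_filter"
  shows "negligible_function h"
proof -
  have "eventually (\<lambda>r. 0 \<le> nevanlinna_T r h \<and> nevanlinna_T r h \<le> \<psi> r) nev_filter"
    using eventually_T_nonneg[OF assms(1)] assms(3) by eventually_elim auto
  thus ?thesis using smallo_le[OF assms(2)] assms(1) by (simp add: negligible_function_def)
qed

lemma T_bigo_le:
  assumes "h meromorphic_on UNIV" "\<psi> \<in> O[nev_filter](\<tau>)" "eventually (\<lambda>r. nevanlinna_T r h \<le> \<psi> r) nev_filter"
  shows "(\<lambda>r. nevanlinna_T r h) \<in> O[nev_filter](\<tau>)"
proof (rule bigo_le[OF assms(2)])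
  show "eventually (\<lambda>r. 0 \<le> nevanlinna_T r h \<and> nevanlinna_T r h \<le> \<psi> r) nev_filter"
    using eventually_T_nonneg[OF assms(1)] assms(3) by eventually_elim auto
qed

lemma N_smallo_le:
  assumes "h meromorphic_on UNIV" "\<psi> \<in> o[nev_filter](\<tau>)" "eventually (\<lambda>r. nevanlinna_N r h \<le> \<psi> r) nev_filter"
  shows "(\<lambda>r. nevanlinna_N r h) \<in> o[nev_filter](\<tau>)"
proof (rule smallo_le[OF assms(2)])
  show "eventually (\<lambda>r. 0 \<le> nevanlinna_N r h \<and> nevanlinna_N r h \<le> \<psi> r) nev_filter"
    using eventually_nevanlinna_nonneg[OF assms(1)] assms(3) by eventually_elim auto
qed

lemma negligible_const [intro]: "negligible_function (\<lambda>_. c)"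
  using const_small by (auto simp: negligible_function_def nevanlinna_T_const)

lemma negligible_mult:
  assumes "negligible_function f" "negligible_function g"
  shows "negligible_function (\<lambda>z. f z * g z)"
proof -
  have m: "f meromorphic_on UNIV" "g meromorphic_on UNIV" using assms by (auto simp: negligible_function_def)
  show ?thesis
  proof (rule negligible_functionI[OF _ _ nevanlinna_T_mult_le[OF m]])
    show "(\<lambda>r. nevanlinna_T r f + nevanlinna_T r g) \<in> o[nev_filter](\<tau>)"
      using assms by (auto simp: negligible_function_def intro: sum_in_smallo)
  qed (intro meromorphic_intros m)
qed

lemma negligible_add:
  assumes "negligible_function f" "negligible_function g"
  shows "negligible_function (\<lambda>z. f z + g z)"
proof -
  have m: "f meromorphic_on UNIV" "g meromorphic_on UNIV" using assms by (auto simp: negligible_function_def)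
  show ?thesis
  proof (rule negligible_functionI[OF _ _ nevanlinna_T_add_le[OF m]])
    show "(\<lambda>r. nevanlinna_T r f + nevanlinna_T r g + ln 2) \<in> o[nev_filter](\<tau>)"
      using assms by (auto simp: negligible_function_def intro!: sum_in_smallo const_small)
  qed (intro meromorphic_intros m)
qed

lemma negligible_cong:
  assumes "negligible_function f" "eventually (\<lambda>z. f z = g z) (cosparse UNIV)"
  shows "negligible_function g"
proof -
  have "g meromorphic_on UNIV"
  proof -
    have "eventually (\<lambda>w. f w = g w) (at z)" for z
      by (rule eventually_cosparse_imp_eventually_at[OF assms(2)]) auto
    hence "f meromorphic_on UNIV \<longleftrightarrow> g meromorphic_on UNIV" by (intro meromorphic_on_cong) auto
    thus ?thesis using assms(1) by (simp add: negligible_function_def)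
  qed
  thus ?thesis using assms(1) landau_o.small.in_cong[OF nevanlinna_T_cong[OF assms(2)]]
    by (simp add: negligible_function_def)
qed

lemma negligible_inverse:
  assumes "negligible_function h" "nonzero_meromorphic h"
  shows "negligible_function (\<lambda>z. 1 / h z)"
proof -
  have "(\<lambda>r. nevanlinna_T r h - ln (norm (zor_poly h 0 0))) \<in> o[nev_filter](\<tau>)"
    using assms(1) by (auto simp: negligible_function_def intro!: sum_in_smallo const_small)
  hence "(\<lambda>r. nevanlinna_T r (\<lambda>z. 1 / h z)) \<in> o[nev_filter](\<tau>)"
    using landau_o.small.in_cong[OF nevanlinna_T_inverse[OF assms(2)]] by blast
  thus ?thesis using nonzero_meromorphic_at'(1)[OF nonzero_meromorphic_inverse[OF assms(2)]]
    by (simp add: negligible_function_def)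
qed

lemma N_negligible:
  assumes "negligible_function h"
  shows "(\<lambda>r. nevanlinna_N r h) \<in> o[nev_filter](\<tau>)"
proof (rule N_smallo_le)
  show "h meromorphic_on UNIV" "(\<lambda>r. nevanlinna_T r h) \<in> o[nev_filter](\<tau>)" using assms by (auto simp: negligible_function_def)
  show "eventually (\<lambda>r. nevanlinna_N r h \<le> nevanlinna_T r h) nev_filter"
    using eventually_nevanlinna_nonneg[of h] assms
    by (auto elim!: eventually_mono simp: nevanlinna_T_def negligible_function_def)
qed

lemma negligible_imp_near_unit:
  assumes "negligible_function h" "nonzero_meromorphic h"
  shows "near_unit h"
  using N_negligible[OF assms(1)] N_negligible[OF negligible_inverse[OF assms]] assms landau_o.small_imp_big
  by (auto simp: near_unit_def negligible_function_def)

lemma near_unit_inverse: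
  assumes "near_unit h" shows "near_unit (\<lambda>z. 1 / h z)"
proof -
  have h: "nonzero_meromorphic h" using assms by (simp add: near_unit_def)
  have "(\<lambda>r. nevanlinna_T r h - ln (norm (zor_poly h 0 0))) \<in> O[nev_filter](\<tau>)"
    using assms by (auto simp: near_unit_def intro!: sum_in_bigo const_small[THEN landau_o.small_imp_big])
  hence "(\<lambda>r. nevanlinna_T r (\<lambda>z. 1 / h z)) \<in> O[nev_filter](\<tau>)"
    using landau_o.big.in_cong[OF nevanlinna_T_inverse[OF h]] by blast
  thus ?thesis using assms nonzero_meromorphic_inverse[OF h] by (simp add: near_unit_def)
qed

lemma near_unit_mult:
  assumes "near_unit f" "near_unit g" shows "near_unit (\<lambda>z. f z * g z)"
proof -
  have nz: "nonzero_meromorphic f" "nonzero_meromorphic g" using assms by (auto simp: near_unit_def)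
  note m = nonzero_meromorphic_at'(1)[OF nz(1)] nonzero_meromorphic_at'(1)[OF nz(2)]
  note mi = nonzero_meromorphic_at'(1)[OF nonzero_meromorphic_inverse[OF nz(1)]]
    nonzero_meromorphic_at'(1)[OF nonzero_meromorphic_inverse[OF nz(2)]]
  have nfg: "nonzero_meromorphic (\<lambda>z. f z * g z)" by (rule nonzero_meromorphic_mult[OF nz])
  note mfg = nonzero_meromorphic_at'(1)[OF nfg]
  note mifg = nonzero_meromorphic_at'(1)[OF nonzero_meromorphic_inverse[OF nfg]]
  have "(\<lambda>r. nevanlinna_N r (\<lambda>z. f z * g z)) \<in> o[nev_filter](\<tau>)"
  proof (rule N_smallo_le[OF mfg])
    show "(\<lambda>r. nevanlinna_N r f + nevanlinna_N r g) \<in> o[nev_filter](\<tau>)"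
      using assms by (auto simp: near_unit_def intro: sum_in_smallo)
  qed (use eventually_nev_filter_ge[of 1] in eventually_elim, intro nevanlinna_N_mult_le m)
  moreover have "(\<lambda>r. nevanlinna_N r (\<lambda>z. 1 / (f z * g z))) \<in> o[nev_filter](\<tau>)"
  proof (rule N_smallo_le[OF mifg])
    show "(\<lambda>r. nevanlinna_N r (\<lambda>z. 1 / f z) + nevanlinna_N r (\<lambda>z. 1 / g z)) \<in> o[nev_filter](\<tau>)"
      using assms by (auto simp: near_unit_def intro: sum_in_smallo)
  qed (use eventually_nev_filter_ge[of 1] in eventually_elim, use nevanlinna_N_mult_le[OF mi] in simp)
  moreover have "(\<lambda>r. nevanlinna_T r (\<lambda>z. f z * g z)) \<in> O[nev_filter](\<tau>)"
  proof (rule T_bigo_le[OF mfg _ nevanlinna_T_mult_le[OF m]])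
    show "(\<lambda>r. nevanlinna_T r f + nevanlinna_T r g) \<in> O[nev_filter](\<tau>)"
      using assms by (auto simp: near_unit_def intro: sum_in_bigo)
  qed
  ultimately show ?thesis using nfg by (simp add: near_unit_def)
qed

lemma near_unit_cong:
  assumes "near_unit f" "eventually (\<lambda>z. f z = g z) (cosparse UNIV)"
  shows "near_unit g"
proof -
  have at: "eventually (\<lambda>w. f w = g w) (at z)" for z
    by (rule eventually_cosparse_imp_eventually_at[OF assms(2)]) auto
  have f: "nonzero_meromorphic f" using assms by (simp add: near_unit_def)
  have "nonzero_meromorphic g"
  proof (rule nonzero_meromorphicI)
    show "g meromorphic_on UNIV"
      using meromorphic_on_cong[of UNIV f g UNIV] at nonzero_meromorphic_at'(1)[OF f] by auto
    show "eventually (\<lambda>w. g w \<noteq> 0) (at 0)"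
      using at[of 0] nonzero_meromorphic_at'(3)[OF f, of 0] by eventually_elim auto
  qed
  moreover have "eventually (\<lambda>z. 1 / f z = 1 / g z) (cosparse UNIV)"
    using assms(2) by eventually_elim simp
  ultimately show ?thesis
    using assms(1) nevanlinna_N_cong[OF assms(2)] nevanlinna_N_cong[of "\<lambda>z. 1 / f z" "\<lambda>z. 1 / g z"]
      landau_o.big.in_cong[OF nevanlinna_T_cong[OF assms(2)]]
    by (simp add: near_unit_def)
qed

text \<open>The proximity part is the logarithmic derivative lemma; the poles are at most simple and
  sit at the few zeros and poles of \<open>h\<close>.\<close>

lemma negligible_log_deriv:
  assumes "near_unit h" shows "negligible_function (\<lambda>z. deriv h z / h z)"
proof -
  have h: "nonzero_meromorphic h" using assms by (simp add: near_unit_def)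
  note m = nonzero_meromorphic_at'(1)[OF h] nonzero_meromorphic_at'(1)[OF nonzero_meromorphic_inverse[OF h]]
  have md: "(\<lambda>z. deriv h z / h z) meromorphic_on UNIV" by (intro meromorphic_intros m)
  obtain C where C: "eventually (\<lambda>r. nevanlinna_m r (\<lambda>z. deriv h z / h z) \<le> C * (1 + ln (nevanlinna_T r h + r))) nev_filter"
    using log_derivative_lemma[OF h] by blast
  have "(\<lambda>r. C * (1 + ln (nevanlinna_T r h + r)) + (nevanlinna_N r h + nevanlinna_N r (\<lambda>z. 1 / h z))) \<in> o[nev_filter](\<tau>)"
  proof (intro sum_in_smallo)
    have "(\<lambda>r. 1 + ln (nevanlinna_T r h + r)) \<in> o[nev_filter](\<tau>)"
      using assms eventually_T_nonneg[OF m(1)]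
      by (intro sum_in_smallo const_small ln_characteristic_small) (auto simp: near_unit_def)
    thus "(\<lambda>r. C * (1 + ln (nevanlinna_T r h + r))) \<in> o[nev_filter](\<tau>)" by simp
  qed (use assms in \<open>auto simp: near_unit_def\<close>)
  moreover have "eventually (\<lambda>r. nevanlinna_T r (\<lambda>z. deriv h z / h z)
     \<le> C * (1 + ln (nevanlinna_T r h + r)) + (nevanlinna_N r h + nevanlinna_N r (\<lambda>z. 1 / h z))) nev_filter"
    using C eventually_nev_filter_ge[of 1]
  proof eventually_elim
    case (elim r)
    thus ?case using nevanlinna_N_le[OF md m elim(2) pole_order_log_deriv[OF h]] by (simp add: nevanlinna_T_def)
  qed
  ultimately show ?thesis by (rule negligible_functionI[OF md])
qed

text \<open>h' is the product of \<open>h\<close> and h' / h, which is negligible and not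
  identically zero, hence itself a near unit.\<close>

lemma deriv_near_unit:
  assumes "near_unit h" "nonzero_meromorphic (deriv h)"
  shows "near_unit (deriv h)"
proof -
  have h: "nonzero_meromorphic h" using assms by (simp add: near_unit_def)
  have ev: "eventually (\<lambda>z. h z * (deriv h z / h z) = deriv h z) (cosparse UNIV)"
    using nonzero_meromorphic_cosparse[OF h] by eventually_elim auto
  have "nonzero_meromorphic (\<lambda>z. deriv h z / h z)"
    using nonzero_meromorphic_mult[OF assms(2) nonzero_meromorphic_inverse[OF h]] by simp
  hence "near_unit (\<lambda>z. h z * (deriv h z / h z))"
    by (intro near_unit_mult assms negligible_imp_near_unit negligible_log_deriv)
  thus ?thesis using ev by (rule near_unit_cong)
qed

text \<open>The second main theorem for the values \<open>0\<close>, \<open>1\<close>, \<open>\<infinity>\<close>: with \<open>u = h' / h\<close> and \<open>v = h' / (h - 1)\<close> one has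
  \<open>u * h = v * (h - 1)\<close>, so that \<open>h\<close> is a rational expression in \<open>u\<close> and \<open>v\<close>.\<close>

lemma near_unit_pair_imp_negligible:
  assumes "near_unit h" "near_unit (\<lambda>z. h z - 1)"
  shows "negligible_function h"
proof -
  define h1 where "h1 z = h z - 1" for z
  define u where "u z = deriv h z / h z" for z
  define v where "v z = deriv h1 z / h1 z" for z
  have h: "nonzero_meromorphic h" "nonzero_meromorphic h1" using assms by (auto simp: near_unit_def h1_def[abs_def])
  have m: "h meromorphic_on UNIV" by (rule nonzero_meromorphic_at'(1)[OF h(1)])
  have s: "negligible_function u" "negligible_function v"
    unfolding u_def v_def using assms by (auto intro!: negligible_log_deriv simp: h1_def[abs_def])
  define w where "w z = v z + (-1) * u z" for z
  have w: "negligible_function w" unfolding w_def by (intro negligible_add negligible_mult negligible_const s)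
  have ev: "eventually (\<lambda>z. deriv h z = u z * h z \<and> deriv h z = v z * (h z - 1) \<and> h z \<noteq> 0 \<and> h z \<noteq> 1) (cosparse UNIV)"
    using nonzero_meromorphic_cosparse[OF h(1)] nonzero_meromorphic_cosparse[OF h(2)]
  proof eventually_elim
    case (elim z)
    have "(h1 has_field_derivative deriv h z) (at z)"
      unfolding h1_def[abs_def] using elim by (auto intro!: derivative_eq_intros analytic_derivI)
    hence "deriv h1 z = deriv h z" by (rule DERIV_imp_deriv)
    thus ?case using elim by (auto simp: u_def v_def h1_def)
  qed
  show ?thesis
  proof (cases "eventually (\<lambda>z. w z = 0) (cosparse UNIV)")
    case False
    hence nw: "nonzero_meromorphic w" using w by (simp add: nonzero_meromorphic_def negligible_function_def)
    have "negligible_function (\<lambda>z. v z * (1 / w z))" by (intro negligible_mult s negligible_inverse w nw)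
    moreover have "eventually (\<lambda>z. v z * (1 / w z) = h z) (cosparse UNIV)"
      using ev nonzero_meromorphic_cosparse[OF nw]
    proof eventually_elim
      case (elim z)
      hence "u z * h z = v z * (h z - 1)" by metis
      hence "v z = h z * w z" by (simp add: w_def algebra_simps)
      thus ?case using elim by simp
    qed
    ultimately show ?thesis by (rule negligible_cong)
  next
    case True
    \<comment> \<open>If u = v, then u h = u (h - 1) forces u = 0, and \<open>h\<close> is
      constant.\<close>
    have "eventually (\<lambda>z. deriv h z = 0) (cosparse UNIV)"
      using True ev
    proof eventually_elim
      case (elim z)
      have "v z = u z" using elim by (simp add: w_def)
      hence "u z * h z = u z * (h z - 1)" using elim by metis
      hence "u z = 0" by (simp add: algebra_simps)
      thus ?case using elim by simp
    qed
    then obtain c where "eventually (\<lambda>z. h z = c) (cosparse UNIV)"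
      using deriv_zero_imp_constant[OF m] by blast
    hence "eventually (\<lambda>z. c = h z) (cosparse UNIV)" by eventually_elim simp
    thus ?thesis by (rule negligible_cong[OF negligible_const])
  qed
qed

text \<open>The quotient telescopes into the logarithmic derivatives of the lower derivatives, each
  again a near unit.\<close>

lemma higher_deriv_near_unit:
  assumes h: "near_unit h" and nz: "\<And>j. j \<le> k \<Longrightarrow> nonzero_meromorphic ((deriv ^^ j) h)"
  shows "near_unit ((deriv ^^ k) h) \<and> negligible_function (\<lambda>z. (deriv ^^ k) h z / h z)"
  using nz
proof (induction k)
  case 0
  have "eventually (\<lambda>z. 1 = (deriv ^^ 0) h z / h z) (cosparse UNIV)"
    using nonzero_meromorphic_cosparse[of h] h by (auto simp: near_unit_def elim!: eventually_mono)
  thus ?case using h negligible_cong[OF negligible_const[of 1]] by simp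
next
  case (Suc k)
  let ?d = "(deriv ^^ k) h"
  have IH: "near_unit ?d" "negligible_function (\<lambda>z. ?d z / h z)" using Suc by auto
  have "near_unit (deriv ?d)" using deriv_near_unit[OF IH(1)] Suc.prems[of "Suc k"] by simp
  moreover have "negligible_function (\<lambda>z. deriv ?d z / h z)"
  proof (rule negligible_cong)
    show "negligible_function (\<lambda>z. (?d z / h z) * (deriv ?d z / ?d z))"
      by (intro negligible_mult IH negligible_log_deriv)
    show "eventually (\<lambda>z. (?d z / h z) * (deriv ?d z / ?d z) = deriv ?d z / h z) (cosparse UNIV)"
      using nonzero_meromorphic_cosparse[OF Suc.prems[of k]] by (auto elim!: eventually_mono)
  qed
  ultimately show ?case by simp
qed

text \<open>If the next derivative vanished, the current one would be a constant c. Dividing c by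
  its negligible quotient with \<open>h\<close> would show that \<open>h\<close> is
  negligible.\<close>

lemma higher_deriv_nonzero:
  assumes h: "near_unit h" "\<not> negligible_function h"
  shows "nonzero_meromorphic ((deriv ^^ k) h)"
proof (induction k rule: less_induct)
  case (less k)
  show ?case
  proof (cases k)
    case 0
    thus ?thesis using h by (simp add: near_unit_def)
  next
    case (Suc j)
    let ?d = "(deriv ^^ j) h"
    have nz: "nonzero_meromorphic ((deriv ^^ i) h)" if "i \<le> j" for i using less[of i] that Suc by simp
    have d: "near_unit ?d" "negligible_function (\<lambda>z. ?d z / h z)" using higher_deriv_near_unit[OF h(1) nz] by auto
    have dm: "?d meromorphic_on UNIV" by (rule nonzero_meromorphic_at'(1)[OF nz[OF order_refl]])
    have False if d0: "eventually (\<lambda>z. deriv ?d z = 0) (cosparse UNIV)"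
    proof -
      obtain c where c: "eventually (\<lambda>z. ?d z = c) (cosparse UNIV)"
        using deriv_zero_imp_constant[OF dm d0] by blast
      have hn: "nonzero_meromorphic h" using h by (simp add: near_unit_def)
      have "nonzero_meromorphic (\<lambda>z. ?d z * (1 / h z))"
        by (intro nonzero_meromorphic_mult nonzero_meromorphic_inverse nz hn order_refl)
      hence "negligible_function (\<lambda>z. c * (1 / (?d z / h z)))"
        by (intro negligible_mult negligible_const negligible_inverse d) simp
      moreover have "eventually (\<lambda>z. c * (1 / (?d z / h z)) = h z) (cosparse UNIV)"
        using c nonzero_meromorphic_cosparse[OF nz[OF order_refl]] by eventually_elim auto
      ultimately have "negligible_function h" by (rule negligible_cong)
      thus False using h by blast
    qed
    moreover have "deriv ?d meromorphic_on UNIV" by (intro meromorphic_intros dm)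
    ultimately show ?thesis using Suc by (auto simp: nonzero_meromorphic_def)
  qed
qed

text \<open>H - 1 = G / a can vanish only at zeros of \<open>G\<close>, finitely many, or at poles
  of the small function \<open>a\<close>. Once \<open>H\<close> is negligible, multiplying by
  \<open>a\<close> and dividing by the negligible quotient of the k-th derivative by
  \<open>g\<close> recovers the product.\<close>

lemma negligible_square_mult:
  assumes f: "near_unit f" and g: "near_unit g" and gk: "\<And>j. j \<le> k \<Longrightarrow> nonzero_meromorphic ((deriv ^^ j) g)"
    and a: "negligible_function a" "nonzero_meromorphic a"
    and fin: "finite (zeros_of (\<lambda>z. (f z)\<^sup>2 * (deriv ^^ k) g z - a z))"
  shows "negligible_function (\<lambda>z. f z * f z * g z)"
proof -
  let ?d = "(deriv ^^ k) g"
  have d: "near_unit ?d" "negligible_function (\<lambda>z. ?d z / g z)" using higher_deriv_near_unit[OF g gk] by auto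
  have nz: "nonzero_meromorphic g" "nonzero_meromorphic ?d" using g gk by (auto simp: near_unit_def)
  define F where "F z = f z * f z * ?d z" for z
  define G where "G z = F z - a z" for z
  define H where "H z = F z * (1 / a z)" for z
  have F: "near_unit F" unfolding F_def by (intro near_unit_mult f d)
  have H: "near_unit H" unfolding H_def by (intro near_unit_mult F near_unit_inverse negligible_imp_near_unit a)
  have mH: "H meromorphic_on UNIV" using H nonzero_meromorphic_at'(1) by (auto simp: near_unit_def)
  have mF: "F meromorphic_on UNIV" using F nonzero_meromorphic_at'(1) by (auto simp: near_unit_def)
  have ma: "a meromorphic_on UNIV" by (rule nonzero_meromorphic_at'(1)[OF a(2)])
  have finG: "finite (zeros_of G)" using fin by (simp add: G_def[abs_def] F_def power2_eq_square)
  have mG: "G meromorphic_on UNIV" unfolding G_def by (intro meromorphic_intros mF ma)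
  have nG: "nonzero_meromorphic G"
  proof -
    \<comment> \<open>An identically vanishing \<open>G\<close> would have every point as a zero in
      the limit sense.\<close>
    have False if "eventually (\<lambda>z. G z = 0) (cosparse UNIV)"
    proof -
      have "G \<midarrow>z\<rightarrow> 0" for z
        by (rule tendsto_eventually, rule eventually_cosparse_imp_eventually_at[OF that]) auto
      hence "zeros_of G = UNIV" by (auto simp: zeros_of_def)
      thus False using finG infinite_UNIV_char_0[where ?'a = complex] by simp
    qed
    thus ?thesis using mG by (auto simp: nonzero_meromorphic_def)
  qed
  have H1: "eventually (\<lambda>z. H z - 1 = G z * (1 / a z)) (cosparse UNIV)"
    using nonzero_meromorphic_cosparse[OF a(2)] by eventually_elim (auto simp: H_def G_def diff_divide_distrib)
  have nH1: "nonzero_meromorphic (\<lambda>z. H z + (-1))"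
  proof (rule nonzero_meromorphicI)
    show "(\<lambda>z. H z + (-1)) meromorphic_on UNIV" by (intro meromorphic_intros mH)
    have "eventually (\<lambda>z. H z - 1 = G z * (1 / a z)) (at 0)"
      by (rule eventually_cosparse_imp_eventually_at[OF H1]) auto
    thus "eventually (\<lambda>z. H z + (-1) \<noteq> 0) (at 0)"
      using nonzero_meromorphic_at'(3)[OF nG, of 0] nonzero_meromorphic_at'(3)[OF a(2), of 0]
      by eventually_elim auto
  qed
  note mH1 = nonzero_meromorphic_at'(1)[OF nH1] nonzero_meromorphic_at'(1)[OF nonzero_meromorphic_inverse[OF nH1]]
  have mc: "(\<lambda>_. -1 :: complex) meromorphic_on UNIV" by (rule meromorphic_on_const)
  have "near_unit (\<lambda>z. H z + (-1))" unfolding near_unit_def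
  proof (intro conjI nH1)
    show "(\<lambda>r. nevanlinna_N r (\<lambda>z. H z + (-1))) \<in> o[nev_filter](\<tau>)"
    proof (rule N_smallo_le[OF mH1(1)])
      show "(\<lambda>r. nevanlinna_N r H + nevanlinna_N r (\<lambda>_. -1)) \<in> o[nev_filter](\<tau>)"
        using H N_negligible[OF negligible_const] by (auto simp: near_unit_def intro!: sum_in_smallo)
    qed (use eventually_nev_filter_ge[of 1] in eventually_elim, rule nevanlinna_N_add_le[OF mH mc])
    show "(\<lambda>r. nevanlinna_T r (\<lambda>z. H z + (-1))) \<in> O[nev_filter](\<tau>)"
    proof (rule T_bigo_le[OF mH1(1) _ nevanlinna_T_add_le[OF mH mc]])
      have "(\<lambda>r. nevanlinna_T r (\<lambda>_. -1)) \<in> O[nev_filter](\<tau>)"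
        unfolding nevanlinna_T_const by (rule landau_o.small_imp_big[OF const_small])
      thus "(\<lambda>r. nevanlinna_T r H + nevanlinna_T r (\<lambda>_. -1) + ln 2) \<in> O[nev_filter](\<tau>)"
        using H by (intro sum_in_bigo landau_o.small_imp_big[OF const_small]) (auto simp: near_unit_def)
    qed
    show "(\<lambda>r. nevanlinna_N r (\<lambda>z. 1 / (H z + (-1)))) \<in> o[nev_filter](\<tau>)"
    proof -
      have miG: "(\<lambda>z. 1 / G z) meromorphic_on UNIV"
        by (rule nonzero_meromorphic_at'(1)[OF nonzero_meromorphic_inverse[OF nG]])
      \<comment> \<open>The limit definition of zeros fits here: at a pole of 1 / G,
        \<open>G\<close> tends to 0 whatever its value there.\<close>
      have pole: "b \<in> zeros_of G" if "is_pole (\<lambda>z. 1 / G z) b" for b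
      proof -
        have "((\<lambda>z. inverse (1 / G z)) \<longlongrightarrow> 0) (at b)"
          using that tendsto_inverse_0 filterlim_compose unfolding is_pole_def by blast
        thus ?thesis by (simp add: zeros_of_def)
      qed
      obtain A B where AB: "eventually (\<lambda>r. nevanlinna_N r (\<lambda>z. 1 / G z) \<le> A * ln r + B) nev_filter"
        using nevanlinna_N_finite_poles[OF miG finG pole] by blast
      have "eventually (\<lambda>z. 1 / (H z + (-1)) = a z * (1 / G z)) (cosparse UNIV)"
        using H1 by eventually_elim auto
      hence eq: "nevanlinna_N r (\<lambda>z. 1 / (H z + (-1))) = nevanlinna_N r (\<lambda>z. a z * (1 / G z))" for r
        by (rule nevanlinna_N_cong)
      show ?thesis
      proof (rule N_smallo_le[OF mH1(2)])
        show "(\<lambda>r. nevanlinna_N r a + (A * ln r + B)) \<in> o[nev_filter](\<tau>)"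
          by (intro sum_in_smallo N_negligible a const_small) (use ln_small in simp)
        show "eventually (\<lambda>r. nevanlinna_N r (\<lambda>z. 1 / (H z + (-1))) \<le> nevanlinna_N r a + (A * ln r + B)) nev_filter"
          using AB eventually_nev_filter_ge[of 1]
        proof eventually_elim
          case (elim r)
          show ?case using nevanlinna_N_mult_le[OF ma miG elim(2)] elim(1) eq by simp
        qed
      qed
    qed
  qed
  hence sH: "negligible_function H" using near_unit_pair_imp_negligible[OF H] by simp
  have "nonzero_meromorphic (\<lambda>z. ?d z * (1 / g z))"
    by (intro nonzero_meromorphic_mult nonzero_meromorphic_inverse nz)
  hence "negligible_function (\<lambda>z. H z * a z * (1 / (?d z / g z)))"
    by (intro negligible_mult sH a negligible_inverse d) simp
  moreover have "eventually (\<lambda>z. H z * a z * (1 / (?d z / g z)) = f z * f z * g z) (cosparse UNIV)"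
    using nonzero_meromorphic_cosparse[OF a(2)] nonzero_meromorphic_cosparse[OF nz(2)]
    by eventually_elim (auto simp: H_def F_def)
  ultimately show ?thesis by (rule negligible_cong)
qed

text \<open>f^3 is a quotient of the two products. Its smallness is only needed for m(r, f), as N(r,
  f) is already small for a near unit.\<close>

lemma T_small_of_cross_products:
  assumes f: "near_unit f" and g: "near_unit g"
    and X: "negligible_function (\<lambda>z. f z * f z * g z)" and Y: "negligible_function (\<lambda>z. g z * g z * f z)"
  shows "(\<lambda>r. nevanlinna_T r f) \<in> o[nev_filter](\<tau>)"
proof -
  have nz: "nonzero_meromorphic f" "nonzero_meromorphic g" using f g by (auto simp: near_unit_def)
  note fm = nonzero_meromorphic_at'(1)[OF nz(1)]
  have nY: "nonzero_meromorphic (\<lambda>z. g z * g z * f z)" by (intro nonzero_meromorphic_mult nz)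
  have "negligible_function (\<lambda>z. (f z * f z * g z) * (f z * f z * g z) * (1 / (g z * g z * f z)))"
    by (intro negligible_mult X negligible_inverse Y nY)
  moreover have "eventually (\<lambda>z. (f z * f z * g z) * (f z * f z * g z) * (1 / (g z * g z * f z)) = f z ^ 3) (cosparse UNIV)"
    using nonzero_meromorphic_cosparse[OF nz(1)] nonzero_meromorphic_cosparse[OF nz(2)]
    by eventually_elim (auto simp: field_simps power3_eq_cube)
  ultimately have c: "negligible_function (\<lambda>z. f z ^ 3)" by (rule negligible_cong)
  show ?thesis
  proof (rule smallo_le)
    show "(\<lambda>r. nevanlinna_T r (\<lambda>z. f z ^ 3) + nevanlinna_N r f) \<in> o[nev_filter](\<tau>)"
      using c f by (auto simp: near_unit_def negligible_function_def intro: sum_in_smallo)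
    have cm: "(\<lambda>z. f z ^ 3) meromorphic_on UNIV" using c by (simp add: negligible_function_def)
    show "eventually (\<lambda>r. 0 \<le> nevanlinna_T r f \<and> nevanlinna_T r f \<le> nevanlinna_T r (\<lambda>z. f z ^ 3) + nevanlinna_N r f) nev_filter"
      using eventually_nevanlinna_nonneg[OF fm] eventually_nevanlinna_nonneg[OF cm] eventually_regular_radius[OF nz(1)] eventually_nev_filter_ge[of 1]
    proof eventually_elim
      case (elim r)
      have "nevanlinna_m r (\<lambda>z. f z ^ 3) = circle_mean r (\<lambda>z. 3 * log_plus (norm (f z)))"
        by (simp add: nevanlinna_m_eq norm_power log_plus_power)
      also have "\<dots> = 3 * nevanlinna_m r f" unfolding nevanlinna_m_eq
        by (rule circle_mean_cmult) (use regular_radiusD[OF elim(3)] elim in \<open>auto intro!: continuous_intros\<close>)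
      finally show ?case using elim by (simp add: nevanlinna_T_def)
    qed
  qed
qed

end

section \<open>From the hypotheses to the common scale\<close>

lemma nevanlinna_S_imp_smallo:
  assumes "\<phi> \<in> nevanlinna_S f"
  shows "\<phi> \<in> o[nev_filter](\<lambda>r. nevanlinna_T r f)"
  using assms landau_o.small.filter_mono[OF nev_filter_le] unfolding nevanlinna_S_def by blast

lemma (in nevanlinna_scale) near_unitI:
  assumes f: "nonzero_meromorphic f"
    and S: "(\<lambda>r. nevanlinna_N r f + nevanlinna_N r (\<lambda>z. 1 / f z)) \<in> nevanlinna_S f"
    and T: "(\<lambda>r. nevanlinna_T r f) \<in> O[nev_filter](\<tau>)"
  shows "near_unit f"
proof -
  have s: "(\<lambda>r. nevanlinna_N r f + nevanlinna_N r (\<lambda>z. 1 / f z)) \<in> o[nev_filter](\<tau>)"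
    using nevanlinna_S_imp_smallo[OF S] T landau_o.small_big_trans by blast
  note m = nonzero_meromorphic_at'(1)[OF f] nonzero_meromorphic_at'(1)[OF nonzero_meromorphic_inverse[OF f]]
  have "eventually (\<lambda>r. 0 \<le> nevanlinna_N r f \<and> 0 \<le> nevanlinna_N r (\<lambda>z. 1 / f z)) nev_filter"
    using eventually_nevanlinna_nonneg[OF m(1)] eventually_nevanlinna_nonneg[OF m(2)] by eventually_elim auto
  hence "(\<lambda>r. nevanlinna_N r f) \<in> o[nev_filter](\<tau>)" "(\<lambda>r. nevanlinna_N r (\<lambda>z. 1 / f z)) \<in> o[nev_filter](\<tau>)"
    by (auto intro!: smallo_le[OF s] elim: eventually_mono)
  thus ?thesis using f T by (simp add: near_unit_def)
qed

text \<open>Here \<open>f\<close> is measured against its own characteristic, for which it cannot be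
  negligible. Against the common scale it might be, if the other function grew much faster.\<close>

lemma higher_deriv_transcendental:
  assumes f: "transcendental_meromorphic f"
    and S: "(\<lambda>r. nevanlinna_N r f + nevanlinna_N r (\<lambda>z. 1 / f z)) \<in> nevanlinna_S f"
  shows "nonzero_meromorphic ((deriv ^^ k) f)"
proof -
  interpret nevanlinna_scale "\<lambda>r. nevanlinna_T r f"
    by unfold_locales (rule ln_smallo_characteristic[OF f])
  have "near_unit f" by (rule near_unitI[OF transcendental_nonzero_meromorphic[OF f] S]) simp
  moreover have "\<not> negligible_function f"
  proof
    assume "negligible_function f"
    hence "eventually (\<lambda>r. nevanlinna_T r f = 0) nev_filter"
      by (simp add: negligible_function_def landau_o.small_refl_iff)
    moreover have "eventually (\<lambda>r. 1 \<le> \<bar>nevanlinna_T r f\<bar>) nev_filter"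
      using scale_at_top by (auto simp: filterlim_at_top)
    ultimately have "eventually (\<lambda>r. False) nev_filter" by eventually_elim auto
    thus False using nev_filter_not_bot by (simp add: eventually_False)
  qed
  ultimately show ?thesis by (rule higher_deriv_nonzero)
qed

theorem theoremA:
  fixes k :: nat and f g a :: "complex \<Rightarrow> complex"
  assumes "k \<ge> 1"
    and "transcendental_meromorphic f"
    and "transcendental_meromorphic g"
    and "(\<lambda>r. nevanlinna_N r f + nevanlinna_N r (\<lambda>z. 1 / f z)) \<in> nevanlinna_S f"
    and "(\<lambda>r. nevanlinna_N r g + nevanlinna_N r (\<lambda>z. 1 / g z)) \<in> nevanlinna_S g"
    and "a meromorphic_on UNIV"
    and "\<not> (\<forall>\<^sub>\<approx>z\<in>UNIV. a z = 0)"
    and "small_function a f"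
    and "small_function a g"
  shows "infinite (zeros_of (\<lambda>z. (f z)^2 * (deriv ^^ k) g z - a z)) \<or>
         infinite (zeros_of (\<lambda>z. (g z)^2 * (deriv ^^ k) f z - a z))"
proof (rule ccontr)
  assume "\<not> ?thesis"
  hence fin: "finite (zeros_of (\<lambda>z. (f z)^2 * (deriv ^^ k) g z - a z))"
    "finite (zeros_of (\<lambda>z. (g z)^2 * (deriv ^^ k) f z - a z))" by auto
  define \<tau> where "\<tau> r = nevanlinna_T r f + nevanlinna_T r g" for r
  note nz = transcendental_nonzero_meromorphic[OF assms(2)] transcendental_nonzero_meromorphic[OF assms(3)]
  have na: "nonzero_meromorphic a" using assms by (simp add: nonzero_meromorphic_def)
  have nonneg: "eventually (\<lambda>r. 0 \<le> nevanlinna_T r f \<and> 0 \<le> nevanlinna_T r g) nev_filter"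
    using eventually_nevanlinna_nonneg[OF nonzero_meromorphic_at'(1)[OF nz(1)]] eventually_nevanlinna_nonneg[OF nonzero_meromorphic_at'(1)[OF nz(2)]]
    by eventually_elim (auto simp: nevanlinna_T_def)
  have T: "(\<lambda>r. nevanlinna_T r f) \<in> O[nev_filter](\<tau>)" "(\<lambda>r. nevanlinna_T r g) \<in> O[nev_filter](\<tau>)"
    by (rule bigoI[of _ 1]; use nonneg in \<open>auto elim!: eventually_mono simp: \<tau>_def\<close>)+
  interpret nevanlinna_scale \<tau>
    by unfold_locales (rule landau_o.small_big_trans[OF ln_smallo_characteristic[OF assms(2)] T(1)])
  have u: "near_unit f" "near_unit g"
    by (rule near_unitI[OF nz(1) assms(4) T(1)], rule near_unitI[OF nz(2) assms(5) T(2)])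
  have a: "negligible_function a"
    using nevanlinna_S_imp_smallo[of _ f] T(1) landau_o.small_big_trans assms(8)
    unfolding negligible_function_def small_function_def by blast
  have X: "negligible_function (\<lambda>z. f z * f z * g z)" "negligible_function (\<lambda>z. g z * g z * f z)"
    by (rule negligible_square_mult[OF u(1,2) higher_deriv_transcendental[OF assms(3,5)] a na fin(1)],
        rule negligible_square_mult[OF u(2,1) higher_deriv_transcendental[OF assms(2,4)] a na fin(2)])
  have "(\<lambda>r. nevanlinna_T r f + nevanlinna_T r g) \<in> o[nev_filter](\<tau>)"
    by (intro sum_in_smallo T_small_of_cross_products[OF u X] T_small_of_cross_products[OF u(2,1) X(2,1)])
  hence "eventually (\<lambda>r. \<tau> r = 0) nev_filter"
    unfolding \<tau>_def[symmetric] by (simp add: landau_o.small_refl_iff)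
  moreover have "eventually (\<lambda>r. 1 \<le> \<bar>\<tau> r\<bar>) nev_filter"
    using scale_at_top by (auto simp: filterlim_at_top)
  ultimately have "eventually (\<lambda>r. False) nev_filter" by eventually_elim auto
  thus False using nev_filter_not_bot by (simp add: eventually_False)
qed

end
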